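(* Let $k$ be a field, $K$ a finite separable field extension of $k$, $\Lambda$ a $k$-algebra and $\Gamma=K\otimes_k\Lambda$. Let $M\in\operatorname{mod}\Gamma$. Then the multiplication map $$\mu_M:K\otimes_k M\to M,\qquad x\otimes m\mapsto xm,$$ is a split epimorphism of $\Gamma$-modules. Furthermore, if $K$ is a normal extension of $k$, then there is an isomorphism of $\Gamma$-modules $$K\otimes_k M\simeq\bigoplus_{\phi\in G(K/k)}M^\phi.$$
   Context: For a $k$-algebra $R$, $\operatorname{mod} R$ denotes the category of finite-dimensional (over $k$) left $R$-modules. $\Lambda$ is regarded as a subring of $\Gamma=K\otimes_k\Lambda$ via $\lambda\mapsto 1\otimes\lambda$, so every $\Gamma$-module is also a $\Lambda$-module; likewise, for a $\Gamma$-module $M$, $x\in K$ and $m\in M$, $xm$ means $(x\otimes 1)\cdot m$. For any $\Lambda$-module $M$ (in particular for a $\Gamma$-module regarded as a $\Lambda$-module), $K\otimes_k M$ is a $\Gamma$-module via $(x\otimes\lambda)\cdot(y\otimes m)=xy\otimes\lambda m$. When $K$ is a normal extension of $k$, $G(K/k)$ denotes its Galois group, i.e. the group of $k$-automorphisms of $K$. For a $k$-automorphism $\phi$ of $K$ and a $\Gamma$-module $M$, $M^\phi$ denotes the $\Gamma$-module that equals $M$ as a $k$-space, with multiplication given by $(x\otimes\lambda)\cdot_{M^\phi}m=(\phi(x)\otimes\lambda)\cdot_M m$. *)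

theory Defs
  imports "HOL-Algebra.Algebra"
begin

text \<open>The locale \<^locale>\<open>algebra\<close> of HOL-Algebra is restricted to commutative algebras, and
  \<^locale>\<open>module\<close> to commutative scalar rings. The next two locales do not require commutativity.
  The components \<^const>\<open>monoid.mult\<close> and \<^const>\<open>monoid.one\<close> of a record that is used
  as a module carry no information.\<close>

locale assoc_algebra = module + ring M +
  assumes smult_mult_left:
      "\<lbrakk>a \<in> carrier R; x \<in> carrier M; y \<in> carrier M\<rbrakk> \<Longrightarrow>
      (a \<odot>\<^bsub>M\<^esub> x) \<otimes>\<^bsub>M\<^esub> y = a \<odot>\<^bsub>M\<^esub> (x \<otimes>\<^bsub>M\<^esub> y)"
    and smult_mult_right:
      "\<lbrakk>a \<in> carrier R; x \<in> carrier M; y \<in> carrier M\<rbrakk> \<Longrightarrow>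
      x \<otimes>\<^bsub>M\<^esub> (a \<odot>\<^bsub>M\<^esub> y) = a \<odot>\<^bsub>M\<^esub> (x \<otimes>\<^bsub>M\<^esub> y)"

locale left_module = R?: ring R + M?: abelian_group M
  for R :: "('r, 'x) ring_scheme" (structure) and M :: "('r, 'm, 'y) module_scheme" (structure) +
  assumes smult_closed:
      "\<lbrakk>a \<in> carrier R; x \<in> carrier M\<rbrakk> \<Longrightarrow> a \<odot>\<^bsub>M\<^esub> x \<in> carrier M"
    and smult_l_distr:
      "\<lbrakk>a \<in> carrier R; b \<in> carrier R; x \<in> carrier M\<rbrakk> \<Longrightarrow>
      (a \<oplus> b) \<odot>\<^bsub>M\<^esub> x = a \<odot>\<^bsub>M\<^esub> x \<oplus>\<^bsub>M\<^esub> b \<odot>\<^bsub>M\<^esub> x"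
    and smult_r_distr:
      "\<lbrakk>a \<in> carrier R; x \<in> carrier M; y \<in> carrier M\<rbrakk> \<Longrightarrow>
      a \<odot>\<^bsub>M\<^esub> (x \<oplus>\<^bsub>M\<^esub> y) = a \<odot>\<^bsub>M\<^esub> x \<oplus>\<^bsub>M\<^esub> a \<odot>\<^bsub>M\<^esub> y"
    and smult_assoc:
      "\<lbrakk>a \<in> carrier R; b \<in> carrier R; x \<in> carrier M\<rbrakk> \<Longrightarrow>
      (a \<otimes> b) \<odot>\<^bsub>M\<^esub> x = a \<odot>\<^bsub>M\<^esub> (b \<odot>\<^bsub>M\<^esub> x)"
    and smult_one: "x \<in> carrier M \<Longrightarrow> \<one> \<odot>\<^bsub>M\<^esub> x = x"

definition left_module_hom ::
  "('r, 'x) ring_scheme \<Rightarrow> ('r, 'm, 'y) module_scheme \<Rightarrow> ('r, 'n, 'z) module_scheme \<Rightarrow> ('m \<Rightarrow> 'n) set"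
  where "left_module_hom R M N =
    {h \<in> carrier M \<rightarrow> carrier N.
      (\<forall>x\<in>carrier M. \<forall>y\<in>carrier M. h (x \<oplus>\<^bsub>M\<^esub> y) = h x \<oplus>\<^bsub>N\<^esub> h y) \<and>
      (\<forall>a\<in>carrier R. \<forall>x\<in>carrier M. h (a \<odot>\<^bsub>M\<^esub> x) = a \<odot>\<^bsub>N\<^esub> h x)}"

definition left_module_iso ::
  "('r, 'x) ring_scheme \<Rightarrow> ('r, 'm, 'y) module_scheme \<Rightarrow> ('r, 'n, 'z) module_scheme \<Rightarrow> ('m \<Rightarrow> 'n) set"
  where "left_module_iso R M N =
    {h \<in> left_module_hom R M N. bij_betw h (carrier M) (carrier N)}"

definition split_epimorphism ::
  "('r, 'x) ring_scheme \<Rightarrow> ('r, 'm, 'y) module_scheme \<Rightarrow> ('r, 'n, 'z) module_scheme \<Rightarrow> ('m \<Rightarrow> 'n) \<Rightarrow> bool"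
  where "split_epimorphism R M N h \<longleftrightarrow>
    h \<in> left_module_hom R M N \<and>
    (\<exists>s\<in>left_module_hom R N M. \<forall>y\<in>carrier N. h (s y) = y)"

definition restrict_scalars ::
  "('s \<Rightarrow> 'r) \<Rightarrow> ('r, 'm, 'y) module_scheme \<Rightarrow> ('s, 'm) module"
  where "restrict_scalars f M =
    \<lparr>carrier = carrier M, monoid.mult = monoid.mult M, monoid.one = monoid.one M,
     ring.zero = ring.zero M, ring.add = ring.add M,
     smult = (\<lambda>s x. f s \<odot>\<^bsub>M\<^esub> x)\<rparr>"

text \<open>The \<open>F\<close>-module underlying a module over the \<open>F\<close>-algebra \<open>A\<close>.\<close>

definition underlying_module ::
  "('f, 'r, 'x) module_scheme \<Rightarrow> ('r, 'm, 'y) module_scheme \<Rightarrow> ('f, 'm) module"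
  where "underlying_module A M = restrict_scalars (\<lambda>c. c \<odot>\<^bsub>A\<^esub> \<one>\<^bsub>A\<^esub>) M"

text \<open>The library's \<^const>\<open>ring.finite_dimension\<close> only covers subspaces of a ring that contains
  the scalars. Over a field, a space is finite-dimensional if it has a finite spanning set.\<close>

definition finitely_spanned :: "('f, 'x) ring_scheme \<Rightarrow> ('f, 'v, 'y) module_scheme \<Rightarrow> bool"
  where "finitely_spanned F V \<longleftrightarrow>
    (\<exists>B. finite B \<and> B \<subseteq> carrier V \<and>
      (\<forall>v\<in>carrier V. \<exists>c \<in> B \<rightarrow> carrier F. v = (\<Oplus>\<^bsub>V\<^esub>b\<in>B. c b \<odot>\<^bsub>V\<^esub> b)))"

definition finite_dim_left_module ::
  "('f, 'x) ring_scheme \<Rightarrow> ('f, 'r, 'y) module_scheme \<Rightarrow> ('r, 'm, 'z) module_scheme \<Rightarrow> bool"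
  where "finite_dim_left_module F A M \<longleftrightarrow>
    left_module A M \<and> finitely_spanned F (underlying_module A M)"

definition direct_sum :: "'i set \<Rightarrow> ('i \<Rightarrow> ('r, 'm, 'y) module_scheme) \<Rightarrow> ('r, 'i \<Rightarrow> 'm) module"
  where "direct_sum I M =
    \<lparr>carrier = {f \<in> \<Pi>\<^sub>E i\<in>I. carrier (M i). finite {i \<in> I. f i \<noteq> \<zero>\<^bsub>M i\<^esub>}},
     monoid.mult = undefined, monoid.one = undefined,
     ring.zero = (\<lambda>i\<in>I. \<zero>\<^bsub>M i\<^esub>),
     ring.add = (\<lambda>f g. \<lambda>i\<in>I. f i \<oplus>\<^bsub>M i\<^esub> g i),
     smult = (\<lambda>a f. \<lambda>i\<in>I. a \<odot>\<^bsub>M i\<^esub> f i)\<rparr>"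

text \<open>\<open>V \<otimes>\<^sub>F W\<close> is the free abelian group on \<open>V \<times> W\<close> modulo the subgroup generated by the
  relations that make the tensor symbol biadditive and \<open>F\<close>-balanced; its elements are cosets.\<close>

definition tensor_relations ::
  "('f, 'x) ring_scheme \<Rightarrow> ('f, 'v, 'y) module_scheme \<Rightarrow> ('f, 'w, 'z) module_scheme
    \<Rightarrow> (('v \<times> 'w) \<Rightarrow>\<^sub>0 int) set"
  where "tensor_relations F V W =
    {frag_of (v \<oplus>\<^bsub>V\<^esub> v', w) - frag_of (v, w) - frag_of (v', w) | v v' w.
       v \<in> carrier V \<and> v' \<in> carrier V \<and> w \<in> carrier W} \<union>
    {frag_of (v, w \<oplus>\<^bsub>W\<^esub> w') - frag_of (v, w) - frag_of (v, w') | v w w'.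
       v \<in> carrier V \<and> w \<in> carrier W \<and> w' \<in> carrier W} \<union>
    {frag_of (c \<odot>\<^bsub>V\<^esub> v, w) - frag_of (v, c \<odot>\<^bsub>W\<^esub> w) | c v w.
       c \<in> carrier F \<and> v \<in> carrier V \<and> w \<in> carrier W}"

definition tensor_null ::
  "('f, 'x) ring_scheme \<Rightarrow> ('f, 'v, 'y) module_scheme \<Rightarrow> ('f, 'w, 'z) module_scheme
    \<Rightarrow> (('v \<times> 'w) \<Rightarrow>\<^sub>0 int) set"
  where "tensor_null F V W =
    generate (free_Abelian_group (carrier V \<times> carrier W)) (tensor_relations F V W)"

definition tensor_group ::
  "('f, 'x) ring_scheme \<Rightarrow> ('f, 'v, 'y) module_scheme \<Rightarrow> ('f, 'w, 'z) module_scheme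
    \<Rightarrow> (('v \<times> 'w) \<Rightarrow>\<^sub>0 int) set monoid"
  where "tensor_group F V W =
    free_Abelian_group (carrier V \<times> carrier W) Mod tensor_null F V W"

definition tensor_class ::
  "('f, 'x) ring_scheme \<Rightarrow> ('f, 'v, 'y) module_scheme \<Rightarrow> ('f, 'w, 'z) module_scheme
    \<Rightarrow> (('v \<times> 'w) \<Rightarrow>\<^sub>0 int) \<Rightarrow> (('v \<times> 'w) \<Rightarrow>\<^sub>0 int) set"
  where "tensor_class F V W z =
    tensor_null F V W #>\<^bsub>free_Abelian_group (carrier V \<times> carrier W)\<^esub> z"

definition pure_tensor ::
  "('f, 'x) ring_scheme \<Rightarrow> ('f, 'v, 'y) module_scheme \<Rightarrow> ('f, 'w, 'z) module_scheme
    \<Rightarrow> 'v \<Rightarrow> 'w \<Rightarrow> (('v \<times> 'w) \<Rightarrow>\<^sub>0 int) set"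
  where "pure_tensor F V W v w = tensor_class F V W (frag_of (v, w))"

text \<open>If \<open>cl\<close> is the class map of the target, \<open>tensor_lift cl f\<close> and \<open>tensor_lift2 cl g\<close> are the
  additive, respectively biadditive, maps on classes that are given by \<open>f\<close>, respectively \<open>g\<close>, on
  pure tensors. As for \<^const>\<open>rcoset_mult\<close>, the union runs over the representatives, which all
  give the same class whenever the map is well defined.\<close>

definition tensor_lift ::
  "(('c \<Rightarrow>\<^sub>0 int) \<Rightarrow> ('c \<Rightarrow>\<^sub>0 int) set) \<Rightarrow> ('a \<Rightarrow> 'c)
    \<Rightarrow> ('a \<Rightarrow>\<^sub>0 int) set \<Rightarrow> ('c \<Rightarrow>\<^sub>0 int) set"
  where "tensor_lift cl f S = (\<Union>x\<in>S. cl (frag_extend (\<lambda>p. frag_of (f p)) x))"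

definition tensor_lift2 ::
  "(('c \<Rightarrow>\<^sub>0 int) \<Rightarrow> ('c \<Rightarrow>\<^sub>0 int) set) \<Rightarrow> ('a \<Rightarrow> 'b \<Rightarrow> 'c)
    \<Rightarrow> ('a \<Rightarrow>\<^sub>0 int) set \<Rightarrow> ('b \<Rightarrow>\<^sub>0 int) set \<Rightarrow> ('c \<Rightarrow>\<^sub>0 int) set"
  where "tensor_lift2 cl f S T =
    (\<Union>x\<in>S. \<Union>y\<in>T. cl (frag_extend (\<lambda>p. frag_extend (\<lambda>q. frag_of (f p q)) y) x))"

definition tensor_algebra ::
  "('f, 'x) ring_scheme \<Rightarrow> ('f, 'a, 'y) module_scheme \<Rightarrow> ('f, 'b, 'z) module_scheme
    \<Rightarrow> ('f, (('a \<times> 'b) \<Rightarrow>\<^sub>0 int) set) module"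
  where "tensor_algebra F A B =
    \<lparr>carrier = carrier (tensor_group F A B),
     monoid.mult = tensor_lift2 (tensor_class F A B)
       (\<lambda>(a, b) (a', b'). (a \<otimes>\<^bsub>A\<^esub> a', b \<otimes>\<^bsub>B\<^esub> b')),
     monoid.one = pure_tensor F A B \<one>\<^bsub>A\<^esub> \<one>\<^bsub>B\<^esub>,
     ring.zero = \<one>\<^bsub>tensor_group F A B\<^esub>,
     ring.add = monoid.mult (tensor_group F A B),
     smult = (\<lambda>c. tensor_lift (tensor_class F A B) (\<lambda>(a, b). (c \<odot>\<^bsub>A\<^esub> a, b)))\<rparr>"

text \<open>For \<open>F\<close>-algebras \<open>A\<close> and \<open>B\<close> and a left \<open>B\<close>-module \<open>N\<close>, the left
  \<open>A \<otimes>\<^sub>F B\<close>-module \<open>A \<otimes>\<^sub>F N\<close>.\<close>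

definition tensor_module ::
  "('f, 'x) ring_scheme \<Rightarrow> ('f, 'a, 'y) module_scheme \<Rightarrow> ('f, 'b, 'z) module_scheme
    \<Rightarrow> ('b, 'n, 'u) module_scheme
    \<Rightarrow> ((('a \<times> 'b) \<Rightarrow>\<^sub>0 int) set, (('a \<times> 'n) \<Rightarrow>\<^sub>0 int) set) module"
  where "tensor_module F A B N =
    (let V = underlying_module B N in
    \<lparr>carrier = carrier (tensor_group F A V),
     monoid.mult = undefined, monoid.one = undefined,
     ring.zero = \<one>\<^bsub>tensor_group F A V\<^esub>,
     ring.add = monoid.mult (tensor_group F A V),
     smult = tensor_lift2 (tensor_class F A V)
       (\<lambda>(a, b) (a', n). (a \<otimes>\<^bsub>A\<^esub> a', b \<odot>\<^bsub>N\<^esub> n))\<rparr>)"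

text \<open>No multiple roots in an algebraic closure of \<open>K\<close>, which for \<open>K\<close> algebraic over \<open>k\<close> is
  also an algebraic closure of \<open>k\<close>.\<close>

definition separable_polynomial :: "('a, 'x) ring_scheme \<Rightarrow> 'a list \<Rightarrow> bool"
  where "separable_polynomial K p \<longleftrightarrow>
    p \<noteq> [] \<and>
    (\<forall>x\<in>carrier (field.alg_closure K).
       ring.alg_mult (field.alg_closure K) (map (ring.indexed_const K) p) x \<le> 1)"

definition separable_extension :: "'a set \<Rightarrow> ('a, 'x) ring_scheme \<Rightarrow> bool"
  where "separable_extension k K \<longleftrightarrow>
    (\<forall>x\<in>carrier K. ring.algebraic K k x \<and> separable_polynomial K (ring.Irr K k x))"

definition normal_extension :: "'a set \<Rightarrow> ('a, 'x) ring_scheme \<Rightarrow> bool"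
  where "normal_extension k K \<longleftrightarrow>
    (\<forall>x\<in>carrier K. ring.algebraic K k x) \<and>
    (\<forall>p\<in>carrier (k[X]\<^bsub>K\<^esub>).
       pirreducible\<^bsub>K\<^esub> k p \<and> (\<exists>x. ring.is_root K p x) \<longrightarrow> ring.splitted K p)"

text \<open>\<^const>\<open>Bij\<close> makes the automorphisms extensional, so that each of them is represented by
  exactly one function.\<close>

definition galois_group :: "'a set \<Rightarrow> ('a, 'x) ring_scheme \<Rightarrow> ('a \<Rightarrow> 'a) set"
  where "galois_group k K =
    {\<phi> \<in> Bij (carrier K). \<phi> \<in> ring_hom K K \<and> (\<forall>c\<in>k. \<phi> c = c)}"

abbreviation base_field :: "'a set \<Rightarrow> ('a, 'x) ring_scheme \<Rightarrow> ('a, 'x) ring_scheme"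
  where "base_field k K \<equiv> K\<lparr>carrier := k\<rparr>"

definition self_algebra :: "('a, 'x) ring_scheme \<Rightarrow> ('a, 'a) module"
  where "self_algebra K =
    \<lparr>carrier = carrier K, monoid.mult = monoid.mult K, monoid.one = monoid.one K,
     ring.zero = ring.zero K, ring.add = ring.add K,
     smult = monoid.mult K\<rparr>"

text \<open>The algebra \<open>\<Gamma> = K \<otimes>\<^sub>k \<Lambda>\<close>, its elements \<open>x \<otimes> \<lambda>\<close>, and, for a
  \<open>\<Gamma>\<close>-module \<open>M\<close>, the \<open>\<Lambda>\<close>-module \<open>M\<close>, the \<open>\<Gamma>\<close>-modules \<open>K \<otimes>\<^sub>k M\<close> and
  \<open>M\<^sup>\<phi>\<close>, the elements \<open>x \<otimes> m\<close> of \<open>K \<otimes>\<^sub>k M\<close>, and the multiplication map.\<close>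

definition ext_algebra ::
  "'a set \<Rightarrow> ('a, 'x) ring_scheme \<Rightarrow> ('a, 'l, 'y) module_scheme
    \<Rightarrow> ('a, (('a \<times> 'l) \<Rightarrow>\<^sub>0 int) set) module"
  where "ext_algebra k K \<Lambda> = tensor_algebra (base_field k K) (self_algebra K) \<Lambda>"

definition ext_algebra_pure ::
  "'a set \<Rightarrow> ('a, 'x) ring_scheme \<Rightarrow> ('a, 'l, 'y) module_scheme
    \<Rightarrow> 'a \<Rightarrow> 'l \<Rightarrow> (('a \<times> 'l) \<Rightarrow>\<^sub>0 int) set"
  where "ext_algebra_pure k K \<Lambda> = pure_tensor (base_field k K) (self_algebra K) \<Lambda>"

definition restrict_to_algebra ::
  "'a set \<Rightarrow> ('a, 'x) ring_scheme \<Rightarrow> ('a, 'l, 'y) module_scheme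
    \<Rightarrow> ((('a \<times> 'l) \<Rightarrow>\<^sub>0 int) set, 'm, 'z) module_scheme \<Rightarrow> ('l, 'm) module"
  where "restrict_to_algebra k K \<Lambda> M = restrict_scalars (ext_algebra_pure k K \<Lambda> \<one>\<^bsub>K\<^esub>) M"

definition ext_module ::
  "'a set \<Rightarrow> ('a, 'x) ring_scheme \<Rightarrow> ('a, 'l, 'y) module_scheme
    \<Rightarrow> ((('a \<times> 'l) \<Rightarrow>\<^sub>0 int) set, 'm, 'z) module_scheme
    \<Rightarrow> ((('a \<times> 'l) \<Rightarrow>\<^sub>0 int) set, (('a \<times> 'm) \<Rightarrow>\<^sub>0 int) set) module"
  where "ext_module k K \<Lambda> M =
    tensor_module (base_field k K) (self_algebra K) \<Lambda> (restrict_to_algebra k K \<Lambda> M)"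

definition ext_module_pure ::
  "'a set \<Rightarrow> ('a, 'x) ring_scheme \<Rightarrow> ('a, 'l, 'y) module_scheme
    \<Rightarrow> ((('a \<times> 'l) \<Rightarrow>\<^sub>0 int) set, 'm, 'z) module_scheme
    \<Rightarrow> 'a \<Rightarrow> 'm \<Rightarrow> (('a \<times> 'm) \<Rightarrow>\<^sub>0 int) set"
  where "ext_module_pure k K \<Lambda> M =
    pure_tensor (base_field k K) (self_algebra K)
      (underlying_module \<Lambda> (restrict_to_algebra k K \<Lambda> M))"

text \<open>The action is pulled back along \<open>\<phi> \<otimes> id\<close>.\<close>

definition twisted_module ::
  "'a set \<Rightarrow> ('a, 'x) ring_scheme \<Rightarrow> ('a, 'l, 'y) module_scheme
    \<Rightarrow> ('a \<Rightarrow> 'a) \<Rightarrow> ((('a \<times> 'l) \<Rightarrow>\<^sub>0 int) set, 'm, 'z) module_scheme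
    \<Rightarrow> ((('a \<times> 'l) \<Rightarrow>\<^sub>0 int) set, 'm) module"
  where "twisted_module k K \<Lambda> \<phi> M =
    restrict_scalars
      (tensor_lift (tensor_class (base_field k K) (self_algebra K) \<Lambda>) (\<lambda>(x, l). (\<phi> x, l))) M"

text \<open>The value at a class is computed from a representative \<open>\<Sum> n\<^sub>i (x\<^sub>i, m\<^sub>i)\<close>, as
  \<open>\<Sum> n\<^sub>i (x\<^sub>i \<otimes> 1) m\<^sub>i\<close>; \<^const>\<open>the_elem\<close> expresses independence of the choice.\<close>

definition mult_map ::
  "'a set \<Rightarrow> ('a, 'x) ring_scheme \<Rightarrow> ('a, 'l, 'y) module_scheme
    \<Rightarrow> ((('a \<times> 'l) \<Rightarrow>\<^sub>0 int) set, 'm, 'z) module_scheme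
    \<Rightarrow> (('a \<times> 'm) \<Rightarrow>\<^sub>0 int) set \<Rightarrow> 'm"
  where "mult_map k K \<Lambda> M S =
    the_elem ((\<lambda>z. \<Oplus>\<^bsub>M\<^esub>p\<in>Poly_Mapping.keys z.
      add_pow M (Poly_Mapping.lookup z p)
        (ext_algebra_pure k K \<Lambda> (fst p) \<one>\<^bsub>\<Lambda>\<^esub> \<odot>\<^bsub>M\<^esub> snd p)) ` S)"

end

(*
A separability element of K/k is a list of pairs (x_i, y_i) with Sum x_i y_i = 1 such that
Sum b(c x_i, y_i) = Sum b(x_i, c y_i) for every k-balanced b and every c in K; then
m |-> Sum x_i \<otimes> y_i m is a Gamma-linear section of the multiplication map. For a single element a
with minimal polynomial (X - a) g(X), the pairs (a^i / g(a), g_i) have this property for c = a, and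
g(a) is nonzero because a is a simple root. Componentwise products of such lists, taken over a
spanning set of K over k, work for all c at once, so neither a primitive element nor a tower of
extensions is needed.

In the normal case the isomorphism sends x \<otimes> m to (phi(x) m)_phi, and its inverse sends (m_phi)_phi to
Sum_phi Sum_i phi^-1(x_i) \<otimes> y_i m_phi. One composite is the identity because Sum_i sigma(x_i) y_i
vanishes for sigma distinct from 1, the other because Sum_phi phi(x_i) lies in the fixed field of the
Galois group, which is k.
*)
theory Submission
  imports Defs
begin

text \<open>A separability element stays a list of pairs, so \<open>K \<otimes> K\<close> is never
  formed; its identities are tested on balanced maps into a fixed abelian group. Two targets occur:
  \<open>K \<otimes>\<^sub>k M\<close>, which makes the section linear, and \<open>K\<close>, which
  gives orthogonality. The \<open>c\<close> that pass the test for a list form a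
  \<open>k\<close>-subspace of \<open>K\<close>, which is why a spanning set suffices, and
  commutativity of \<open>K\<close> lets a product of lists inherit the test from either factor.

  Orthogonality holds for every \<open>k\<close>-endomorphism of \<open>K\<close>; it comes from
  comparing \<open>\<sigma>(c)\<close> with \<open>c\<close> inside the sum. Normality acts through
  the fixed field: it supplies the roots along which embeddings extend, one generator at a time.

  Tensor products are quotients of free abelian groups, so each map out of one must be shown
  independent of representatives. A single universal property does this, and equations between
  additive maps are then checked on pure tensors; for the action of \<open>\<Gamma>\<close> this
  happens in the scalar and in the vector separately.\<close>

section \<open>Separability elements\<close>

text \<open>Lists, not sets, index these sums: in a product of separability elements a pair may
  occur repeatedly and then counts with multiplicity.\<close>

definition list_sum :: "('g, 'h) ring_scheme \<Rightarrow> ('b \<Rightarrow> 'g) \<Rightarrow> 'b list \<Rightarrow> 'g"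
  where "list_sum G f xs = foldr (\<lambda>x s. f x \<oplus>\<^bsub>G\<^esub> s) xs \<zero>\<^bsub>G\<^esub>"

lemma list_sum_simps [simp]:
  "list_sum G f [] = \<zero>\<^bsub>G\<^esub>"
  "list_sum G f (x # xs) = f x \<oplus>\<^bsub>G\<^esub> list_sum G f xs"
  by (simp_all add: list_sum_def)

lemma list_sum_map: "list_sum G f (map h xs) = list_sum G (\<lambda>x. f (h x)) xs"
  by (induction xs) auto

lemma list_sum_cong: "(\<And>x. x \<in> set xs \<Longrightarrow> f x = g x) \<Longrightarrow> list_sum G f xs = list_sum G g xs"
  by (induction xs) auto

context abelian_group
begin

lemma list_sum_closed [intro]:
  "(\<And>x. x \<in> set xs \<Longrightarrow> f x \<in> carrier G) \<Longrightarrow> list_sum G f xs \<in> carrier G"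
  by (induction xs) auto

lemma list_sum_append:
  "\<lbrakk>\<And>x. x \<in> set xs \<Longrightarrow> f x \<in> carrier G; \<And>x. x \<in> set ys \<Longrightarrow> f x \<in> carrier G\<rbrakk> \<Longrightarrow>
    list_sum G f (xs @ ys) = list_sum G f xs \<oplus> list_sum G f ys"
proof (induction xs)
  case (Cons x xs)
  then show ?case using list_sum_closed[of xs f] list_sum_closed[of ys f]
    by (auto simp: a_assoc)
qed (auto simp: list_sum_closed)

lemma list_sum_addf:
  "\<lbrakk>\<And>x. x \<in> set xs \<Longrightarrow> f x \<in> carrier G; \<And>x. x \<in> set xs \<Longrightarrow> g x \<in> carrier G\<rbrakk> \<Longrightarrow>
    list_sum G (\<lambda>x. f x \<oplus> g x) xs = list_sum G f xs \<oplus> list_sum G g xs"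
proof (induction xs)
  case (Cons x xs)
  then show ?case using list_sum_closed[of xs f] list_sum_closed[of xs g]
    by (auto simp: a_ac)
qed auto

lemma list_sum_upt_Suc:
  "(\<And>i. i \<le> n \<Longrightarrow> f i \<in> carrier G) \<Longrightarrow> list_sum G f [0..<Suc n] = list_sum G f [0..<n] \<oplus> f n"
  by (simp, subst list_sum_append) auto

lemma list_sum_upt_Suc_shift:
  "list_sum G f [0..<Suc n] = f 0 \<oplus> list_sum G (\<lambda>i. f (Suc i)) [0..<n]"
  by (simp add: upt_conv_Cons map_Suc_upt[symmetric] list_sum_map del: upt_Suc)

lemma list_sum_zero: "(\<And>x. x \<in> set xs \<Longrightarrow> f x = \<zero>) \<Longrightarrow> list_sum G f xs = \<zero>"
  by (induction xs) auto

lemma list_sum_product: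
  "(\<And>x y. \<lbrakk>x \<in> set xs; y \<in> set ys\<rbrakk> \<Longrightarrow> f (x, y) \<in> carrier G) \<Longrightarrow>
    list_sum G f (List.product xs ys) = list_sum G (\<lambda>x. list_sum G (\<lambda>y. f (x, y)) ys) xs"
proof (induction xs)
  case (Cons x xs)
  then show ?case
    by (subst List.product.simps, subst list_sum_append) (auto simp: list_sum_map)
qed auto

lemma list_sum_swap:
  "(\<And>x y. \<lbrakk>x \<in> set xs; y \<in> set ys\<rbrakk> \<Longrightarrow> f x y \<in> carrier G) \<Longrightarrow>
    list_sum G (\<lambda>x. list_sum G (f x) ys) xs = list_sum G (\<lambda>y. list_sum G (\<lambda>x. f x y) xs) ys"
proof (induction xs)
  case (Cons x xs)
  then show ?case
    by (simp, subst list_sum_addf[symmetric]) auto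
qed (simp add: list_sum_zero)

lemma finsum_list_sum:
  assumes "finite I"
  shows "(\<And>i x. \<lbrakk>i \<in> I; x \<in> set xs\<rbrakk> \<Longrightarrow> f i x \<in> carrier G) \<Longrightarrow>
    (\<Oplus>i\<in>I. list_sum G (f i) xs) = list_sum G (\<lambda>x. \<Oplus>i\<in>I. f i x) xs"
proof (induction xs)
  case (Cons x xs)
  have "(\<Oplus>i\<in>I. f i x \<oplus> list_sum G (f i) xs) = (\<Oplus>i\<in>I. f i x) \<oplus> (\<Oplus>i\<in>I. list_sum G (f i) xs)"
    by (rule finsum_addf) (use Cons.prems in auto)
  then show ?case using Cons by simp
qed simp

end

lemma hom_add_closed:
  "\<lbrakk>h \<in> hom (add_monoid G) (add_monoid H); x \<in> carrier G\<rbrakk> \<Longrightarrow> h x \<in> carrier H"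
  by (auto simp: hom_def)

lemma hom_add_add:
  "\<lbrakk>h \<in> hom (add_monoid G) (add_monoid H); x \<in> carrier G; y \<in> carrier G\<rbrakk> \<Longrightarrow>
    h (x \<oplus>\<^bsub>G\<^esub> y) = h x \<oplus>\<^bsub>H\<^esub> h y"
  by (auto simp: hom_def)

lemma hom_add_zero:
  assumes "abelian_group G" "abelian_group H" "h \<in> hom (add_monoid G) (add_monoid H)"
  shows "h \<zero>\<^bsub>G\<^esub> = \<zero>\<^bsub>H\<^esub>"
  using hom_one[OF assms(3) abelian_group.a_group[OF assms(1)] abelian_group.a_group[OF assms(2)]]
  by simp

lemma hom_add_list_sum:
  assumes "abelian_group G" "abelian_group H" "h \<in> hom (add_monoid G) (add_monoid H)"
  shows "(\<And>x. x \<in> set xs \<Longrightarrow> f x \<in> carrier G) \<Longrightarrow>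
    h (list_sum G f xs) = list_sum H (\<lambda>x. h (f x)) xs"
proof (induction xs)
  case (Cons x xs)
  then have "list_sum G f xs \<in> carrier G"
    by (intro abelian_group.list_sum_closed[OF assms(1)]) auto
  then show ?case using Cons hom_add_add[OF assms(3)] by auto
qed (simp add: hom_add_zero[OF assms])

text \<open>The target carries no \<open>F\<close>-action: biadditivity and moving scalars across
  are exactly what \<open>tensor_relations\<close> imposes, so these are the maps that factor
  through the tensor product.\<close>

definition balanced_map ::
  "('f, 'x) ring_scheme \<Rightarrow> ('f, 'v, 'y) module_scheme \<Rightarrow> ('f, 'w, 'z) module_scheme
    \<Rightarrow> ('g, 'h) ring_scheme \<Rightarrow> ('v \<Rightarrow> 'w \<Rightarrow> 'g) \<Rightarrow> bool"
  where "balanced_map F V W G \<beta> \<longleftrightarrow>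
    (\<forall>v\<in>carrier V. \<forall>w\<in>carrier W. \<beta> v w \<in> carrier G) \<and>
    (\<forall>v\<in>carrier V. \<forall>v'\<in>carrier V. \<forall>w\<in>carrier W.
      \<beta> (v \<oplus>\<^bsub>V\<^esub> v') w = \<beta> v w \<oplus>\<^bsub>G\<^esub> \<beta> v' w) \<and>
    (\<forall>v\<in>carrier V. \<forall>w\<in>carrier W. \<forall>w'\<in>carrier W.
      \<beta> v (w \<oplus>\<^bsub>W\<^esub> w') = \<beta> v w \<oplus>\<^bsub>G\<^esub> \<beta> v w') \<and>
    (\<forall>c\<in>carrier F. \<forall>v\<in>carrier V. \<forall>w\<in>carrier W. \<beta> (c \<odot>\<^bsub>V\<^esub> v) w = \<beta> v (c \<odot>\<^bsub>W\<^esub> w))"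

lemma self_algebra_simps [simp]:
  "carrier (self_algebra K) = carrier K"
  "monoid.mult (self_algebra K) = monoid.mult K"
  "monoid.one (self_algebra K) = monoid.one K"
  "ring.zero (self_algebra K) = ring.zero K"
  "ring.add (self_algebra K) = ring.add K"
  "smult (self_algebra K) = monoid.mult K"
  by (simp_all add: self_algebra_def)

section \<open>Elements of \<open>K\<close> that move across a list of pairs\<close>

locale field_extension = field K for k :: "'a set" and K :: "('a, 'x) ring_scheme" (structure) +
  assumes k_subfield: "subfield k K"
begin

abbreviation balanced :: "('g, 'h) ring_scheme \<Rightarrow> ('a \<Rightarrow> 'a \<Rightarrow> 'g) \<Rightarrow> bool"
  where "balanced G \<beta> \<equiv> balanced_map (base_field k K) (self_algebra K) (self_algebra K) G \<beta>"

text \<open>If the list stands for \<open>t = \<Sum> x_i \<otimes> y_i\<close>, this is the set of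
  \<open>c\<close> with \<open>(c \<otimes> 1) t = (1 \<otimes> c) t\<close>, as far as balanced
  maps into \<open>G\<close> can tell.\<close>

definition central :: "('g, 'h) ring_scheme \<Rightarrow> ('a \<times> 'a) list \<Rightarrow> 'a set"
  where "central G ps = {c \<in> carrier K. \<forall>\<beta>. balanced G \<beta> \<longrightarrow>
    list_sum G (\<lambda>(x, y). \<beta> (c \<otimes> x) y) ps = list_sum G (\<lambda>(x, y). \<beta> x (c \<otimes> y)) ps}"

lemma k_carrier: "c \<in> k \<Longrightarrow> c \<in> carrier K"
  using subfieldE(3)[OF k_subfield] by auto

lemmas k_subring = subfieldE(1)[OF k_subfield]

lemma balancedD:
  assumes "balanced G \<beta>"
  shows "\<lbrakk>x \<in> carrier K; y \<in> carrier K\<rbrakk> \<Longrightarrow> \<beta> x y \<in> carrier G"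
    and "\<lbrakk>x \<in> carrier K; x' \<in> carrier K; y \<in> carrier K\<rbrakk> \<Longrightarrow> \<beta> (x \<oplus> x') y = \<beta> x y \<oplus>\<^bsub>G\<^esub> \<beta> x' y"
    and "\<lbrakk>x \<in> carrier K; y \<in> carrier K; y' \<in> carrier K\<rbrakk> \<Longrightarrow> \<beta> x (y \<oplus> y') = \<beta> x y \<oplus>\<^bsub>G\<^esub> \<beta> x y'"
    and "\<lbrakk>c \<in> k; x \<in> carrier K; y \<in> carrier K\<rbrakk> \<Longrightarrow> \<beta> (c \<otimes> x) y = \<beta> x (c \<otimes> y)"
  using assms unfolding balanced_map_def by auto

text \<open>Centrality quantifies over all balanced maps, so it may be applied to a premultiplied
  one; this is what carries it through scalars and through products of lists.\<close>

lemma balanced_mult: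
  assumes "balanced G \<beta>" "a \<in> carrier K" "b \<in> carrier K"
  shows "balanced G (\<lambda>x y. \<beta> (a \<otimes> x) (b \<otimes> y))"
proof -
  have "\<beta> (a \<otimes> (c \<otimes> x)) (b \<otimes> y) = \<beta> (a \<otimes> x) (b \<otimes> (c \<otimes> y))"
    if "c \<in> k" "x \<in> carrier K" "y \<in> carrier K" for c x y
    using balancedD(4)[OF assms(1) that(1), of "a \<otimes> x" "b \<otimes> y"] that assms k_carrier[of c]
    by (simp add: m_lcomm)
  then show ?thesis
    using assms balancedD[OF assms(1)] unfolding balanced_map_def
    by (auto simp: r_distr)
qed

text \<open>\<open>b\<close> crosses by its own centrality, tested on \<open>\<beta>\<close>
  premultiplied by \<open>a\<close>; then \<open>a\<close> crosses because \<open>\<beta>\<close> is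
  balanced over \<open>k\<close>.\<close>

lemma scale_central:
  assumes ps: "set ps \<subseteq> carrier K \<times> carrier K" and "a \<in> k" "b \<in> central G ps"
  shows "a \<otimes> b \<in> central G ps"
proof -
  have ps': "x \<in> carrier K" "y \<in> carrier K" if "(x, y) \<in> set ps" for x y using that ps by auto
  have ab: "a \<in> carrier K" "b \<in> carrier K" using assms k_carrier by (auto simp: central_def)
  have "list_sum G (\<lambda>(x, y). \<beta> ((a \<otimes> b) \<otimes> x) y) ps = list_sum G (\<lambda>(x, y). \<beta> x ((a \<otimes> b) \<otimes> y)) ps"
    if \<beta>: "balanced G \<beta>" for \<beta>
  proof -
    \<comment> \<open>The factor \<open>\<one>\<close> is there to fit the shape of
      \<open>balanced_mult\<close>.\<close>
    have "balanced G (\<lambda>x y. \<beta> (a \<otimes> x) (\<one> \<otimes> y))" by (intro balanced_mult \<beta> ab one_closed)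
    with \<open>b \<in> central G ps\<close>
    have "list_sum G (\<lambda>(x, y). \<beta> (a \<otimes> (b \<otimes> x)) (\<one> \<otimes> y)) ps = list_sum G (\<lambda>(x, y). \<beta> (a \<otimes> x) (\<one> \<otimes> (b \<otimes> y))) ps"
      unfolding central_def by blast
    also have "\<dots> = list_sum G (\<lambda>(x, y). \<beta> x ((a \<otimes> b) \<otimes> y)) ps"
      by (rule list_sum_cong) (auto simp: ab ps' balancedD(4)[OF \<beta> \<open>a \<in> k\<close>] m_assoc)
    also have "list_sum G (\<lambda>(x, y). \<beta> (a \<otimes> (b \<otimes> x)) (\<one> \<otimes> y)) ps = list_sum G (\<lambda>(x, y). \<beta> ((a \<otimes> b) \<otimes> x) y) ps"
      by (rule list_sum_cong) (auto simp: ab ps' m_assoc)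
    finally show ?thesis .
  qed
  then show ?thesis using ab by (auto simp: central_def)
qed

text \<open>Together with \<open>scale_central\<close> this makes \<open>central G ps\<close> a
  \<open>k\<close>-subspace, in the form that \<open>Span_min\<close> asks for.\<close>

lemma subgroup_central:
  assumes G: "abelian_group G" and ps: "set ps \<subseteq> carrier K \<times> carrier K"
  shows "subgroup (central G ps) (add_monoid K)"
proof -
  interpret G: abelian_group G by fact
  have ps': "x \<in> carrier K" "y \<in> carrier K" if "(x, y) \<in> set ps" for x y using that ps by auto
  have add: "a \<oplus> b \<in> central G ps" if "a \<in> central G ps" "b \<in> central G ps" for a b
  proof -
    have ab: "a \<in> carrier K" "b \<in> carrier K" using that by (auto simp: central_def)
    have "list_sum G (\<lambda>(x, y). \<beta> ((a \<oplus> b) \<otimes> x) y) ps = list_sum G (\<lambda>(x, y). \<beta> x ((a \<oplus> b) \<otimes> y)) ps"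
      if \<beta>: "balanced G \<beta>" for \<beta>
    proof -
      have "list_sum G (\<lambda>(x, y). \<beta> ((a \<oplus> b) \<otimes> x) y) ps
          = list_sum G (\<lambda>p. (case p of (x, y) \<Rightarrow> \<beta> (a \<otimes> x) y) \<oplus>\<^bsub>G\<^esub> (case p of (x, y) \<Rightarrow> \<beta> (b \<otimes> x) y)) ps"
        by (rule list_sum_cong) (auto simp: l_distr ab ps' balancedD[OF \<beta>])
      also have "\<dots> = list_sum G (\<lambda>p. (case p of (x, y) \<Rightarrow> \<beta> x (a \<otimes> y)) \<oplus>\<^bsub>G\<^esub> (case p of (x, y) \<Rightarrow> \<beta> x (b \<otimes> y))) ps"
        using \<open>a \<in> central G ps\<close> \<open>b \<in> central G ps\<close> \<beta>
        by (subst (1 2) G.list_sum_addf) (auto simp: ab ps' balancedD[OF \<beta>] central_def)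
      also have "\<dots> = list_sum G (\<lambda>(x, y). \<beta> x ((a \<oplus> b) \<otimes> y)) ps"
        by (rule list_sum_cong) (auto simp: l_distr ab ps' balancedD[OF \<beta>])
      finally show ?thesis .
    qed
    then show ?thesis using ab by (auto simp: central_def)
  qed
  have k: "a \<in> central G ps" if "a \<in> k" for a
    using that k_carrier ps' by (auto simp: central_def balancedD(4) intro!: list_sum_cong)
  show ?thesis
  proof (rule group.subgroupI)
    show "inv\<^bsub>add_monoid K\<^esub> a \<in> central G ps" if "a \<in> central G ps" for a
    proof -
      have "a \<in> carrier K" using that by (auto simp: central_def)
      \<comment> \<open>Negation is scaling by this element, so \<open>scale_central\<close> covers
        it.\<close>
      moreover have "\<ominus> \<one> \<in> k" by (simp add: subringE[OF k_subring])
      ultimately show ?thesis using scale_central[OF ps, of "\<ominus> \<one>" a] that by (simp add: l_minus a_inv_def[symmetric])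
    qed
  qed (use add k[of \<zero>] subringE(2)[OF k_subring] add.is_group in \<open>auto simp: central_def\<close>)
qed

text \<open>A subspace that contains a spanning set is everything, so centrality has to be arranged
  for the finitely many entries of \<open>us\<close> only.\<close>

lemma central_eq_carrier:
  assumes G: "abelian_group G" and ps: "set ps \<subseteq> carrier K \<times> carrier K"
    and Us: "set us \<subseteq> carrier K" "Span k us = carrier K" "set us \<subseteq> central G ps"
  shows "central G ps = carrier K"
proof -
  have "Span k us \<subseteq> central G ps"
    by (rule Span_min[OF k_subfield Us(1) subgroup_central[OF G ps]])
      (use scale_central[OF ps] Us(3) in \<open>auto simp: set_mult_def\<close>)
  then show ?thesis using Us by (auto simp: central_def)
qed

text \<open>In the commutative ring \<open>K \<otimes> K\<close> the new list is the product of the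
  two tensors, and \<open>c\<close> is absorbed by the factor for which it is central. Concretely, a
  pair of the other list is frozen and \<open>\<beta>\<close> premultiplied by that pair is used as
  the test map.\<close>

lemma central_product:
  assumes G: "abelian_group G"
    and ps: "set ps \<subseteq> carrier K \<times> carrier K" and qs: "set qs \<subseteq> carrier K \<times> carrier K"
  shows "central G ps \<union> central G qs \<subseteq> central G (map (\<lambda>((x, y), (x', y')). (x \<otimes> x', y \<otimes> y')) (List.product ps qs))"
proof -
  interpret G: abelian_group G by fact
  let ?pq = "map (\<lambda>((x, y), (x', y')). (x \<otimes> x', y \<otimes> y')) (List.product ps qs)"
  have p: "x \<in> carrier K" "y \<in> carrier K" if "(x, y) \<in> set ps" for x y using that ps by auto
  have q: "x \<in> carrier K" "y \<in> carrier K" if "(x, y) \<in> set qs" for x y using that qs by auto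
  note pq = p q
  \<comment> \<open>Two orders of summation, each with the list whose centrality is used on the
    inside.\<close>
  have sum_ps: "list_sum G (\<lambda>(x, y). \<beta> x y) ?pq =
      list_sum G (\<lambda>(x', y'). list_sum G (\<lambda>(x, y). \<beta> (x \<otimes> x') (y \<otimes> y')) ps) qs"
    and sum_qs: "list_sum G (\<lambda>(x, y). \<beta> x y) ?pq =
      list_sum G (\<lambda>(x, y). list_sum G (\<lambda>(x', y'). \<beta> (x \<otimes> x') (y \<otimes> y')) qs) ps"
    if "\<And>x y. x \<in> carrier K \<Longrightarrow> y \<in> carrier K \<Longrightarrow> \<beta> x y \<in> carrier G" for \<beta>
  proof -
    show 1: "list_sum G (\<lambda>(x, y). \<beta> x y) ?pq =
      list_sum G (\<lambda>(x, y). list_sum G (\<lambda>(x', y'). \<beta> (x \<otimes> x') (y \<otimes> y')) qs) ps"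
      using that pq by (subst list_sum_map, subst G.list_sum_product)
        (auto simp: case_prod_beta intro!: list_sum_cong)
    show "list_sum G (\<lambda>(x, y). \<beta> x y) ?pq =
      list_sum G (\<lambda>(x', y'). list_sum G (\<lambda>(x, y). \<beta> (x \<otimes> x') (y \<otimes> y')) ps) qs"
      unfolding 1 case_prod_beta by (rule G.list_sum_swap) (use that pq in auto)
  qed
  have cp: "c \<in> central G ?pq" if c: "c \<in> central G ps" for c
  proof -
    have cK: "c \<in> carrier K" using c by (auto simp: central_def)
    have "list_sum G (\<lambda>(x, y). \<beta> (c \<otimes> x) y) ?pq = list_sum G (\<lambda>(x, y). \<beta> x (c \<otimes> y)) ?pq"
      if \<beta>: "balanced G \<beta>" for \<beta>
    proof -
      have "list_sum G (\<lambda>(x, y). \<beta> (c \<otimes> (x \<otimes> x')) (y \<otimes> y')) ps = list_sum G (\<lambda>(x, y). \<beta> (x \<otimes> x') (c \<otimes> (y \<otimes> y'))) ps"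
        if "(x', y') \<in> set qs" for x' y'
      proof -
        have "balanced G (\<lambda>x y. \<beta> (x' \<otimes> x) (y' \<otimes> y))" by (intro balanced_mult \<beta> q[OF that])
        then have "list_sum G (\<lambda>(x, y). \<beta> (x' \<otimes> (c \<otimes> x)) (y' \<otimes> y)) ps = list_sum G (\<lambda>(x, y). \<beta> (x' \<otimes> x) (y' \<otimes> (c \<otimes> y))) ps"
          using c unfolding central_def by blast
        moreover have "list_sum G (\<lambda>(x, y). \<beta> (x' \<otimes> (c \<otimes> x)) (y' \<otimes> y)) ps = list_sum G (\<lambda>(x, y). \<beta> (c \<otimes> (x \<otimes> x')) (y \<otimes> y')) ps"
          "list_sum G (\<lambda>(x, y). \<beta> (x' \<otimes> x) (y' \<otimes> (c \<otimes> y))) ps = list_sum G (\<lambda>(x, y). \<beta> (x \<otimes> x') (c \<otimes> (y \<otimes> y'))) ps"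
          by (rule list_sum_cong; use p q[OF that] cK in \<open>auto simp: m_ac\<close>)+
        ultimately show ?thesis by simp
      qed
      then have "list_sum G (\<lambda>(x', y'). list_sum G (\<lambda>(x, y). \<beta> (c \<otimes> (x \<otimes> x')) (y \<otimes> y')) ps) qs =
        list_sum G (\<lambda>(x', y'). list_sum G (\<lambda>(x, y). \<beta> (x \<otimes> x') (c \<otimes> (y \<otimes> y'))) ps) qs"
        by (intro list_sum_cong) auto
      then show ?thesis
        by (subst (1 2) sum_ps) (use balancedD(1)[OF \<beta>] cK in auto)
    qed
    then show ?thesis using cK by (auto simp: central_def)
  qed
  have cq: "c \<in> central G ?pq" if c: "c \<in> central G qs" for c
  proof -
    have cK: "c \<in> carrier K" using c by (auto simp: central_def)
    have "list_sum G (\<lambda>(x, y). \<beta> (c \<otimes> x) y) ?pq = list_sum G (\<lambda>(x, y). \<beta> x (c \<otimes> y)) ?pq"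
      if \<beta>: "balanced G \<beta>" for \<beta>
    proof -
      have "list_sum G (\<lambda>(x', y'). \<beta> (c \<otimes> (x \<otimes> x')) (y \<otimes> y')) qs = list_sum G (\<lambda>(x', y'). \<beta> (x \<otimes> x') (c \<otimes> (y \<otimes> y'))) qs"
        if "(x, y) \<in> set ps" for x y
      proof -
        have "balanced G (\<lambda>x' y'. \<beta> (x \<otimes> x') (y \<otimes> y'))" by (intro balanced_mult \<beta> p[OF that])
        then have "list_sum G (\<lambda>(x', y'). \<beta> (x \<otimes> (c \<otimes> x')) (y \<otimes> y')) qs = list_sum G (\<lambda>(x', y'). \<beta> (x \<otimes> x') (y \<otimes> (c \<otimes> y'))) qs"
          using c unfolding central_def by blast
        moreover have "list_sum G (\<lambda>(x', y'). \<beta> (x \<otimes> (c \<otimes> x')) (y \<otimes> y')) qs = list_sum G (\<lambda>(x', y'). \<beta> (c \<otimes> (x \<otimes> x')) (y \<otimes> y')) qs"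
          "list_sum G (\<lambda>(x', y'). \<beta> (x \<otimes> x') (y \<otimes> (c \<otimes> y'))) qs = list_sum G (\<lambda>(x', y'). \<beta> (x \<otimes> x') (c \<otimes> (y \<otimes> y'))) qs"
          by (rule list_sum_cong; use p[OF that] q cK in \<open>auto simp: m_lcomm\<close>)+
        ultimately show ?thesis by simp
      qed
      then have "list_sum G (\<lambda>(x, y). list_sum G (\<lambda>(x', y'). \<beta> (c \<otimes> (x \<otimes> x')) (y \<otimes> y')) qs) ps =
        list_sum G (\<lambda>(x, y). list_sum G (\<lambda>(x', y'). \<beta> (x \<otimes> x') (c \<otimes> (y \<otimes> y'))) qs) ps"
        by (intro list_sum_cong) auto
      then show ?thesis
        by (subst (1 2) sum_qs) (use balancedD(1)[OF \<beta>] cK in auto)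
    qed
    then show ?thesis using cK by (auto simp: central_def)
  qed
  show ?thesis using cp cq by auto
qed

section \<open>The list of pairs that belongs to a simple root\<close>

lemma balanced_zero:
  assumes G: "abelian_group G" and \<beta>: "balanced G \<beta>" and "x \<in> carrier K"
  shows "\<beta> x \<zero> = \<zero>\<^bsub>G\<^esub>" "\<beta> \<zero> x = \<zero>\<^bsub>G\<^esub>"
proof -
  interpret G: abelian_group G by fact
  have "\<beta> x \<zero> \<oplus>\<^bsub>G\<^esub> \<beta> x \<zero> = \<beta> x \<zero>" "\<beta> \<zero> x \<oplus>\<^bsub>G\<^esub> \<beta> \<zero> x = \<beta> \<zero> x"
    using balancedD(2)[OF \<beta>, of \<zero> \<zero> x] balancedD(3)[OF \<beta>, of x \<zero> \<zero>] assms by auto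
  then show "\<beta> x \<zero> = \<zero>\<^bsub>G\<^esub>" "\<beta> \<zero> x = \<zero>\<^bsub>G\<^esub>"
    using G.add.l_cancel_one balancedD(1)[OF \<beta>] assms(3) by auto
qed

text \<open>\<open>coeff\<close> is zero beyond the length, so any larger \<open>n\<close> serves;
  the slack lets a polynomial and its cofactor be summed with one common bound.\<close>

lemma eval_eq_list_sum:
  assumes "set p \<subseteq> carrier K" "a \<in> carrier K" "length p \<le> n"
  shows "eval p a = list_sum K (\<lambda>i. coeff p i \<otimes> a [^] i) [0..<n]"
proof -
  have "eval p a = list_sum K (\<lambda>i. coeff p i \<otimes> a [^] i) [0..<length p]"
    using assms(1)
  proof (induction p)
    case (Cons b p)
    have "list_sum K (\<lambda>i. coeff (b # p) i \<otimes> a [^] i) [0..<length p]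
        = list_sum K (\<lambda>i. coeff p i \<otimes> a [^] i) [0..<length p]"
      by (rule list_sum_cong) auto
    then show ?case using Cons assms(2)
      by (simp add: list_sum_append list_sum_closed a_comm del: upt_Suc)
        (subst list_sum_upt_Suc, auto simp: a_comm list_sum_closed)
  qed simp
  also have "\<dots> = list_sum K (\<lambda>i. coeff p i \<otimes> a [^] i) [0..<n]"
    using assms(3)
  proof (induction rule: dec_induct)
    case (step n)
    then show ?case using assms
      by (subst list_sum_upt_Suc) (auto simp: coeff_length list_sum_closed)
  qed simp
  finally show ?thesis .
qed

text \<open>Coefficient lists start with the leading term, so appending \<open>\<zero>\<close>
  multiplies by the variable: the product is \<open>g\<close> shifted by one place plus
  \<open>\<ominus> a\<close> times \<open>g\<close>.\<close>

lemma coeff_mult_linear: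
  assumes "set g \<subseteq> carrier K" "a \<in> carrier K"
  shows "coeff (poly_mult [\<one>, \<ominus> a] g) 0 = \<ominus> (a \<otimes> coeff g 0)"
    and "coeff (poly_mult [\<one>, \<ominus> a] g) (Suc i) = coeff g i \<ominus> a \<otimes> coeff g (Suc i)"
proof -
  have [simp]: "set (map ((\<otimes>) \<one>) g) \<subseteq> carrier K" "set (map ((\<otimes>) (\<ominus> a)) g) \<subseteq> carrier K"
    using assms by auto
  have "coeff (poly_mult [\<ominus> a] g) = (\<lambda>i. \<ominus> a \<otimes> coeff g i)"
    using assms by (simp del: poly_add.simps, subst poly_add_coeff) (auto simp: scalar_coeff)
  moreover have "set (poly_mult [\<ominus> a] g) \<subseteq> carrier K"
    using assms by (intro poly_mult_in_carrier) auto
  ultimately have *: "coeff (poly_mult [\<one>, \<ominus> a] g) j =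
      (if j < 1 then \<zero> else coeff g (j - 1)) \<oplus> \<ominus> a \<otimes> coeff g j" for j
  proof -
    have "coeff (poly_add (map ((\<otimes>) \<one>) g @ [\<zero>]) (poly_mult [\<ominus> a] g)) j =
        coeff (map ((\<otimes>) \<one>) g @ [\<zero>]) j \<oplus> coeff (poly_mult [\<ominus> a] g) j"
      using assms \<open>set (poly_mult [\<ominus> a] g) \<subseteq> carrier K\<close> by (subst poly_add_coeff) auto
    moreover have "poly_mult [\<one>, \<ominus> a] g = poly_add (map ((\<otimes>) \<one>) g @ [\<zero>]) (poly_mult [\<ominus> a] g)"
      by simp
    ultimately show ?thesis
      using \<open>coeff (poly_mult [\<ominus> a] g) = _\<close> assms by (simp add: append_coeff scalar_coeff)
  qed
  show "coeff (poly_mult [\<one>, \<ominus> a] g) 0 = \<ominus> (a \<otimes> coeff g 0)"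
    "coeff (poly_mult [\<one>, \<ominus> a] g) (Suc i) = coeff g i \<ominus> a \<otimes> coeff g (Suc i)"
    using assms by (simp_all only: *) (simp_all add: l_minus minus_eq)
qed

text \<open>Write \<open>p_i\<close>, \<open>g_i\<close> for the coefficients. By
  \<open>coeff_mult_linear\<close>, \<open>p_0 + \<alpha> g_0 = 0\<close> and
  \<open>p_(i+1) + \<alpha> g_(i+1) = g_i\<close>. Substituting for \<open>g_i\<close> in
  \<open>\<Sum> \<beta>(\<alpha>^(i+1), g_i)\<close> produces
  \<open>\<Sum> \<beta>(\<alpha>^i, \<alpha> g_i)\<close> plus
  \<open>\<Sum> \<beta>(\<alpha>^i, p_i)\<close>, and the extra sum equals
  \<open>\<beta>(p(\<alpha>), 1) = 0\<close> since the \<open>p_i\<close> lie in \<open>k\<close>.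
  The factor \<open>a\<close> is free here; \<open>exists_separability_element\<close> takes the
  inverse of \<open>g(\<alpha>)\<close>.\<close>

lemma casimir_central:
  assumes G: "abelian_group G" and p: "set p \<subseteq> k" "eval p \<alpha> = \<zero>"
    and g: "set g \<subseteq> carrier K" "p = poly_mult [\<one>, \<ominus> \<alpha>] g"
    and n: "length p \<le> n" "length g \<le> n"
    and \<alpha>: "\<alpha> \<in> carrier K" and a: "a \<in> carrier K"
  shows "\<alpha> \<in> central G (map (\<lambda>i. (a \<otimes> \<alpha> [^] i, coeff g i)) [0..<n])"
proof -
  interpret G: abelian_group G by fact
  have pK: "set p \<subseteq> carrier K" using p k_carrier by auto
  have p_k: "coeff p i \<in> k" for i
    using p(1) coeff_img(3)[of p] subringE(2)[OF k_subring] by (metis insert_subset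
      Un_insert_right image_subset_iff range_eqI subsetD sup_bot.right_neutral)
  have core: "list_sum G (\<lambda>i. \<beta> (\<alpha> \<otimes> \<alpha> [^] i) (coeff g i)) [0..<n] =
      list_sum G (\<lambda>i. \<beta> (\<alpha> [^] i) (\<alpha> \<otimes> coeff g i)) [0..<n]" if \<beta>: "balanced G \<beta>" for \<beta>
  proof -
    let ?T = "\<lambda>i. \<beta> (\<alpha> [^] i) (coeff p i)" and ?U = "\<lambda>i. \<beta> (\<alpha> [^] i) (\<alpha> \<otimes> coeff g i)"
    note [simp] = balancedD(1)[OF \<beta>] \<alpha> pK g(1)
    have TU: "?T i \<oplus>\<^bsub>G\<^esub> ?U i = \<beta> (\<alpha> [^] i) (coeff p i \<oplus> \<alpha> \<otimes> coeff g i)" for i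
      by (rule balancedD(3)[OF \<beta>, symmetric]) auto
    have "?T 0 \<oplus>\<^bsub>G\<^esub> ?U 0 = \<zero>\<^bsub>G\<^esub>"
      unfolding TU using coeff_mult_linear(1)[OF g(1) \<alpha>] g(2) balanced_zero(1)[OF G \<beta>]
      by (simp add: l_neg)
    moreover have "?T (Suc i) \<oplus>\<^bsub>G\<^esub> ?U (Suc i) = \<beta> (\<alpha> \<otimes> \<alpha> [^] i) (coeff g i)" for i
      unfolding TU using coeff_mult_linear(2)[OF g(1) \<alpha>, of i] g(2)
      by (simp add: minus_eq a_assoc l_neg m_comm)
    \<comment> \<open>The summand at 0 vanishes and the one at \<open>Suc i\<close> is the wanted
      one at \<open>i\<close>, hence the upper bound \<open>Suc n\<close>.\<close>
    ultimately have "list_sum G (\<lambda>i. \<beta> (\<alpha> \<otimes> \<alpha> [^] i) (coeff g i)) [0..<n] = list_sum G (\<lambda>i. ?T i \<oplus>\<^bsub>G\<^esub> ?U i) [0..<Suc n]"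
      by (simp del: upt_Suc add: G.list_sum_upt_Suc_shift G.list_sum_closed)
    also have "\<dots> = list_sum G ?T [0..<Suc n] \<oplus>\<^bsub>G\<^esub> list_sum G ?U [0..<Suc n]"
      by (rule G.list_sum_addf) auto
    \<comment> \<open>The coefficient of \<open>p\<close> moves from the second argument, where it
      leaves \<open>\<one>\<close>, to the first.\<close>
    also have "list_sum G ?T [0..<Suc n] = list_sum G (\<lambda>i. \<beta> (coeff p i \<otimes> \<alpha> [^] i) \<one>) [0..<Suc n]"
      by (rule list_sum_cong) (simp add: balancedD(4)[OF \<beta> p_k])
    also have "\<dots> = \<beta> (list_sum K (\<lambda>i. coeff p i \<otimes> \<alpha> [^] i) [0..<Suc n]) \<one>"
      by (rule hom_add_list_sum[symmetric, OF _ G])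
        (auto simp: hom_def balancedD(2)[OF \<beta>] abelian_group_axioms)
    also have "list_sum K (\<lambda>i. coeff p i \<otimes> \<alpha> [^] i) [0..<Suc n] = \<zero>"
      using eval_eq_list_sum[OF pK \<alpha>, of "Suc n"] n p by simp
    \<comment> \<open>The term at \<open>n\<close> vanishes because \<open>n\<close> bounds the
      length of \<open>g\<close>.\<close>
    also have "list_sum G ?U [0..<Suc n] = list_sum G ?U [0..<n]"
      using n balanced_zero(1)[OF G \<beta>]
      by (subst G.list_sum_upt_Suc) (auto simp: coeff_length G.list_sum_closed)
    finally show ?thesis using balanced_zero(2)[OF G \<beta>] by (simp add: G.list_sum_closed)
  qed
  \<comment> \<open>The factor \<open>a\<close> enters by applying \<open>core\<close> to
    \<open>\<beta>\<close> premultiplied by \<open>a\<close> in its first argument.\<close>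
  have "list_sum G (\<lambda>i. \<beta> (\<alpha> \<otimes> (a \<otimes> \<alpha> [^] i)) (coeff g i)) [0..<n] =
      list_sum G (\<lambda>i. \<beta> (a \<otimes> \<alpha> [^] i) (\<alpha> \<otimes> coeff g i)) [0..<n]" if \<beta>: "balanced G \<beta>" for \<beta>
    using core[OF balanced_mult[OF \<beta> a one_closed]] a \<alpha> g(1) by (simp add: m_lcomm)
  then show ?thesis using \<alpha> by (simp add: central_def list_sum_map)
qed

end

text \<open>A homomorphism of fields keeps leading coefficients nonzero, so the normalisation in
  \<open>poly_mult_hom'\<close> changes nothing.\<close>

lemma poly_map_mult:
  assumes h: "h \<in> ring_hom R S" and R: "field R" and S: "field S"
    and p: "p \<in> carrier (poly_ring R)" and q: "q \<in> carrier (poly_ring R)"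
  shows "map h (p \<otimes>\<^bsub>poly_ring R\<^esub> q) = map h p \<otimes>\<^bsub>poly_ring S\<^esub> map h q"
proof -
  interpret R: field R by fact
  interpret S: field S by fact
  interpret h: ring_hom_ring R S h
    by (rule ring_hom_ringI2[OF R.ring_axioms S.ring_axioms h])
  have "p \<otimes>\<^bsub>poly_ring R\<^esub> q \<in> carrier (poly_ring R)"
    using p q R.univ_poly_is_ring[OF R.carrier_is_subring] by (simp add: ring.ring_simprules)
  from polynomial_hom[OF h R S this]
  have "S.normalize (map h (p \<otimes>\<^bsub>poly_ring R\<^esub> q)) = map h (p \<otimes>\<^bsub>poly_ring R\<^esub> q)"
    by (intro S.normalize_polynomial) (simp add: univ_poly_carrier[symmetric])
  then show ?thesis
    using h.poly_mult_hom'[of p q] p q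
    by (simp add: univ_poly_mult univ_poly_carrier[symmetric] R.polynomial_incl)
qed

text \<open>\<open>separable_polynomial\<close> speaks of roots in the algebraic closure; a square
  \<open>(X - x)^2\<close> that divides \<open>p\<close> over the field itself is mapped to one that
  divides the image of \<open>p\<close> there.\<close>

lemma (in field) separable_polynomial_alg_mult:
  assumes "separable_polynomial R p" and p: "p \<in> carrier (poly_ring R)" and x: "x \<in> carrier R"
  shows "alg_mult p x \<le> 1"
proof (rule ccontr)
  assume "\<not> alg_mult p x \<le> 1"
  define L where "L = alg_closure"
  have "algebraic_closure L (indexed_const ` carrier R)" and h: "indexed_const \<in> ring_hom R L"
    unfolding L_def by (rule alg_closureE)+
  then interpret L: algebraic_closure L "indexed_const ` carrier R" by simp
  interpret h: ring_hom_ring R L indexed_const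
    by (rule ring_hom_ringI2[OF ring_axioms L.ring_axioms h])
  interpret P: ring "poly_ring R" by (rule univ_poly_is_ring[OF carrier_is_subring])
  interpret PL: ring "poly_ring L" by (rule L.univ_poly_is_ring[OF L.carrier_is_subring])
  have ne: "p \<noteq> []" and mult: "\<And>y. y \<in> carrier L \<Longrightarrow> L.alg_mult (map indexed_const p) y \<le> 1"
    using assms(1) unfolding separable_polynomial_def L_def by auto
  let ?l = "[\<one>, \<ominus> x]"
  have l: "?l \<in> carrier (poly_ring R)" using x by (simp add: univ_poly_carrier[symmetric] polynomial_def)
  have map_l: "map indexed_const ?l = [\<one>\<^bsub>L\<^esub>, \<ominus>\<^bsub>L\<^esub> indexed_const x]"
    using x by simp
  have "?l [^]\<^bsub>poly_ring R\<^esub> (2::nat) pdivides p"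
    by (rule le_alg_mult_imp_pdivides[OF x p]) (use \<open>\<not> alg_mult p x \<le> 1\<close> in simp)
  then obtain q where q: "q \<in> carrier (poly_ring R)"
    "p = (?l \<otimes>\<^bsub>poly_ring R\<^esub> ?l) \<otimes>\<^bsub>poly_ring R\<^esub> q"
    using l by (auto simp: pdivides_def factor_def numeral_2_eq_2)
  note mm = poly_map_mult[OF h field_axioms L.field_axioms]
  have "map indexed_const p = ([\<one>\<^bsub>L\<^esub>, \<ominus>\<^bsub>L\<^esub> indexed_const x] [^]\<^bsub>poly_ring L\<^esub> (2::nat)) \<otimes>\<^bsub>poly_ring L\<^esub> map indexed_const q"
    using l q polynomial_hom[OF h field_axioms L.field_axioms l]
    by (simp add: mm map_l[symmetric] numeral_2_eq_2 del: list.map)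
  then have "[\<one>\<^bsub>L\<^esub>, \<ominus>\<^bsub>L\<^esub> indexed_const x] [^]\<^bsub>poly_ring L\<^esub> (2::nat) pdivides\<^bsub>L\<^esub> map indexed_const p"
    using polynomial_hom[OF h field_axioms L.field_axioms q(1)] unfolding pdivides_def factor_def by auto
  from L.alg_multE(2)[OF _ polynomial_hom[OF h field_axioms L.field_axioms p] _ this]
  show False using mult[of "indexed_const x"] x ne by fastforce
qed

context field_extension
begin

text \<open>If \<open>g\<close> also vanished at \<open>\<alpha>\<close>, a second linear factor
  would split off and \<open>\<alpha>\<close> would be a double root of \<open>p\<close>.\<close>

lemma separable_factor:
  assumes p: "p \<in> carrier (poly_ring K)" "separable_polynomial K p" and \<alpha>: "\<alpha> \<in> carrier K" "eval p \<alpha> = \<zero>"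
  obtains g where "g \<in> carrier (poly_ring K)" "p = poly_mult [\<one>, \<ominus> \<alpha>] g" "eval g \<alpha> \<noteq> \<zero>"
proof -
  interpret P: ring "poly_ring K" by (rule univ_poly_is_ring[OF carrier_is_subring])
  let ?l = "[\<one>, \<ominus> \<alpha>]"
  have l: "?l \<in> carrier (poly_ring K)" using \<alpha> by (simp add: univ_poly_carrier[symmetric] polynomial_def)
  have ne: "p \<noteq> []" using p(2) by (auto simp: separable_polynomial_def)
  then have "?l pdivides p"
    using is_root_imp_pdivides[OF p(1), of \<alpha>] \<alpha> by (auto simp: is_root_def)
  then obtain g where g: "g \<in> carrier (poly_ring K)" "p = ?l \<otimes>\<^bsub>poly_ring K\<^esub> g"
    by (auto simp: pdivides_def factor_def)
  have "eval g \<alpha> \<noteq> \<zero>"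
  proof
    assume "eval g \<alpha> = \<zero>"
    \<comment> \<open>\<open>is_root\<close> excludes the zero polynomial, so this has to be ruled
      out before a factor can be split off.\<close>
    moreover have "g \<noteq> []" using g ne by (auto simp: univ_poly_mult poly_mult_zero)
    ultimately have "?l pdivides g"
      using is_root_imp_pdivides[OF g(1), of \<alpha>] \<alpha> by (auto simp: is_root_def)
    then obtain q where "q \<in> carrier (poly_ring K)" "g = ?l \<otimes>\<^bsub>poly_ring K\<^esub> q"
      by (auto simp: pdivides_def factor_def)
    then have "?l [^]\<^bsub>poly_ring K\<^esub> (2::nat) pdivides p"
      using g l by (auto simp: pdivides_def factor_def numeral_2_eq_2 P.m_assoc)
    then show False
      using alg_multE(2)[OF \<alpha>(1) p(1) ne, of 2] separable_polynomial_alg_mult[OF p(2,1) \<alpha>(1)] by simp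
  qed
  then show ?thesis using that g by (simp add: univ_poly_mult)
qed

text \<open>This is multiplicativity of the multiplication map
  \<open>K \<otimes> K \<rightarrow> K\<close>; it preserves the normalisation to
  \<open>\<one>\<close> when lists are multiplied.\<close>

lemma sum_mult_product:
  assumes ps: "set ps \<subseteq> carrier K \<times> carrier K" and qs: "set qs \<subseteq> carrier K \<times> carrier K"
  shows "list_sum K (\<lambda>(x, y). x \<otimes> y) (map (\<lambda>((x, y), (x', y')). (x \<otimes> x', y \<otimes> y')) (List.product ps qs)) =
    list_sum K (\<lambda>(x, y). x \<otimes> y) ps \<otimes> list_sum K (\<lambda>(x, y). x \<otimes> y) qs"
proof -
  have mult_sum: "a \<otimes> list_sum K f xs = list_sum K (\<lambda>x. a \<otimes> f x) xs"
    if "a \<in> carrier K" "\<And>x. x \<in> set xs \<Longrightarrow> f x \<in> carrier K" for a f and xs :: "('a \<times> 'a) list"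
    using that by (intro hom_add_list_sum) (auto simp: hom_def r_distr abelian_group_axioms)
  have p: "x \<in> carrier K" "y \<in> carrier K" if "(x, y) \<in> set ps" for x y using that ps by auto
  have q: "x \<in> carrier K" "y \<in> carrier K" if "(x, y) \<in> set qs" for x y using that qs by auto
  let ?q = "list_sum K (\<lambda>(x, y). x \<otimes> y) qs"
  have Q: "?q \<in> carrier K" using q by (intro list_sum_closed) auto
  have "list_sum K (\<lambda>(x, y). x \<otimes> y) (map (\<lambda>((x, y), (x', y')). (x \<otimes> x', y \<otimes> y')) (List.product ps qs)) =
    list_sum K (\<lambda>(x, y). list_sum K (\<lambda>(x', y'). (x \<otimes> y) \<otimes> (x' \<otimes> y')) qs) ps"
    using p q by (subst list_sum_map, subst list_sum_product)
      (auto simp: case_prod_beta m_ac intro!: list_sum_cong)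
  also have "\<dots> = list_sum K (\<lambda>z. ?q \<otimes> (case z of (x, y) \<Rightarrow> x \<otimes> y)) ps"
  proof (rule list_sum_cong, clarify)
    fix x y assume xy: "(x, y) \<in> set ps"
    show "list_sum K (\<lambda>(x', y'). (x \<otimes> y) \<otimes> (x' \<otimes> y')) qs = ?q \<otimes> (x \<otimes> y)"
      using p[OF xy] q unfolding case_prod_beta
      by (subst m_comm, (auto intro!: list_sum_closed)[2], subst mult_sum) auto
  qed
  also have "\<dots> = ?q \<otimes> list_sum K (\<lambda>(x, y). x \<otimes> y) ps"
    using p q Q by (intro mult_sum[symmetric]) auto
  also have "\<dots> = list_sum K (\<lambda>(x, y). x \<otimes> y) ps \<otimes> ?q"
    using p by (intro m_comm[OF Q] list_sum_closed) auto
  finally show ?thesis .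
qed

text \<open>Balanced maps into all groups cannot be quantified over at once, as their types differ; below the
  targets needed are \<open>K \<otimes>\<^sub>k M\<close> and \<open>K\<close>.\<close>

lemma exists_separability_element:
  assumes G: "abelian_group G" and H: "abelian_group H" and sep: "separable_extension k K"
    and fin: "finite_dimension k (carrier K)"
  obtains ps where "set ps \<subseteq> carrier K \<times> carrier K" "list_sum K (\<lambda>(x, y). x \<otimes> y) ps = \<one>"
    "central G ps = carrier K" "central H ps = carrier K"
proof -
  have gen: "\<exists>ps. set ps \<subseteq> carrier K \<times> carrier K \<and> list_sum K (\<lambda>(x, y). x \<otimes> y) ps = \<one> \<and>
      set us \<subseteq> central G ps \<and> set us \<subseteq> central H ps" if "set us \<subseteq> carrier K" for us
    using that
  proof (induction us)
    case Nil
    \<comment> \<open>With no element required to be central, \<open>1 \<otimes> 1\<close> will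
      do.\<close>
    show ?case by (rule exI[of _ "[(\<one>, \<one>)]"]) auto
  next
    case (Cons \<alpha> us)
    then obtain ps where ps: "set ps \<subseteq> carrier K \<times> carrier K" "list_sum K (\<lambda>(x, y). x \<otimes> y) ps = \<one>"
      "set us \<subseteq> central G ps" "set us \<subseteq> central H ps" by auto
    have \<alpha>: "\<alpha> \<in> carrier K" using Cons by simp
    define p where "p = Irr k \<alpha>"
    have alg: "(algebraic over k) \<alpha>" and sp: "separable_polynomial K p"
      using sep \<alpha> by (auto simp: separable_extension_def over_def p_def)
    have p: "p \<in> carrier (k[X])" "eval p \<alpha> = \<zero>"
      unfolding p_def using IrrE[OF k_subfield \<alpha> alg] by auto
    obtain g where g: "g \<in> carrier (poly_ring K)" "p = poly_mult [\<one>, \<ominus> \<alpha>] g" "eval g \<alpha> \<noteq> \<zero>"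
      using separable_factor[OF carrier_polynomial_shell[OF k_subring p(1)] sp \<alpha> p(2)] by blast
    \<comment> \<open>A common bound for both lengths, as \<open>casimir_central\<close>
      requires.\<close>
    define n where "n = length p + length g"
    \<comment> \<open>Without this factor the sum of products would be \<open>g(\<alpha>)\<close>
      instead of \<open>\<one>\<close>.\<close>
    define a where "a = inv (eval g \<alpha>)"
    define qs where "qs = map (\<lambda>i. (a \<otimes> \<alpha> [^] i, coeff g i)) [0..<n]"
    have gK: "set g \<subseteq> carrier K" and pk: "set p \<subseteq> k"
      using g(1) p(1) by (auto simp: univ_poly_carrier[symmetric] dest: polynomial_incl)
    have ev: "eval g \<alpha> \<in> carrier K" using gK \<alpha> eval_in_carrier by blast
    then have a: "a \<in> carrier K" "a \<otimes> eval g \<alpha> = \<one>"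
      using g(3) by (auto simp: a_def field_Units)
    have qs: "set qs \<subseteq> carrier K \<times> carrier K"
      using a \<alpha> gK by (auto simp: qs_def)
    have c: "\<alpha> \<in> central G qs" "\<alpha> \<in> central H qs"
      unfolding qs_def by (rule casimir_central[OF _ pk p(2) gK g(2)]; use G H a \<alpha> in \<open>simp add: n_def\<close>)+
    have "list_sum K (\<lambda>(x, y). x \<otimes> y) qs = list_sum K (\<lambda>i. a \<otimes> (coeff g i \<otimes> \<alpha> [^] i)) [0..<n]"
      unfolding qs_def list_sum_map by (rule list_sum_cong) (use a \<alpha> gK in \<open>auto simp: m_ac\<close>)
    also have "\<dots> = a \<otimes> list_sum K (\<lambda>i. coeff g i \<otimes> \<alpha> [^] i) [0..<n]"
      using a \<alpha> gK by (intro hom_add_list_sum[symmetric]) (auto simp: hom_def r_distr abelian_group_axioms)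
    also have "\<dots> = \<one>" using eval_eq_list_sum[OF gK \<alpha>, of n] a by (simp add: n_def)
    finally have "list_sum K (\<lambda>(x, y). x \<otimes> y) qs = \<one>" .
    \<comment> \<open>The product keeps the entries of \<open>us\<close> central through
      \<open>ps\<close> and gains \<open>\<alpha>\<close> through \<open>qs\<close>.\<close>
    then show ?case
      using ps qs c sum_mult_product[OF qs ps(1)] central_product[OF G qs ps(1)] central_product[OF H qs ps(1)]
      by (intro exI[of _ "map (\<lambda>((x, y), (x', y')). (x \<otimes> x', y \<otimes> y')) (List.product qs ps)"]) auto
  qed
  obtain n where "dimension n k (carrier K)" using fin by blast
  then obtain us where us: "set us \<subseteq> carrier K" "Span k us = carrier K"
    using exists_base[OF k_subfield] by blast
  then obtain ps where "set ps \<subseteq> carrier K \<times> carrier K" "list_sum K (\<lambda>(x, y). x \<otimes> y) ps = \<one>"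
      "set us \<subseteq> central G ps" "set us \<subseteq> central H ps" using gen by blast
  with that us show ?thesis using central_eq_carrier[OF G] central_eq_carrier[OF H] by blast
qed

end

section \<open>Galois groups of normal extensions\<close>

lemma (in field) normal_splitted:
  assumes "normal_extension k R" "p \<in> carrier (k[X])" "pirreducible k p" "x \<in> carrier R" "eval p x = \<zero>"
    and "p \<noteq> []"
  shows "splitted p"
  using assms unfolding normal_extension_def is_root_def by blast

section \<open>Extending embeddings into a normal extension\<close>

context field_extension
begin

text \<open>The map on \<open>L[X]\<close> that is \<open>s\<close> on constants and sends the
  variable to \<open>a\<close>. It descends to \<open>simple_extension L \<alpha>\<close> when
  \<open>a\<close> is a root of the transported minimal polynomial of
  \<open>\<alpha>\<close>.\<close>

definition poly_subst :: "('a \<Rightarrow> 'a) \<Rightarrow> 'a \<Rightarrow> 'a list \<Rightarrow> 'a"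
  where "poly_subst s a p = eval (map s p) a"

text \<open>Sums and products of mapped polynomials are compared after normalisation, and removing
  leading zeros does not change the value at \<open>a\<close>.\<close>

lemma poly_subst_hom:
  assumes L: "subfield L K" and s: "s \<in> ring_hom (K\<lparr>carrier := L\<rparr>) K" and a: "a \<in> carrier K"
  shows "poly_subst s a \<in> ring_hom (L[X]) K"
proof -
  note sub = subfieldE(1)[OF L]
  interpret L: field "K\<lparr>carrier := L\<rparr>" by (rule subfield_iff(2)[OF L])
  interpret sh: ring_hom_ring "K\<lparr>carrier := L\<rparr>" K s
    by (rule ring_hom_ringI2[OF L.ring_axioms ring_axioms s])
  have set_map: "set (map s p) \<subseteq> carrier K" if "set p \<subseteq> L" for p using that sh.hom_closed by auto
  have set_p: "set p \<subseteq> L" if "p \<in> carrier (L[X])" for p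
    using that by (simp add: univ_poly_carrier[symmetric] polynomial_incl)
  show ?thesis
  proof (rule ring_hom_memI)
    fix p q assume pq: "p \<in> carrier (L[X])" "q \<in> carrier (L[X])"
    have "set (poly_add p q) \<subseteq> L" "set (poly_mult p q) \<subseteq> L"
      using poly_add_is_polynomial[OF sub set_p[OF pq(1)] set_p[OF pq(2)]]
        poly_mult_is_polynomial[OF sub set_p[OF pq(1)] set_p[OF pq(2)]] polynomial_incl by blast+
    note s1 = this[THEN set_map]
    show "poly_subst s a (p \<oplus>\<^bsub>L[X]\<^esub> q) = poly_subst s a p \<oplus> poly_subst s a q"
      using sh.poly_add_hom'[of p q] set_p pq eval_normalize[OF s1(1) a] set_map a
      by (simp add: poly_subst_def univ_poly_add poly_add_consistent[OF sub] eval_poly_add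
          del: poly_add.simps)
    show "poly_subst s a (p \<otimes>\<^bsub>L[X]\<^esub> q) = poly_subst s a p \<otimes> poly_subst s a q"
      using sh.poly_mult_hom'[of p q] set_p pq eval_normalize[OF s1(2) a] set_map a
      by (simp add: poly_subst_def univ_poly_mult poly_mult_consistent[OF sub] eval_poly_mult
          del: poly_mult.simps)
    show "poly_subst s a p \<in> carrier K"
      unfolding poly_subst_def by (intro eval_in_carrier set_map set_p pq a)
  next
    show "poly_subst s a \<one>\<^bsub>L[X]\<^esub> = \<one>"
      using sh.hom_one a by (simp add: poly_subst_def univ_poly_one)
  qed
qed

text \<open>The field \<open>L(\<alpha>)\<close> is the image of \<open>L[X]\<close> under
  evaluation at \<open>\<alpha>\<close>, whose kernel consists of the multiples of
  \<open>Irr L \<alpha>\<close>. The map \<open>poly_subst s a\<close> kills these, because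
  \<open>a\<close> is a root of the transported polynomial, and so factors through the
  image.\<close>

lemma extend_hom_with_root:
  assumes L: "subfield L K" and s: "s \<in> ring_hom (K\<lparr>carrier := L\<rparr>) K"
    and \<alpha>: "\<alpha> \<in> carrier K" "(algebraic over L) \<alpha>"
    and a: "a \<in> carrier K" "eval (map s (Irr L \<alpha>)) a = \<zero>"
  obtains \<tau> where "\<tau> \<in> ring_hom (K\<lparr>carrier := simple_extension L \<alpha>\<rparr>) K"
    "\<And>x. x \<in> L \<Longrightarrow> \<tau> x = s x" "\<tau> \<alpha> = a"
proof -
  note sub = subfieldE(1)[OF L]
  have LK: "L \<subseteq> carrier K" using subfieldE(3)[OF L] .
  interpret L: field "K\<lparr>carrier := L\<rparr>" by (rule subfield_iff(2)[OF L])
  interpret sh: ring_hom_ring "K\<lparr>carrier := L\<rparr>" K s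
    by (rule ring_hom_ringI2[OF L.ring_axioms ring_axioms s])
  interpret P: ring "L[X]" by (rule univ_poly_is_ring[OF sub])
  interpret e: ring_hom_ring "L[X]" K "\<lambda>p. eval p \<alpha>" by (rule eval_ring_hom[OF sub \<alpha>(1)])
  interpret e': ring_hom_ring "L[X]" K "poly_subst s a"
    by (rule ring_hom_ringI2[OF P.ring_axioms ring_axioms poly_subst_hom[OF L s a(1)]])
  have img: "simple_extension L \<alpha> = (\<lambda>p. eval p \<alpha>) ` carrier (L[X])"
    by (rule simple_extension_as_eval_img[OF LK \<alpha>(1)])
  have kernel: "poly_subst s a p = \<zero>" if p: "p \<in> carrier (L[X])" "eval p \<alpha> = \<zero>" for p
  proof -
    note Irr = IrrE[OF L \<alpha>]
    have "Irr L \<alpha> divides\<^bsub>L[X]\<^esub> p"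
      using Irr_minimal[OF L \<alpha> p] pdivides_iff_shell[OF L Irr(1) p(1)] by simp
    then obtain r where "r \<in> carrier (L[X])" "p = Irr L \<alpha> \<otimes>\<^bsub>L[X]\<^esub> r"
      by (auto simp: factor_def)
    then show ?thesis using a(2) Irr(1) by (simp add: poly_subst_def[of s a "Irr L \<alpha>"])
  qed
  have wd: "poly_subst s a p = poly_subst s a q"
    if pq: "p \<in> carrier (L[X])" "q \<in> carrier (L[X])" "eval p \<alpha> = eval q \<alpha>" for p q
  proof -
    have "poly_subst s a (p \<ominus>\<^bsub>L[X]\<^esub> q) = \<zero>"
      using pq by (intro kernel) (auto simp: P.minus_eq r_neg)
    then have "poly_subst s a p \<ominus> poly_subst s a q = \<zero>" using pq by (simp add: P.minus_eq minus_eq)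
    then show ?thesis using pq by simp
  qed
  \<comment> \<open>A polynomial representing \<open>y\<close> is chosen; by \<open>wd\<close> the
    choice does not affect the value.\<close>
  define \<tau> where "\<tau> y = poly_subst s a (SOME p. p \<in> carrier (L[X]) \<and> eval p \<alpha> = y)" for y
  have \<tau>: "\<tau> (eval p \<alpha>) = poly_subst s a p" if "p \<in> carrier (L[X])" for p
    unfolding \<tau>_def by (rule someI2[of _ p]) (use that in \<open>auto intro: wd\<close>)
  show ?thesis
  proof
    show "\<tau> \<in> ring_hom (K\<lparr>carrier := simple_extension L \<alpha>\<rparr>) K"
    proof (rule ring_hom_memI, simp_all add: img)
      fix x y assume "x \<in> (\<lambda>p. eval p \<alpha>) ` carrier (L[X])" "y \<in> (\<lambda>p. eval p \<alpha>) ` carrier (L[X])"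
      then show "\<tau> (x \<oplus> y) = \<tau> x \<oplus> \<tau> y" "\<tau> (x \<otimes> y) = \<tau> x \<otimes> \<tau> y"
        by (auto simp: \<tau> e.hom_add[symmetric] e.hom_mult[symmetric] simp del: e.hom_add e.hom_mult)
    next
      fix x assume "x \<in> (\<lambda>p. eval p \<alpha>) ` carrier (L[X])"
      then show "\<tau> x \<in> carrier K" by (auto simp: \<tau>)
    next
      show "\<tau> \<one> = \<one>" using \<tau>[OF P.one_closed] by simp
    qed
    show "\<tau> x = s x" if "x \<in> L" for x
    proof -
      \<comment> \<open>The zero constant is the empty list rather than \<open>[\<zero>]\<close>,
        which causes the case split below.\<close>
      have "poly_of_const x \<in> carrier (L[X])"
        using that normalize_gives_polynomial[of "[x]" L]
        by (simp add: poly_of_const_def univ_poly_carrier[symmetric] del: normalize.simps)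
      moreover have "x \<in> carrier K" "s x \<in> carrier K" using that LK sh.hom_closed by auto
      ultimately show ?thesis using \<tau>[of "poly_of_const x"] a(1) sh.hom_zero \<alpha>(1)
        by (auto simp: poly_subst_def poly_of_const_def split: if_splits)
    qed
    have "X \<in> carrier (L[X])" by (rule var_closed[OF sub])
    moreover have "s \<zero> = \<zero>" "s \<one> = \<one>" using sh.hom_zero sh.hom_one by simp_all
    ultimately show "\<tau> \<alpha> = a" using \<tau>[of X] eval_var[OF \<alpha>(1)] eval_var[OF a(1)]
      by (simp add: poly_subst_def var_def)
  qed
qed

text \<open>Over \<open>L\<close> the minimal polynomial of \<open>\<alpha>\<close> divides the one
  over \<open>k\<close>. As \<open>s\<close> fixes \<open>k\<close>, the transported polynomial
  divides the latter too; that one splits by normality, and every factor of positive degree then has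
  a root.\<close>

lemma normal_exists_conjugate_root:
  assumes L: "subfield L K" "k \<subseteq> L" and s: "s \<in> ring_hom (K\<lparr>carrier := L\<rparr>) K" "\<And>c. c \<in> k \<Longrightarrow> s c = c"
    and normal: "normal_extension k K" and \<alpha>: "\<alpha> \<in> carrier K"
  obtains a where "a \<in> carrier K" "eval (map s (Irr L \<alpha>)) a = \<zero>"
proof -
  note sub = subfieldE(1)[OF L(1)]
  interpret L: field "K\<lparr>carrier := L\<rparr>" by (rule subfield_iff(2)[OF L(1)])
  have PL: "poly_ring (K\<lparr>carrier := L\<rparr>) = L[X]" by (simp add: univ_poly_consistent[OF sub])
  have algk: "(algebraic over k) \<alpha>" using normal \<alpha> by (auto simp: normal_extension_def over_def)
  have algL: "(algebraic over L) \<alpha>" by (rule algebraic_mono[OF L(2) algk])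
  define p where "p = Irr k \<alpha>"
  define f where "f = Irr L \<alpha>"
  note p = IrrE[OF k_subfield \<alpha> algk, folded p_def]
  note f = IrrE[OF L(1) \<alpha> algL, folded f_def]
  have pne: "p \<noteq> []" using pirreducibleE(1)[OF k_subring p(1,2)] .
  have "carrier (k[X]) \<subseteq> carrier (L[X])" using L(2) by (force simp: univ_poly_carrier[symmetric] polynomial_def)
  then have pL: "p \<in> carrier (L[X])" using p by auto
  have "f divides\<^bsub>L[X]\<^esub> p"
    using Irr_minimal[OF L(1) \<alpha> algL pL p(4)] pdivides_iff_shell[OF L(1) f(1) pL] by (simp add: f_def)
  then obtain r where r: "r \<in> carrier (L[X])" "p = f \<otimes>\<^bsub>L[X]\<^esub> r" by (auto simp: factor_def)
  have hom: "map s q \<in> carrier (poly_ring K)" if "q \<in> carrier (L[X])" for q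
    using polynomial_hom[OF s(1) L.field_axioms field_axioms, of q] that PL by simp
  have "set p \<subseteq> k" using p(1) by (simp add: univ_poly_carrier[symmetric] polynomial_incl)
  then have "map s p = p" using s(2) by (intro map_idI) auto
  then have "p = map s f \<otimes>\<^bsub>poly_ring K\<^esub> map s r"
    using poly_map_mult[OF s(1) L.field_axioms field_axioms, of f r] f(1) r PL by simp
  then have "map s f pdivides p" using hom[OF r(1)] by (auto simp: pdivides_def factor_def)
  moreover have "splitted p" by (rule normal_splitted[OF normal p(1,2) \<alpha> p(4) pne])
  ultimately have "splitted (map s f)"
    using pdivides_imp_splitted[OF hom[OF f(1)] carrier_polynomial_shell[OF k_subring p(1)] pne] by simp
  moreover have "degree f \<ge> 1" using pirreducible_degree[OF L(1) f(1,2)] .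
  ultimately have "roots (map s f) \<noteq> {#}" by (auto simp: splitted_def)
  then obtain a where "a \<in># roots (map s f)" by blast
  then have "is_root (map s f) a" using roots_mem_iff_is_root[OF hom[OF f(1)]] by simp
  then show ?thesis using that by (auto simp: is_root_def f_def)
qed

text \<open>The entries of \<open>us\<close> are adjoined one at a time, each sent to a conjugate
  root. The field \<open>L'\<close> may stay unspecified: when \<open>us\<close> spans
  \<open>K\<close> over \<open>k\<close>, containing \<open>us\<close> forces it to be
  \<open>K\<close>.\<close>

lemma extend_hom:
  assumes normal: "normal_extension k K" and us: "set us \<subseteq> carrier K"
  shows "\<lbrakk>subfield L K; k \<subseteq> L; s \<in> ring_hom (K\<lparr>carrier := L\<rparr>) K; \<And>c. c \<in> k \<Longrightarrow> s c = c\<rbrakk> \<Longrightarrow>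
    \<exists>L' \<tau>. subfield L' K \<and> L \<subseteq> L' \<and> set us \<subseteq> L' \<and> \<tau> \<in> ring_hom (K\<lparr>carrier := L'\<rparr>) K \<and> (\<forall>x\<in>L. \<tau> x = s x)"
  using us
proof (induction us arbitrary: L s)
  case Nil
  then show ?case by auto
next
  case (Cons \<alpha> us)
  have \<alpha>: "\<alpha> \<in> carrier K" and us: "set us \<subseteq> carrier K" using Cons.prems by auto
  have LK: "L \<subseteq> carrier K" using subfieldE(3)[OF Cons.prems(1)] .
  have alg: "(algebraic over L) \<alpha>"
    using normal \<alpha> algebraic_mono[OF Cons.prems(2)] by (auto simp: normal_extension_def over_def)
  obtain a where a: "a \<in> carrier K" "eval (map s (Irr L \<alpha>)) a = \<zero>"
    using normal_exists_conjugate_root[OF Cons.prems(1-4) normal \<alpha>] by blast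
  obtain \<tau> where \<tau>: "\<tau> \<in> ring_hom (K\<lparr>carrier := simple_extension L \<alpha>\<rparr>) K" "\<And>x. x \<in> L \<Longrightarrow> \<tau> x = s x"
    using extend_hom_with_root[OF Cons.prems(1,3) \<alpha> alg a] by metis
  have E: "subfield (simple_extension L \<alpha>) K"
    using simple_extension_is_subfield[OF Cons.prems(1) \<alpha>] alg by simp
  have LE: "L \<subseteq> simple_extension L \<alpha>" by (rule simple_extension_incl[OF LK \<alpha>])
  have "\<exists>L' \<tau>'. subfield L' K \<and> simple_extension L \<alpha> \<subseteq> L' \<and> set us \<subseteq> L' \<and> \<tau>' \<in> ring_hom (K\<lparr>carrier := L'\<rparr>) K \<and>
      (\<forall>x\<in>simple_extension L \<alpha>. \<tau>' x = \<tau> x)"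
    by (rule Cons.IH) (use E LE \<tau> Cons.prems us in auto)
  moreover have "\<alpha> \<in> simple_extension L \<alpha>"
    by (rule simple_extension_mem[OF subfieldE(1)[OF Cons.prems(1)] \<alpha>])
  ultimately show ?case using LE \<tau>(2) by (metis insert_subset list.simps(15) subset_iff)
qed

text \<open>Injectivity is automatic for fields. Surjectivity holds because \<open>\<tau>\<close>
  maps the finite root set of the minimal polynomial of \<open>y\<close> injectively into itself, so
  \<open>y\<close> is attained.\<close>

lemma hom_imp_bij:
  assumes \<tau>: "\<tau> \<in> ring_hom K K" "\<And>c. c \<in> k \<Longrightarrow> \<tau> c = c"
    and alg: "\<And>x. x \<in> carrier K \<Longrightarrow> (algebraic over k) x"
  shows "bij_betw \<tau> (carrier K) (carrier K)"
proof -
  interpret t: ring_hom_ring K K \<tau> by (rule ring_hom_ringI2[OF ring_axioms ring_axioms \<tau>(1)])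
  have inj: "inj_on \<tau> (carrier K)"
    by (rule t.non_trivial_field_hom_imp_inj[OF field_axioms])
      (metis image_eqI one_closed singletonD t.hom_one zero_not_one)
  have "y \<in> \<tau> ` carrier K" if y: "y \<in> carrier K" for y
  proof -
    define p where "p = Irr k y"
    note p = IrrE[OF k_subfield y alg[OF y], folded p_def]
    have pK: "p \<in> carrier (poly_ring K)" by (rule carrier_polynomial_shell[OF k_subring p(1)])
    have pne: "p \<noteq> []" using pirreducibleE(1)[OF k_subring p(1,2)] .
    have "set p \<subseteq> k" using p(1) by (simp add: univ_poly_carrier[symmetric] polynomial_incl)
    then have map: "map \<tau> p = p" and "set p \<subseteq> carrier K"
      using \<tau>(2) k_carrier by (auto intro!: map_idI)
    let ?R = "{x. is_root p x}"
    have "\<tau> ` ?R \<subseteq> ?R"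
    proof clarify
      fix x assume "is_root p x"
      then have x: "x \<in> carrier K" "eval p x = \<zero>" by (auto simp: is_root_def)
      then have "eval p (\<tau> x) = \<tau> (eval p x)"
        using t.eval_hom'[OF x(1) \<open>set p \<subseteq> carrier K\<close>] map by metis
      then show "is_root p (\<tau> x)" using x pne by (simp add: is_root_def)
    qed
    moreover have "inj_on \<tau> ?R" by (rule inj_on_subset[OF inj]) (auto simp: is_root_def)
    ultimately have "\<tau> ` ?R = ?R"
      by (intro endo_inj_surj finite_number_of_roots[OF pK])
    moreover have "is_root p y" using y p(4) pne by (simp add: is_root_def)
    ultimately show ?thesis by (auto simp: is_root_def)
  qed
  then show ?thesis using inj t.hom_closed by (auto simp: bij_betw_def)
qed

text \<open>An element outside \<open>k\<close> has a minimal polynomial of degree at least 2. It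
  splits by normality, and separability lets \<open>x\<close> account for only one of its
  roots.\<close>

lemma other_root:
  assumes sep: "separable_extension k K" and normal: "normal_extension k K"
    and x: "x \<in> carrier K" "x \<notin> k"
  obtains y where "y \<in> carrier K" "y \<noteq> x" "eval (Irr k x) y = \<zero>"
proof -
  have alg: "(algebraic over k) x" and sp: "separable_polynomial K (Irr k x)"
    using sep x by (auto simp: separable_extension_def over_def)
  define p where "p = Irr k x"
  note p = IrrE[OF k_subfield x(1) alg, folded p_def]
  have pK: "p \<in> carrier (poly_ring K)" by (rule carrier_polynomial_shell[OF k_subring p(1)])
  have pne: "p \<noteq> []" using pirreducibleE(1)[OF k_subring p(1,2)] .
  have "degree p \<noteq> 1"
  proof
    assume "degree p = 1"
    then obtain b where b: "p = [\<one>, b]" "b \<in> k"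
      using p(1,3) by (elim degree_oneE) auto
    then have "x \<oplus> b = \<zero>" using p(4) x k_carrier by simp
    then have "x = \<ominus> b" using x b k_carrier by (simp add: minus_equality)
    then show False using x(2) b subringE(5)[OF k_subring] by simp
  qed
  then have "degree p \<ge> 2" using pirreducible_degree[OF k_subfield p(1,2)] by linarith
  moreover have "splitted p" by (rule normal_splitted[OF normal p(1,2) x(1) p(4) pne])
  ultimately have "size (roots p) \<ge> 2" by (simp add: splitted_def)
  moreover have "count (roots p) x \<le> 1"
    using separable_polynomial_alg_mult[OF sp[folded p_def] pK x(1)] alg_mult_eq_count_roots[OF pK] by simp
  \<comment> \<open>If \<open>x\<close> were the only root, the total number of roots would be its
    multiplicity, and at least 2 would be at most 1.\<close>
  moreover have "size (roots p) = count (roots p) x" if "\<forall>y\<in>#roots p. y = x"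
    using that set_mset_subset_singletonD[of "roots p" x] by (metis count_replicate_mset singletonI size_replicate_mset subsetI)
  ultimately have "\<not> (\<forall>y\<in>#roots p. y = x)" by fastforce
  then obtain y where "y \<in># roots p" "y \<noteq> x" by blast
  then show ?thesis using that roots_mem_iff_is_root[OF pK] by (auto simp: is_root_def p_def)
qed

text \<open>If \<open>x\<close> is outside \<open>k\<close>, it can be sent to another root of its
  minimal polynomial. This embedding of \<open>k(x)\<close> extends to \<open>K\<close>, and an
  automorphism that moves \<open>x\<close> results.\<close>

lemma fixed_field_galois_group:
  assumes fin: "finite_dimension k (carrier K)"
    and sep: "separable_extension k K" and normal: "normal_extension k K"
    and x: "x \<in> carrier K" and fixed: "\<And>\<phi>. \<phi> \<in> galois_group k K \<Longrightarrow> \<phi> x = x"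
  shows "x \<in> k"
proof (rule ccontr)
  assume "x \<notin> k"
  have alg: "(algebraic over k) y" if "y \<in> carrier K" for y
    using normal that by (auto simp: normal_extension_def over_def)
  obtain y where y: "y \<in> carrier K" "y \<noteq> x" "eval (Irr k x) y = \<zero>"
    using other_root[OF sep normal x \<open>x \<notin> k\<close>] by blast
  \<comment> \<open>The extension starts from the inclusion of \<open>k\<close> into
    \<open>K\<close>.\<close>
  have id: "id \<in> ring_hom (K\<lparr>carrier := k\<rparr>) K" using k_carrier by (auto simp: ring_hom_def)
  have "eval (map id (Irr k x)) y = \<zero>" using y by simp
  from extend_hom_with_root[OF k_subfield id x alg[OF x] y(1) this]
  obtain s where s: "s \<in> ring_hom (K\<lparr>carrier := simple_extension k x\<rparr>) K" "\<And>c. c \<in> k \<Longrightarrow> s c = c" "s x = y"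
    by auto
  obtain n where "dimension n k (carrier K)" using fin by blast
  then obtain us where us: "set us \<subseteq> carrier K" "Span k us = carrier K"
    using exists_base[OF k_subfield] by blast
  have E: "subfield (simple_extension k x) K" "k \<subseteq> simple_extension k x" "x \<in> simple_extension k x"
    using simple_extension_is_subfield[OF k_subfield x] alg[OF x] subfieldE(3)[OF k_subfield]
      simple_extension_incl x simple_extension_mem[OF k_subring] by auto
  obtain L \<tau> where L: "subfield L K" "simple_extension k x \<subseteq> L" "set us \<subseteq> L"
    "\<tau> \<in> ring_hom (K\<lparr>carrier := L\<rparr>) K" "\<And>z. z \<in> simple_extension k x \<Longrightarrow> \<tau> z = s z"
    using extend_hom[OF normal us(1) E(1,2) s(1,2)] by blast
  have "Span k us \<subseteq> L"
    by (rule Span_min[OF k_subfield us(1)])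
      (use subfieldE(1)[OF L(1)] L E in \<open>auto simp: set_mult_def subring_def intro!: subringE(6)[OF subfieldE(1)[OF L(1)]]\<close>)
  then have "L = carrier K" using us subfieldE(3)[OF L(1)] by auto
  then have \<tau>: "\<tau> \<in> ring_hom K K" using L(4) by simp
  have \<tau>k: "\<tau> c = c" if "c \<in> k" for c using that s(2) L(5) E(2) by auto
  \<comment> \<open>The restriction makes the map extensional, as \<open>Bij\<close>
    demands.\<close>
  have "restrict \<tau> (carrier K) \<in> galois_group k K"
    using hom_imp_bij[OF \<tau> \<tau>k alg] \<tau> \<tau>k k_carrier
    by (auto simp: galois_group_def Bij_def ring_hom_def bij_betw_restrict_eq)
  from fixed[OF this] have "\<tau> x = x" using x by simp
  then show False using L(5) E(3) s(3) y by auto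
qed

text \<open>An automorphism is determined by its values on a spanning list, and each value is one of
  the finitely many roots of a minimal polynomial.\<close>

lemma finite_galois_group:
  assumes fin: "finite_dimension k (carrier K)" and alg: "\<And>x. x \<in> carrier K \<Longrightarrow> (algebraic over k) x"
  shows "finite (galois_group k K)"
proof -
  obtain n where "dimension n k (carrier K)" using fin by blast
  then obtain us where us: "set us \<subseteq> carrier K" "Span k us = carrier K"
    using exists_base[OF k_subfield] by blast
  let ?R = "\<lambda>u. {x. is_root (Irr k u) x}"
  have hom: "ring_hom_ring K K \<phi>" if "\<phi> \<in> galois_group k K" for \<phi>
    using that by (intro ring_hom_ringI2 ring_axioms) (auto simp: galois_group_def)
  have root: "\<phi> u \<in> ?R u" if \<phi>: "\<phi> \<in> galois_group k K" and u: "u \<in> carrier K" for \<phi> u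
  proof -
    interpret t: ring_hom_ring K K \<phi> by (rule hom[OF \<phi>])
    note p = IrrE[OF k_subfield u alg[OF u]]
    have "set (Irr k u) \<subseteq> k" using p(1) by (simp add: univ_poly_carrier[symmetric] polynomial_incl)
    then have map: "map \<phi> (Irr k u) = Irr k u" and "set (Irr k u) \<subseteq> carrier K"
      using \<phi> k_carrier by (auto intro!: map_idI simp: galois_group_def)
    then have "eval (Irr k u) (\<phi> u) = \<phi> (eval (Irr k u) u)" using t.eval_hom'[OF u] by simp
    then show ?thesis using u p(4) pirreducibleE(1)[OF k_subring p(1,2)] by (simp add: is_root_def)
  qed
  have "inj_on (\<lambda>\<phi>. restrict \<phi> (set us)) (galois_group k K)"
  proof (rule inj_onI)
    fix \<phi> \<psi> assume \<phi>: "\<phi> \<in> galois_group k K" and \<psi>: "\<psi> \<in> galois_group k K"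
      and eq: "restrict \<phi> (set us) = restrict \<psi> (set us)"
    interpret s: ring_hom_ring K K \<phi> by (rule hom[OF \<phi>])
    interpret t: ring_hom_ring K K \<psi> by (rule hom[OF \<psi>])
    have k: "\<phi> c = c" "\<psi> c = c" if "c \<in> k" for c using that \<phi> \<psi> by (auto simp: galois_group_def)
    have us': "\<phi> u = \<psi> u" if "u \<in> set us" for u using eq that by (metis restrict_apply')
    \<comment> \<open>The set on which two automorphisms agree is a \<open>k\<close>-subspace, and
      it contains \<open>us\<close>.\<close>
    let ?E = "{x \<in> carrier K. \<phi> x = \<psi> x}"
    have "subgroup ?E (add_monoid K)"
      by (rule group.subgroupI) (use zero_closed in \<open>auto simp: a_inv_def[symmetric] add.is_group\<close>)
    then have "Span k us \<subseteq> ?E"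
      by (rule Span_min[OF k_subfield us(1)]) (use us(1) us' k k_carrier in \<open>auto simp: set_mult_def\<close>)
    then have "\<phi> x = \<psi> x" if "x \<in> carrier K" for x using that us by auto
    moreover have "\<phi> \<in> extensional (carrier K)" "\<psi> \<in> extensional (carrier K)"
      using \<phi> \<psi> by (auto simp: galois_group_def Bij_def)
    ultimately show "\<phi> = \<psi>" by (metis extensionalityI)
  qed
  moreover have "(\<lambda>\<phi>. restrict \<phi> (set us)) ` galois_group k K \<subseteq> (\<Pi>\<^sub>E u\<in>set us. ?R u)"
    using root us(1) by auto
  moreover have "finite (\<Pi>\<^sub>E u\<in>set us. ?R u)"
  proof (rule finite_PiE)
    fix u assume "u \<in> set us"
    then have u: "u \<in> carrier K" using us by auto
    show "finite (?R u)"
      by (rule finite_number_of_roots[OF carrier_polynomial_shell[OF k_subring IrrE(1)[OF k_subfield u alg[OF u]]]])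
  qed simp
  ultimately show ?thesis by (metis finite_imageD finite_subset)
qed

text \<open>This provides the inverses and the translations by which sums over the Galois group are
  reindexed.\<close>

lemma subgroup_galois_group: "subgroup (galois_group k K) (BijGroup (carrier K))"
proof (rule group.subgroupI[OF group_BijGroup])
  show "galois_group k K \<subseteq> carrier (BijGroup (carrier K))" by (auto simp: galois_group_def BijGroup_def)
  have "(\<lambda>x\<in>carrier K. x) \<in> galois_group k K"
    using k_carrier id_Bij[of "carrier K"] by (auto simp: galois_group_def ring_hom_def)
  then show "galois_group k K \<noteq> {}" by blast
next
  fix \<phi> assume "\<phi> \<in> galois_group k K"
  then have \<phi>: "\<phi> \<in> Bij (carrier K)" "\<phi> \<in> ring_hom K K" "\<And>c. c \<in> k \<Longrightarrow> \<phi> c = c"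
    by (auto simp: galois_group_def)
  have bij: "bij_betw \<phi> (carrier K) (carrier K)" using \<phi> by (auto simp: Bij_def)
  have add: "inv_into (carrier K) \<phi> (x \<oplus> y) = inv_into (carrier K) \<phi> x \<oplus> inv_into (carrier K) \<phi> y"
    if "x \<in> carrier K" "y \<in> carrier K" for x y
    by (rule Bij_inv_into_lemma[OF _ \<phi>(1)]) (use \<phi>(2) that in \<open>auto simp: ring_hom_def\<close>)
  have mult: "inv_into (carrier K) \<phi> (x \<otimes> y) = inv_into (carrier K) \<phi> x \<otimes> inv_into (carrier K) \<phi> y"
    if "x \<in> carrier K" "y \<in> carrier K" for x y
    by (rule Bij_inv_into_lemma[OF _ \<phi>(1)]) (use \<phi>(2) that in \<open>auto simp: ring_hom_def\<close>)
  have inv_fixes: "inv_into (carrier K) \<phi> c = c" if "c \<in> carrier K" "\<phi> c = c" for c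
    using that bij by (metis bij_betw_inv_into_left)
  have "\<phi> \<one> = \<one>" using \<phi>(2) by (simp add: ring_hom_def)
  then show "inv\<^bsub>BijGroup (carrier K)\<^esub> \<phi> \<in> galois_group k K"
    using restrict_inv_into_Bij[OF \<phi>(1)] add mult inv_fixes k_carrier \<phi> Bij_inv_into_mem[OF \<phi>(1)]
    by (auto simp: inv_BijGroup galois_group_def ring_hom_def)
next
  fix \<phi> \<psi> assume "\<phi> \<in> galois_group k K" "\<psi> \<in> galois_group k K"
  then show "\<phi> \<otimes>\<^bsub>BijGroup (carrier K)\<^esub> \<psi> \<in> galois_group k K"
    using k_carrier compose_Bij[of \<phi> "carrier K" \<psi>]
    by (auto simp: galois_group_def BijGroup_def ring_hom_def compose_def Pi_iff)
qed

end

section \<open>The universal property of the tensor product\<close>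

text \<open>The additive extension of \<open>f\<close> to formal combinations, written exactly as in
  \<open>mult_map\<close>, so that \<open>mult_map_eq\<close> holds by unfolding.\<close>

definition frag_sum :: "('g, 'h) ring_scheme \<Rightarrow> ('c \<Rightarrow> 'g) \<Rightarrow> ('c \<Rightarrow>\<^sub>0 int) \<Rightarrow> 'g"
  where "frag_sum G f z = (\<Oplus>\<^bsub>G\<^esub>p\<in>Poly_Mapping.keys z. add_pow G (Poly_Mapping.lookup z p) (f p))"

text \<open>Keys may cancel in \<open>x + y\<close>, so additivity is proved by summing over the
  union of the supports; the added terms are zero.\<close>

lemma (in abelian_group) frag_sum_superset:
  assumes "finite B" "Poly_Mapping.keys z \<subseteq> B" "f \<in> B \<rightarrow> carrier G"
  shows "frag_sum G f z = (\<Oplus>p\<in>B. add_pow G (Poly_Mapping.lookup z p) (f p))"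
  unfolding frag_sum_def
  by (rule add.finprod_mono_neutral_cong_left)
    (use assms in \<open>auto simp: in_keys_iff Pi_iff add_pow_def intro!: add.int_pow_closed[unfolded add_pow_def]\<close>)

lemma (in abelian_group) frag_sum_hom:
  assumes f: "f \<in> S \<rightarrow> carrier G"
  shows "frag_sum G f \<in> hom (free_Abelian_group S) (add_monoid G)"
proof (rule homI)
  fix x assume "x \<in> carrier (free_Abelian_group S)"
  then show "frag_sum G f x \<in> carrier (add_monoid G)"
    using f by (auto simp: frag_sum_def intro!: finsum_closed add.int_pow_closed)
next
  fix x y assume "x \<in> carrier (free_Abelian_group S)" "y \<in> carrier (free_Abelian_group S)"
  then have x: "Poly_Mapping.keys x \<subseteq> S" and y: "Poly_Mapping.keys y \<subseteq> S" by auto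
  define B where "B = Poly_Mapping.keys x \<union> Poly_Mapping.keys y"
  have B: "finite B" "f \<in> B \<rightarrow> carrier G" using x y f by (auto simp: B_def)
  have "frag_sum G f (x + y) = (\<Oplus>p\<in>B. add_pow G (Poly_Mapping.lookup (x + y) p) (f p))"
    by (rule frag_sum_superset[OF B(1) _ B(2)]) (simp add: B_def keys_add)
  also have "\<dots> = (\<Oplus>p\<in>B. add_pow G (Poly_Mapping.lookup x p) (f p) \<oplus> add_pow G (Poly_Mapping.lookup y p) (f p))"
    using B by (intro finsum_cong') (auto simp: lookup_add add.int_pow_mult Pi_iff)
  also have "\<dots> = (\<Oplus>p\<in>B. add_pow G (Poly_Mapping.lookup x p) (f p)) \<oplus> (\<Oplus>p\<in>B. add_pow G (Poly_Mapping.lookup y p) (f p))"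
    using B by (intro finsum_addf) (auto simp: Pi_iff)
  also have "(\<Oplus>p\<in>B. add_pow G (Poly_Mapping.lookup x p) (f p)) = frag_sum G f x"
    by (rule frag_sum_superset[symmetric, OF B(1) _ B(2)]) (simp add: B_def)
  also have "(\<Oplus>p\<in>B. add_pow G (Poly_Mapping.lookup y p) (f p)) = frag_sum G f y"
    by (rule frag_sum_superset[symmetric, OF B(1) _ B(2)]) (simp add: B_def)
  finally show "frag_sum G f (x \<otimes>\<^bsub>free_Abelian_group S\<^esub> y) = frag_sum G f x \<otimes>\<^bsub>add_monoid G\<^esub> frag_sum G f y"
    by simp
qed

lemma (in abelian_group) frag_sum_of: "f p \<in> carrier G \<Longrightarrow> frag_sum G f (frag_of p) = f p"
  by (simp add: frag_sum_def)

lemma (in abelian_group) minus_eq_zero_iff: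
  assumes "a \<in> carrier G" "b \<in> carrier G"
  shows "a \<ominus> b = \<zero> \<longleftrightarrow> a = b"
  using minus_equality[of a "\<ominus> b"] assms by (auto simp: minus_eq r_neg)

lemma hom_free_Abelian_group_diff:
  assumes "abelian_group G" and h: "h \<in> hom (free_Abelian_group S) (add_monoid G)"
    and "Poly_Mapping.keys x \<subseteq> S" "Poly_Mapping.keys y \<subseteq> S"
  shows "h (x - y) = h x \<ominus>\<^bsub>G\<^esub> h y"
proof -
  interpret G: abelian_group G by fact
  interpret h: group_hom "free_Abelian_group S" "add_monoid G" h
    using h by (simp add: group_hom_def group_hom_axioms_def G.a_group)
  have "h (x \<otimes>\<^bsub>free_Abelian_group S\<^esub> inv\<^bsub>free_Abelian_group S\<^esub> y) = h x \<oplus>\<^bsub>G\<^esub> inv\<^bsub>add_monoid G\<^esub> h y"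
    using assms(3,4) h.hom_inv[of y] h.hom_mult[of x "- y"] by simp
  then show ?thesis using assms(4) by (simp add: a_minus_def a_inv_def)
qed

text \<open>The map on classes induced by a balanced \<open>\<beta>\<close>, in the same
  \<open>the_elem\<close> form as \<open>mult_map\<close>; \<open>tensor_ext_class\<close> shows
  that the image is a singleton.\<close>

definition tensor_ext ::
  "('g, 'h) ring_scheme \<Rightarrow> ('v \<Rightarrow> 'w \<Rightarrow> 'g) \<Rightarrow> (('v \<times> 'w) \<Rightarrow>\<^sub>0 int) set \<Rightarrow> 'g"
  where "tensor_ext G \<beta> S = the_elem (frag_sum G (\<lambda>p. \<beta> (fst p) (snd p)) ` S)"

text \<open>An equation between \<open>add_monoid T\<close> and the tensor group would be ill-typed for a module
  record \<open>T\<close>.\<close>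

definition is_tensor_group ::
  "((('v \<times> 'w) \<Rightarrow>\<^sub>0 int) set, 'h) ring_scheme \<Rightarrow> ('f, 'x) ring_scheme \<Rightarrow> ('f, 'v, 'y) module_scheme
    \<Rightarrow> ('f, 'w, 'z) module_scheme \<Rightarrow> bool"
  where "is_tensor_group T F V W \<longleftrightarrow>
    carrier T = carrier (tensor_group F V W) \<and> ring.add T = monoid.mult (tensor_group F V W) \<and>
    ring.zero T = \<one>\<^bsub>tensor_group F V W\<^esub>"

lemma balanced_mapD:
  assumes "balanced_map F V W G \<beta>"
  shows "\<lbrakk>v \<in> carrier V; w \<in> carrier W\<rbrakk> \<Longrightarrow> \<beta> v w \<in> carrier G"
    and "\<lbrakk>v \<in> carrier V; v' \<in> carrier V; w \<in> carrier W\<rbrakk> \<Longrightarrow> \<beta> (v \<oplus>\<^bsub>V\<^esub> v') w = \<beta> v w \<oplus>\<^bsub>G\<^esub> \<beta> v' w"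
    and "\<lbrakk>v \<in> carrier V; w \<in> carrier W; w' \<in> carrier W\<rbrakk> \<Longrightarrow> \<beta> v (w \<oplus>\<^bsub>W\<^esub> w') = \<beta> v w \<oplus>\<^bsub>G\<^esub> \<beta> v w'"
    and "\<lbrakk>c \<in> carrier F; v \<in> carrier V; w \<in> carrier W\<rbrakk> \<Longrightarrow> \<beta> (c \<odot>\<^bsub>V\<^esub> v) w = \<beta> v (c \<odot>\<^bsub>W\<^esub> w)"
  using assms unfolding balanced_map_def by auto

text \<open>Closure under scalars is what puts \<open>tensor_relations\<close> inside the free
  abelian group.\<close>

locale tensor_pair = V: abelian_group V + W: abelian_group W
  for F :: "('f, 'x) ring_scheme" and V :: "('f, 'v, 'y) module_scheme" and W :: "('f, 'w, 'z) module_scheme" +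
  assumes smult_V_closed: "\<lbrakk>c \<in> carrier F; v \<in> carrier V\<rbrakk> \<Longrightarrow> c \<odot>\<^bsub>V\<^esub> v \<in> carrier V"
    and smult_W_closed: "\<lbrakk>c \<in> carrier F; w \<in> carrier W\<rbrakk> \<Longrightarrow> c \<odot>\<^bsub>W\<^esub> w \<in> carrier W"
begin

abbreviation "free \<equiv> free_Abelian_group (carrier V \<times> carrier W)"

lemma tensor_relations_carrier: "tensor_relations F V W \<subseteq> carrier free"
  by (auto simp: tensor_relations_def smult_V_closed smult_W_closed
      dest!: subsetD[OF keys_diff])

lemma subgroup_tensor_null: "subgroup (tensor_null F V W) free"
  unfolding tensor_null_def
  by (rule group.generate_is_subgroup[OF group_free_Abelian_group tensor_relations_carrier])

lemma normal_tensor_null: "normal (tensor_null F V W) free"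
  by (rule comm_group.subgroup_imp_normal[OF abelian_free_Abelian_group subgroup_tensor_null])

lemma carrier_tensor_group: "carrier (tensor_group F V W) = tensor_class F V W ` carrier free"
  by (simp add: tensor_group_def carrier_FactGroup tensor_class_def[abs_def])

lemma tensor_class_hom: "tensor_class F V W \<in> hom free (tensor_group F V W)"
  using normal.r_coset_hom_Mod[OF normal_tensor_null]
  by (simp add: tensor_group_def tensor_class_def[abs_def])

lemma comm_group_tensor_group: "comm_group (tensor_group F V W)"
  unfolding tensor_group_def
  by (rule comm_group.abelian_FactGroup[OF abelian_free_Abelian_group subgroup_tensor_null])

lemma tensor_class_null:
  assumes "z \<in> tensor_null F V W"
  shows "tensor_class F V W z = \<one>\<^bsub>tensor_group F V W\<^esub>"
  using group.coset_join3[OF group_free_Abelian_group _ subgroup_tensor_null assms]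
    group.coset_join2[OF group_free_Abelian_group _ subgroup_tensor_null assms]
    subgroup.mem_carrier[OF subgroup_tensor_null assms]
  by (simp add: tensor_class_def tensor_group_def)

lemma mem_tensor_class: "z \<in> carrier free \<Longrightarrow> z \<in> tensor_class F V W z"
  unfolding tensor_class_def by (rule group.rcos_self[OF group_free_Abelian_group _ subgroup_tensor_null])

lemma tensor_class_subset: "z \<in> carrier free \<Longrightarrow> tensor_class F V W z \<subseteq> carrier free"
  unfolding tensor_class_def
  by (rule monoid.r_coset_subset_G[OF group.is_monoid[OF group_free_Abelian_group] subgroup.subset[OF subgroup_tensor_null]])

lemma tensor_class_eq:
  assumes "z \<in> carrier free" "y \<in> tensor_class F V W z"
  shows "tensor_class F V W y = tensor_class F V W z"
  using group.repr_independence[OF group_free_Abelian_group _ assms(1) subgroup_tensor_null] assms(2)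
  by (simp add: tensor_class_def)

lemma pure_tensor_closed: "\<lbrakk>v \<in> carrier V; w \<in> carrier W\<rbrakk> \<Longrightarrow> pure_tensor F V W v w \<in> carrier (tensor_group F V W)"
  by (auto simp: carrier_tensor_group pure_tensor_def)

text \<open>The shape follows \<open>free_Abelian_group_induct\<close>: differences account for sums
  and inverses at once.\<close>

lemma tensor_induct [consumes 1, case_names pure diff]:
  assumes S: "S \<in> carrier (tensor_group F V W)"
    and pure: "\<And>v w. \<lbrakk>v \<in> carrier V; w \<in> carrier W\<rbrakk> \<Longrightarrow> P (pure_tensor F V W v w)"
    and diff: "\<And>S T. \<lbrakk>S \<in> carrier (tensor_group F V W); T \<in> carrier (tensor_group F V W); P S; P T\<rbrakk> \<Longrightarrow>
      P (S \<otimes>\<^bsub>tensor_group F V W\<^esub> inv\<^bsub>tensor_group F V W\<^esub> T)"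
  shows "P S"
proof -
  interpret T: comm_group "tensor_group F V W" by (rule comm_group_tensor_group)
  interpret c: group_hom free "tensor_group F V W" "tensor_class F V W"
    by (simp add: group_hom_def group_hom_axioms_def T.is_group tensor_class_hom)
  have diff': "tensor_class F V W (x - y) = tensor_class F V W x \<otimes>\<^bsub>tensor_group F V W\<^esub> inv\<^bsub>tensor_group F V W\<^esub> tensor_class F V W y"
    if "x \<in> carrier free" "y \<in> carrier free" for x y
    using that c.hom_inv[of y] c.hom_mult[of x "- y"] by simp
  have "P (tensor_class F V W z)" if "Poly_Mapping.keys z \<subseteq> carrier V \<times> carrier W" for z
    using that
  proof (rule free_Abelian_group_induct)
    \<comment> \<open>The class of 0 is the difference of a pure tensor with itself, so the rule
      needs no case for zero.\<close>
    let ?p = "pure_tensor F V W \<zero>\<^bsub>V\<^esub> \<zero>\<^bsub>W\<^esub>"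
    have "P (?p \<otimes>\<^bsub>tensor_group F V W\<^esub> inv\<^bsub>tensor_group F V W\<^esub> ?p)"
      by (intro diff pure pure_tensor_closed V.zero_closed W.zero_closed)
    moreover have "tensor_class F V W 0 = \<one>\<^bsub>tensor_group F V W\<^esub>" using c.hom_one by simp
    ultimately show "P (tensor_class F V W 0)" by (simp add: pure_tensor_closed)
  qed (use diff' c.hom_closed pure in \<open>auto simp: diff pure_tensor_def[symmetric]\<close>)
  then show ?thesis using S by (auto simp: carrier_tensor_group)
qed

context
  fixes G :: "('g, 'h) ring_scheme" and \<beta> :: "'v \<Rightarrow> 'w \<Rightarrow> 'g"
  assumes G: "abelian_group G" and \<beta>: "balanced_map F V W G \<beta>"
begin

lemma frag_sum_balanced_hom: "frag_sum G (\<lambda>p. \<beta> (fst p) (snd p)) \<in> hom free (add_monoid G)"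
  by (rule abelian_group.frag_sum_hom[OF G]) (auto simp: balanced_mapD(1)[OF \<beta>])

text \<open>The extension of \<open>\<beta>\<close> to the free group kills each generating
  relation, because \<open>\<beta>\<close> is balanced; hence it kills the subgroup they generate
  and is constant on its cosets.\<close>

lemma tensor_ext_class:
  assumes z: "z \<in> carrier free"
  shows "tensor_ext G \<beta> (tensor_class F V W z) = frag_sum G (\<lambda>p. \<beta> (fst p) (snd p)) z"
proof -
  interpret G: abelian_group G by (rule G)
  let ?h = "frag_sum G (\<lambda>p. \<beta> (fst p) (snd p))"
  interpret h: group_hom free "add_monoid G" ?h
    using frag_sum_balanced_hom by (simp add: group_hom_def group_hom_axioms_def G.a_group)
  note diff = hom_free_Abelian_group_diff[OF G frag_sum_balanced_hom]
  have of: "?h (frag_of (v, w)) = \<beta> v w" if "v \<in> carrier V" "w \<in> carrier W" for v w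
    using that by (subst G.frag_sum_of) (auto simp: balanced_mapD(1)[OF \<beta>])
  have keys: "Poly_Mapping.keys (frag_of p - frag_of q) \<subseteq> carrier V \<times> carrier W"
    if "p \<in> carrier V \<times> carrier W" "q \<in> carrier V \<times> carrier W" for p q
    using that keys_diff[of "frag_of p" "frag_of q"] by auto
  have cancel: "(a \<oplus>\<^bsub>G\<^esub> b \<ominus>\<^bsub>G\<^esub> a) \<ominus>\<^bsub>G\<^esub> b = \<zero>\<^bsub>G\<^esub>" if "a \<in> carrier G" "b \<in> carrier G" for a b
    using that by (simp add: G.minus_eq G.a_comm[of a b] G.a_assoc G.r_neg)
  have "tensor_relations F V W \<subseteq> kernel free (add_monoid G) ?h"
  proof
    fix r assume r: "r \<in> tensor_relations F V W"
    from r have "?h r = \<zero>\<^bsub>G\<^esub>"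
      unfolding tensor_relations_def
      by (auto simp: diff keys of balanced_mapD[OF \<beta>] smult_V_closed smult_W_closed cancel G.r_neg G.minus_eq)
        (auto simp: G.minus_eq[symmetric] cancel balanced_mapD[OF \<beta>])
    then show "r \<in> kernel free (add_monoid G) ?h"
      using subsetD[OF tensor_relations_carrier r] unfolding kernel_def by simp
  qed
  then have "tensor_null F V W \<subseteq> kernel free (add_monoid G) ?h"
    unfolding tensor_null_def
    by (rule group.generate_subgroup_incl[OF group_free_Abelian_group _ h.subgroup_kernel])
  then have "?h (n + z) = ?h z" if "n \<in> tensor_null F V W" for n
    using that z h.hom_mult[of n z] h.hom_closed[of z] by (auto simp: kernel_def)
  then have "?h ` tensor_class F V W z = {?h z}"
    using subgroup.one_closed[OF subgroup_tensor_null]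
    by (auto simp: tensor_class_def r_coset_def image_iff intro!: bexI[of _ 0])
  then show ?thesis by (simp add: tensor_ext_def)
qed

lemma tensor_ext_pure: "\<lbrakk>v \<in> carrier V; w \<in> carrier W\<rbrakk> \<Longrightarrow> tensor_ext G \<beta> (pure_tensor F V W v w) = \<beta> v w"
  unfolding pure_tensor_def
  by (subst tensor_ext_class) (auto simp: abelian_group.frag_sum_of[OF G] balanced_mapD(1)[OF \<beta>])

lemma tensor_ext_hom: "tensor_ext G \<beta> \<in> hom (tensor_group F V W) (add_monoid G)"
proof -
  interpret h: group_hom free "add_monoid G" "frag_sum G (\<lambda>p. \<beta> (fst p) (snd p))"
    using frag_sum_balanced_hom abelian_group.a_group[OF G] by (simp add: group_hom_def group_hom_axioms_def)
  show ?thesis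
  proof (rule homI)
    fix S T assume "S \<in> carrier (tensor_group F V W)" "T \<in> carrier (tensor_group F V W)"
    then obtain x y where "S = tensor_class F V W x" "x \<in> carrier free" "T = tensor_class F V W y" "y \<in> carrier free"
      by (auto simp: carrier_tensor_group)
    then show "tensor_ext G \<beta> (S \<otimes>\<^bsub>tensor_group F V W\<^esub> T) = tensor_ext G \<beta> S \<otimes>\<^bsub>add_monoid G\<^esub> tensor_ext G \<beta> T"
      using h.hom_mult[of x y] hom_mult[OF tensor_class_hom, of x y] h.G.m_closed[of x y]
      by (simp only: tensor_ext_class flip: hom_mult[OF tensor_class_hom])
  next
    fix S assume "S \<in> carrier (tensor_group F V W)"
    then show "tensor_ext G \<beta> S \<in> carrier (add_monoid G)"
      using h.hom_closed by (auto simp: carrier_tensor_group tensor_ext_class simp del: carrier_free_Abelian_group_iff)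
  qed
qed

end

lemma abelian_group_tensor:
  assumes T: "is_tensor_group T F V W"
  shows "abelian_group T"
proof -
  interpret comm_group "tensor_group F V W" by (rule comm_group_tensor_group)
  show ?thesis
    by (rule abelian_groupI)
      (use T m_assoc m_comm l_inv_ex in \<open>auto simp: is_tensor_group_def\<close>)
qed

lemma tensor_group_eqs:
  assumes T: "is_tensor_group T F V W"
  shows "carrier (tensor_group F V W) = carrier T"
    "x \<otimes>\<^bsub>tensor_group F V W\<^esub> y = x \<oplus>\<^bsub>T\<^esub> y" "\<one>\<^bsub>tensor_group F V W\<^esub> = \<zero>\<^bsub>T\<^esub>"
    "inv\<^bsub>tensor_group F V W\<^esub> x = \<ominus>\<^bsub>T\<^esub> x"
  using T by (simp_all add: is_tensor_group_def a_inv_def m_inv_def)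

lemma tensor_class_hom_add_monoid:
  assumes T: "is_tensor_group T F V W"
  shows "tensor_class F V W \<in> hom free (add_monoid T)"
  using tensor_class_hom T by (simp add: hom_def is_tensor_group_def)

text \<open>Each law of a balanced map corresponds to one family in \<open>tensor_relations\<close>,
  whose members have class zero.\<close>

lemma pure_tensor_balanced:
  assumes T: "is_tensor_group T F V W"
  shows "balanced_map F V W T (pure_tensor F V W)"
proof -
  interpret T: abelian_group T by (rule abelian_group_tensor[OF T])
  note eqs = tensor_group_eqs[OF T]
  have hom: "tensor_class F V W \<in> hom free (add_monoid T)" by (rule tensor_class_hom_add_monoid[OF T])
  note diff = hom_free_Abelian_group_diff[OF T.abelian_group_axioms hom]
  have keys: "Poly_Mapping.keys (frag_of p - frag_of q) \<subseteq> carrier V \<times> carrier W"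
    if "p \<in> carrier V \<times> carrier W" "q \<in> carrier V \<times> carrier W" for p q
    using that keys_diff[of "frag_of p" "frag_of q"] by auto
  have null: "tensor_class F V W r = \<zero>\<^bsub>T\<^esub>" if "r \<in> tensor_relations F V W" for r
    using tensor_class_null[of r] that by (simp add: eqs tensor_null_def generate.incl)
  have cl: "pure_tensor F V W v w \<in> carrier T" if "v \<in> carrier V" "w \<in> carrier W" for v w
    using pure_tensor_closed[OF that] by (simp add: eqs)
  have sum: "a = b \<oplus>\<^bsub>T\<^esub> c" if "(a \<ominus>\<^bsub>T\<^esub> b) \<ominus>\<^bsub>T\<^esub> c = \<zero>\<^bsub>T\<^esub>" "a \<in> carrier T" "b \<in> carrier T" "c \<in> carrier T" for a b c
  proof -
    have "a \<ominus>\<^bsub>T\<^esub> b = c" using that T.minus_eq_zero_iff[of "a \<ominus>\<^bsub>T\<^esub> b" c] by simp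
    then have "c \<oplus>\<^bsub>T\<^esub> b = a" using that by (auto simp: T.minus_eq T.a_assoc T.l_neg)
    then show ?thesis using that T.a_comm by simp
  qed
  show ?thesis
    unfolding balanced_map_def
  proof (intro conjI ballI cl)
    fix v v' w assume *: "v \<in> carrier V" "v' \<in> carrier V" "w \<in> carrier W"
    then have "tensor_class F V W (frag_of (v \<oplus>\<^bsub>V\<^esub> v', w) - frag_of (v, w) - frag_of (v', w)) = \<zero>\<^bsub>T\<^esub>"
      by (intro null) (auto simp: tensor_relations_def)
    then have "(pure_tensor F V W (v \<oplus>\<^bsub>V\<^esub> v') w \<ominus>\<^bsub>T\<^esub> pure_tensor F V W v w) \<ominus>\<^bsub>T\<^esub> pure_tensor F V W v' w = \<zero>\<^bsub>T\<^esub>"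
      using * by (simp add: diff keys pure_tensor_def)
    then show "pure_tensor F V W (v \<oplus>\<^bsub>V\<^esub> v') w = pure_tensor F V W v w \<oplus>\<^bsub>T\<^esub> pure_tensor F V W v' w"
      by (rule sum) (use * cl in auto)
  next
    fix v w w' assume *: "v \<in> carrier V" "w \<in> carrier W" "w' \<in> carrier W"
    then have "tensor_class F V W (frag_of (v, w \<oplus>\<^bsub>W\<^esub> w') - frag_of (v, w) - frag_of (v, w')) = \<zero>\<^bsub>T\<^esub>"
      by (intro null) (auto simp: tensor_relations_def)
    then have "(pure_tensor F V W v (w \<oplus>\<^bsub>W\<^esub> w') \<ominus>\<^bsub>T\<^esub> pure_tensor F V W v w) \<ominus>\<^bsub>T\<^esub> pure_tensor F V W v w' = \<zero>\<^bsub>T\<^esub>"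
      using * by (simp add: diff keys pure_tensor_def)
    then show "pure_tensor F V W v (w \<oplus>\<^bsub>W\<^esub> w') = pure_tensor F V W v w \<oplus>\<^bsub>T\<^esub> pure_tensor F V W v w'"
      by (rule sum) (use * cl in auto)
  next
    fix c v w assume *: "c \<in> carrier F" "v \<in> carrier V" "w \<in> carrier W"
    then have "tensor_class F V W (frag_of (c \<odot>\<^bsub>V\<^esub> v, w) - frag_of (v, c \<odot>\<^bsub>W\<^esub> w)) = \<zero>\<^bsub>T\<^esub>"
      by (intro null) (auto simp: tensor_relations_def)
    then have "pure_tensor F V W (c \<odot>\<^bsub>V\<^esub> v) w \<ominus>\<^bsub>T\<^esub> pure_tensor F V W v (c \<odot>\<^bsub>W\<^esub> w) = \<zero>\<^bsub>T\<^esub>"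
      using * smult_V_closed smult_W_closed by (simp add: diff pure_tensor_def)
    then show "pure_tensor F V W (c \<odot>\<^bsub>V\<^esub> v) w = pure_tensor F V W v (c \<odot>\<^bsub>W\<^esub> w)"
      using * cl smult_V_closed smult_W_closed by (simp add: T.minus_eq_zero_iff)
  qed
qed

end

text \<open>A bridge from \<open>frag_extend\<close>, by which the lifts are defined, to
  \<open>frag_sum\<close>, by which \<open>tensor_ext\<close> is defined. Both sides are additive in
  \<open>x\<close> and agree on generators.\<close>

lemma (in tensor_pair) tensor_class_frag_extend:
  assumes T: "is_tensor_group T F V W"
    and E: "\<And>p. p \<in> S \<Longrightarrow> E p \<in> carrier free" and x: "Poly_Mapping.keys x \<subseteq> S"
  shows "frag_extend E x \<in> carrier free"
    and "tensor_class F V W (frag_extend E x) = frag_sum T (\<lambda>p. tensor_class F V W (E p)) x"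
proof -
  interpret T: abelian_group T by (rule abelian_group_tensor[OF T])
  have hom: "tensor_class F V W \<in> hom free (add_monoid T)" by (rule tensor_class_hom_add_monoid[OF T])
  have cl: "(\<lambda>p. tensor_class F V W (E p)) \<in> S \<rightarrow> carrier T"
    using E hom_in_carrier[OF hom] by auto
  note hom' = T.frag_sum_hom[OF cl]
  have keys: "frag_extend E y \<in> carrier free" if "Poly_Mapping.keys y \<subseteq> S" for y
    using keys_frag_extend[of E y] E that by (simp add: subset_iff) blast
  show "frag_extend E x \<in> carrier free" by (rule keys[OF x])
  show "tensor_class F V W (frag_extend E x) = frag_sum T (\<lambda>p. tensor_class F V W (E p)) x"
    using x
  proof (rule free_Abelian_group_induct)
    show "tensor_class F V W (frag_extend E 0) = frag_sum T (\<lambda>p. tensor_class F V W (E p)) 0"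
      using tensor_class_null[OF subgroup.one_closed[OF subgroup_tensor_null]]
      by (simp add: frag_sum_def tensor_group_eqs[OF T])
  next
    fix y z assume "Poly_Mapping.keys y \<subseteq> S" "Poly_Mapping.keys z \<subseteq> S"
      "tensor_class F V W (frag_extend E y) = frag_sum T (\<lambda>p. tensor_class F V W (E p)) y"
      "tensor_class F V W (frag_extend E z) = frag_sum T (\<lambda>p. tensor_class F V W (E p)) z"
    then show "tensor_class F V W (frag_extend E (y - z)) = frag_sum T (\<lambda>p. tensor_class F V W (E p)) (y - z)"
      using keys[of y] keys[of z]
      by (simp add: frag_extend_diff hom_free_Abelian_group_diff[OF T.abelian_group_axioms hom]
          hom_free_Abelian_group_diff[OF T.abelian_group_axioms hom'])
  next
    fix p assume "p \<in> S"
    then show "tensor_class F V W (frag_extend E (frag_of p)) = frag_sum T (\<lambda>p. tensor_class F V W (E p)) (frag_of p)"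
      using cl by (simp add: T.frag_sum_of Pi_iff)
  qed
qed

lemma (in tensor_pair) mem_tensor_classD:
  assumes "z \<in> carrier free" "x \<in> tensor_class F V W z"
  shows "x \<in> carrier free" "tensor_class F V W z = tensor_class F V W x"
  using tensor_class_subset[OF assms(1)] tensor_class_eq[OF assms] assms(2) by (blast, simp)

lemma (in abelian_group) frag_sum_cong:
  assumes "\<And>p. p \<in> Poly_Mapping.keys z \<Longrightarrow> f p = g p" "\<And>p. p \<in> Poly_Mapping.keys z \<Longrightarrow> g p \<in> carrier G"
  shows "frag_sum G f z = frag_sum G g z"
  unfolding frag_sum_def by (rule finsum_cong') (use assms in \<open>auto intro!: add.int_pow_closed\<close>)

section \<open>Additive and biadditive maps between tensor products\<close>

lemma balanced_map_cong:
  assumes "abelian_group V" "abelian_group W"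
    and "\<And>c v. \<lbrakk>c \<in> carrier F; v \<in> carrier V\<rbrakk> \<Longrightarrow> c \<odot>\<^bsub>V\<^esub> v \<in> carrier V"
    and "\<And>c w. \<lbrakk>c \<in> carrier F; w \<in> carrier W\<rbrakk> \<Longrightarrow> c \<odot>\<^bsub>W\<^esub> w \<in> carrier W"
    and "\<And>v w. \<lbrakk>v \<in> carrier V; w \<in> carrier W\<rbrakk> \<Longrightarrow> \<beta> v w = \<gamma> v w" "balanced_map F V W G \<gamma>"
  shows "balanced_map F V W G \<beta>"
  using assms(3-6) abelian_monoid.a_closed[OF abelian_group.axioms(1)[OF assms(1)]]
    abelian_monoid.a_closed[OF abelian_group.axioms(1)[OF assms(2)]]
  unfolding balanced_map_def by simp

lemma balanced_map_minus:
  assumes "abelian_group G" "balanced_map F V W G \<beta>" "balanced_map F V W G \<gamma>"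
  shows "balanced_map F V W G (\<lambda>v w. \<beta> v w \<ominus>\<^bsub>G\<^esub> \<gamma> v w)"
proof -
  interpret G: abelian_group G by fact
  show ?thesis
    using balanced_mapD[OF assms(2)] balanced_mapD[OF assms(3)]
    unfolding balanced_map_def
    by (simp add: G.minus_eq G.minus_add G.a_ac)
qed

lemma hom_tensor_minus:
  assumes "tensor_pair F V W" "abelian_group G" "h \<in> hom (tensor_group F V W) (add_monoid G)"
    and "S \<in> carrier (tensor_group F V W)" "S' \<in> carrier (tensor_group F V W)"
  shows "h (S \<otimes>\<^bsub>tensor_group F V W\<^esub> inv\<^bsub>tensor_group F V W\<^esub> S') = h S \<ominus>\<^bsub>G\<^esub> h S'"
proof -
  interpret G: abelian_group G by fact
  interpret tensor_pair F V W by fact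
  interpret T: comm_group "tensor_group F V W" by (rule comm_group_tensor_group)
  interpret h: group_hom "tensor_group F V W" "add_monoid G" h
    using assms(3) by (simp add: group_hom_def group_hom_axioms_def G.a_group T.is_group)
  show ?thesis using assms(4,5) h.hom_inv[of S'] by (simp add: G.minus_eq a_inv_def)
qed

text \<open>Every representative contributes the same coset, so the union in
  \<open>tensor_lift\<close> collapses to it, and the universal property takes over.\<close>

lemma tensor_lift_eq:
  assumes V: "tensor_pair F V W" and V': "tensor_pair F' V' W'"
    and T: "is_tensor_group T F' V' W'"
    and f: "\<And>p. p \<in> carrier V \<times> carrier W \<Longrightarrow> f p \<in> carrier V' \<times> carrier W'"
    and bal: "balanced_map F V W T (\<lambda>v w. tensor_class F' V' W' (frag_of (f (v, w))))"
    and S: "S \<in> carrier (tensor_group F V W)"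
  shows "tensor_lift (tensor_class F' V' W') f S = tensor_ext T (\<lambda>v w. tensor_class F' V' W' (frag_of (f (v, w)))) S"
proof -
  interpret V: tensor_pair F V W by fact
  interpret V': tensor_pair F' V' W' by fact
  have T_ab: "abelian_group T" by (rule V'.abelian_group_tensor[OF T])
  obtain z where z: "z \<in> carrier V.free" "S = tensor_class F V W z"
    using S by (auto simp: V.carrier_tensor_group)
  have "tensor_class F' V' W' (frag_extend (\<lambda>p. frag_of (f p)) x) =
      tensor_ext T (\<lambda>v w. tensor_class F' V' W' (frag_of (f (v, w)))) S" if "x \<in> S" for x
  proof -
    have x: "x \<in> carrier V.free" and eq: "S = tensor_class F V W x"
      using that V.mem_tensor_classD[OF z(1)] unfolding z(2) by auto
    show ?thesis unfolding eq V.tensor_ext_class[OF T_ab bal x]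
      by (subst V'.tensor_class_frag_extend(2)[OF T, of "carrier V \<times> carrier W"]) (use f x in auto)
  qed
  moreover have "z \<in> S" using z V.mem_tensor_class by simp
  ultimately show ?thesis unfolding tensor_lift_def by auto
qed

text \<open>Covers both uses of \<open>tensor_lift2\<close>, the product of
  \<open>ext_algebra\<close> and its action on \<open>ext_module\<close>. Balancedness is asked in
  each argument with the other one fixed at a pair, since only on pairs is \<open>f\<close>
  given.\<close>

locale tensor_bilinear =
  A: tensor_pair F1 V1 W1 + B: tensor_pair F2 V2 W2 + C: tensor_pair F3 V3 W3
  for F1 :: "('f1, 'x1) ring_scheme" and V1 :: "('f1, 'v1, 'y1) module_scheme" and W1 :: "('f1, 'w1, 'z1) module_scheme"
    and F2 :: "('f2, 'x2) ring_scheme" and V2 :: "('f2, 'v2, 'y2) module_scheme" and W2 :: "('f2, 'w2, 'z2) module_scheme"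
    and F3 :: "('f3, 'x3) ring_scheme" and V3 :: "('f3, 'v3, 'y3) module_scheme" and W3 :: "('f3, 'w3, 'z3) module_scheme" +
  fixes T :: "((('v3 \<times> 'w3) \<Rightarrow>\<^sub>0 int) set, 'x) ring_scheme" and f :: "'v1 \<times> 'w1 \<Rightarrow> 'v2 \<times> 'w2 \<Rightarrow> 'v3 \<times> 'w3"
  assumes T: "is_tensor_group T F3 V3 W3"
    and f_closed: "\<lbrakk>p \<in> carrier V1 \<times> carrier W1; q \<in> carrier V2 \<times> carrier W2\<rbrakk> \<Longrightarrow> f p q \<in> carrier V3 \<times> carrier W3"
    and balanced1: "q \<in> carrier V2 \<times> carrier W2 \<Longrightarrow>
      balanced_map F1 V1 W1 T (\<lambda>v w. tensor_class F3 V3 W3 (frag_of (f (v, w) q)))"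
    and balanced2: "p \<in> carrier V1 \<times> carrier W1 \<Longrightarrow>
      balanced_map F2 V2 W2 T (\<lambda>v w. tensor_class F3 V3 W3 (frag_of (f p (v, w))))"
begin

abbreviation "lift2 \<equiv> tensor_lift2 (tensor_class F3 V3 W3) f"

text \<open>The first stage: the second argument is extended to all classes while the first is still
  a pair. Extending this in the pair gives the full map, see \<open>lift2_eq\<close>.\<close>

definition "inner v w = tensor_ext T (\<lambda>v' w'. tensor_class F3 V3 W3 (frag_of (f (v, w) (v', w'))))"

lemma abelian_group_T: "abelian_group T"
  by (rule C.abelian_group_tensor[OF T])

lemma inner_pure:
  assumes "v \<in> carrier V1" "w \<in> carrier W1" "v' \<in> carrier V2" "w' \<in> carrier W2"
  shows "inner v w (pure_tensor F2 V2 W2 v' w') = tensor_class F3 V3 W3 (frag_of (f (v, w) (v', w')))"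
  unfolding inner_def by (rule B.tensor_ext_pure[OF abelian_group_T balanced2]) (use assms in auto)

lemma inner_hom:
  assumes "v \<in> carrier V1" "w \<in> carrier W1"
  shows "inner v w \<in> hom (tensor_group F2 V2 W2) (add_monoid T)"
  unfolding inner_def by (rule B.tensor_ext_hom[OF abelian_group_T balanced2]) (use assms in auto)

text \<open>For pure \<open>S\<close> this is \<open>balanced1\<close>, and balanced maps are closed
  under differences.\<close>

lemma balanced_inner:
  assumes "S \<in> carrier (tensor_group F2 V2 W2)"
  shows "balanced_map F1 V1 W1 T (\<lambda>v w. inner v w S)"
  using assms
proof (induction S rule: B.tensor_induct)
  case (pure v w)
  show ?case
    by (rule balanced_map_cong[OF A.V.abelian_group_axioms A.W.abelian_group_axioms
          A.smult_V_closed A.smult_W_closed _ balanced1[of "(v, w)"]])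
      (use pure inner_pure in auto)
next
  case (diff S S')
  show ?case
    by (rule balanced_map_cong[OF A.V.abelian_group_axioms A.W.abelian_group_axioms
          A.smult_V_closed A.smult_W_closed _ balanced_map_minus[OF abelian_group_T diff(3,4)]])
      (simp_all add: hom_tensor_minus[OF B.tensor_pair_axioms abelian_group_T inner_hom diff(1,2)])
qed

text \<open>For all choices of representatives the coset is the value of the two-stage extension, so
  the double union collapses.\<close>

lemma lift2_eq:
  assumes S: "S \<in> carrier (tensor_group F1 V1 W1)" and S': "S' \<in> carrier (tensor_group F2 V2 W2)"
  shows "lift2 S S' = tensor_ext T (\<lambda>v w. inner v w S') S"
proof -
  interpret T: abelian_group T by (rule abelian_group_T)
  obtain z where z: "z \<in> carrier A.free" "S = tensor_class F1 V1 W1 z"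
    using S by (auto simp: A.carrier_tensor_group)
  obtain z' where z': "z' \<in> carrier B.free" "S' = tensor_class F2 V2 W2 z'"
    using S' by (auto simp: B.carrier_tensor_group)
  have "tensor_class F3 V3 W3 (frag_extend (\<lambda>p. frag_extend (\<lambda>q. frag_of (f p q)) y) x) =
      tensor_ext T (\<lambda>v w. inner v w S') S" if "x \<in> S" "y \<in> S'" for x y
  proof -
    have x: "x \<in> carrier A.free" and eq: "S = tensor_class F1 V1 W1 x"
      using that A.mem_tensor_classD[OF z(1)] unfolding z(2) by auto
    have y: "y \<in> carrier B.free" and eq': "S' = tensor_class F2 V2 W2 y"
      using that B.mem_tensor_classD[OF z'(1)] unfolding z'(2) by auto
    have free: "frag_extend (\<lambda>q. frag_of (f p q)) y \<in> carrier C.free"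
      if "p \<in> carrier V1 \<times> carrier W1" for p
      by (rule C.tensor_class_frag_extend(1)[OF T, of "carrier V2 \<times> carrier W2"]) (use f_closed that y in auto)
    have inner: "tensor_class F3 V3 W3 (frag_extend (\<lambda>q. frag_of (f p q)) y) = inner (fst p) (snd p) S'"
      if "p \<in> carrier V1 \<times> carrier W1" for p
    proof -
      have "tensor_class F3 V3 W3 (frag_extend (\<lambda>q. frag_of (f p q)) y) =
          frag_sum T (\<lambda>q. tensor_class F3 V3 W3 (frag_of (f p q))) y"
        by (rule C.tensor_class_frag_extend(2)[OF T, of "carrier V2 \<times> carrier W2"])
          (use f_closed that y in auto)
      also have "\<dots> = inner (fst p) (snd p) S'"
        unfolding eq' inner_def using that
        by (subst B.tensor_ext_class[OF abelian_group_T balanced2 y]) auto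
      finally show ?thesis .
    qed
    have "tensor_class F3 V3 W3 (frag_extend (\<lambda>p. frag_extend (\<lambda>q. frag_of (f p q)) y) x) =
        frag_sum T (\<lambda>p. tensor_class F3 V3 W3 (frag_extend (\<lambda>q. frag_of (f p q)) y)) x"
      by (rule C.tensor_class_frag_extend(2)[OF T, of "carrier V1 \<times> carrier W1"]) (use free x in auto)
    also have "\<dots> = frag_sum T (\<lambda>p. inner (fst p) (snd p) S') x"
      by (rule T.frag_sum_cong) (use inner x balanced_mapD(1)[OF balanced_inner[OF S']] in auto)
    also have "\<dots> = tensor_ext T (\<lambda>v w. inner v w S') S"
      unfolding eq by (rule A.tensor_ext_class[OF abelian_group_T balanced_inner[OF S'] x, symmetric])
    finally show ?thesis .
  qed
  moreover have "z \<in> S" "z' \<in> S'" using z z' A.mem_tensor_class B.mem_tensor_class by simp_all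
  ultimately show ?thesis unfolding tensor_lift2_def by auto
qed

lemma lift2_pure:
  assumes "v \<in> carrier V1" "w \<in> carrier W1" "v' \<in> carrier V2" "w' \<in> carrier W2"
  shows "lift2 (pure_tensor F1 V1 W1 v w) (pure_tensor F2 V2 W2 v' w') = tensor_class F3 V3 W3 (frag_of (f (v, w) (v', w')))"
  using assms
  by (simp add: lift2_eq A.pure_tensor_closed B.pure_tensor_closed
      A.tensor_ext_pure[OF abelian_group_T balanced_inner] inner_pure)

lemma lift2_hom1:
  assumes "S' \<in> carrier (tensor_group F2 V2 W2)"
  shows "(\<lambda>S. lift2 S S') \<in> hom (tensor_group F1 V1 W1) (add_monoid T)"
proof -
  have "tensor_ext T (\<lambda>v w. inner v w S') \<in> hom (tensor_group F1 V1 W1) (add_monoid T)"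
    by (rule A.tensor_ext_hom[OF abelian_group_T balanced_inner[OF assms]])
  moreover have "comm_group (tensor_group F1 V1 W1)" by (rule A.comm_group_tensor_group)
  ultimately show ?thesis
    using assms group.subgroup_self monoid.m_closed[of "tensor_group F1 V1 W1"]
    by (auto simp: hom_def lift2_eq comm_group_def group_def)
qed

text \<open>The two-stage description treats the arguments unequally and shows additivity in the
  first one. Additivity in the second follows by induction on the first, the pure case being
  \<open>inner_hom\<close>.\<close>

lemma lift2_add2:
  assumes S: "S \<in> carrier (tensor_group F1 V1 W1)"
    and S': "S' \<in> carrier (tensor_group F2 V2 W2)" "S'' \<in> carrier (tensor_group F2 V2 W2)"
  shows "lift2 S (S' \<otimes>\<^bsub>tensor_group F2 V2 W2\<^esub> S'') = lift2 S S' \<oplus>\<^bsub>T\<^esub> lift2 S S''"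
proof -
  interpret T: abelian_group T by (rule abelian_group_T)
  interpret B': comm_group "tensor_group F2 V2 W2" by (rule B.comm_group_tensor_group)
  show ?thesis using S
  proof (induction S rule: A.tensor_induct)
    case (pure v w)
    then have "lift2 (pure_tensor F1 V1 W1 v w) R = inner v w R" if "R \<in> carrier (tensor_group F2 V2 W2)" for R
      using that by (simp add: lift2_eq A.pure_tensor_closed A.tensor_ext_pure[OF abelian_group_T balanced_inner])
    then show ?case using hom_mult[OF inner_hom[OF pure] S'] S' by simp
  next
    case (diff R R')
    note minus = hom_tensor_minus[OF A.tensor_pair_axioms abelian_group_T lift2_hom1 diff(1,2)]
    have "lift2 Q U \<in> carrier T" if "Q \<in> {R, R'}" "U \<in> {S', S''}" for Q U
      using that hom_in_carrier[OF lift2_hom1] diff(1,2) S' by fastforce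
    then show ?case using diff(3,4) S'
      by (simp add: minus T.minus_eq T.minus_add T.a_ac)
  qed
qed

lemma lift2_hom2:
  assumes "S \<in> carrier (tensor_group F1 V1 W1)"
  shows "lift2 S \<in> hom (tensor_group F2 V2 W2) (add_monoid T)"
  using lift2_add2[OF assms] hom_in_carrier[OF lift2_hom1 assms] by (auto simp: hom_def)

end

lemma hom_add_finsum:
  assumes "abelian_group G" "abelian_group H" "h \<in> hom (add_monoid G) (add_monoid H)" "finite I"
  shows "(\<And>i. i \<in> I \<Longrightarrow> f i \<in> carrier G) \<Longrightarrow> h (\<Oplus>\<^bsub>G\<^esub>i\<in>I. f i) = (\<Oplus>\<^bsub>H\<^esub>i\<in>I. h (f i))"
  using assms(4)
proof (induction I)
  case empty
  then show ?case
    using hom_add_zero[OF assms(1-3)] assms(1,2) by (simp add: abelian_group_def abelian_monoid.finsum_empty)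
next
  case (insert i I)
  interpret G: abelian_group G by fact
  interpret H: abelian_group H by fact
  have "(\<Oplus>\<^bsub>G\<^esub>i\<in>I. f i) \<in> carrier G" using insert by (intro G.finsum_closed) auto
  then show ?case using insert hom_add_add[OF assms(3)] hom_add_closed[OF assms(3)]
    by (simp add: Pi_iff)
qed

section \<open>Orthogonality and traces over the Galois group\<close>

context field_extension
begin

lemma galois_group_hom: "\<phi> \<in> galois_group k K \<Longrightarrow> ring_hom_ring K K \<phi>"
  by (intro ring_hom_ringI2 ring_axioms) (auto simp: galois_group_def)

lemma galois_group_fixes: "\<lbrakk>\<phi> \<in> galois_group k K; c \<in> k\<rbrakk> \<Longrightarrow> \<phi> c = c"
  by (auto simp: galois_group_def)

text \<open>Let \<open>D\<close> be the sum. Centrality, tested on the balanced map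
  \<open>\<phi>(x) y\<close>, gives \<open>\<phi>(c) D = c D\<close> for every \<open>c\<close>; one
  \<open>c\<close> moved by \<open>\<phi>\<close> forces \<open>D = 0\<close>.\<close>

lemma galois_orthogonality:
  assumes ps: "set ps \<subseteq> carrier K \<times> carrier K" "list_sum K (\<lambda>(x, y). x \<otimes> y) ps = \<one>"
    and central: "central K ps = carrier K"
    and \<phi>: "\<phi> \<in> ring_hom K K" "\<And>c. c \<in> k \<Longrightarrow> \<phi> c = c"
  shows "list_sum K (\<lambda>(x, y). \<phi> x \<otimes> y) ps = (if \<forall>c\<in>carrier K. \<phi> c = c then \<one> else \<zero>)"
proof -
  interpret \<phi>: ring_hom_ring K K \<phi> by (rule ring_hom_ringI2[OF ring_axioms ring_axioms \<phi>(1)])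
  have p: "x \<in> carrier K" "y \<in> carrier K" if "(x, y) \<in> set ps" for x y using that ps by auto
  let ?D = "list_sum K (\<lambda>(x, y). \<phi> x \<otimes> y) ps"
  have D: "?D \<in> carrier K" using p by (intro list_sum_closed) auto
  have mult_sum: "a \<otimes> list_sum K f xs = list_sum K (\<lambda>x. a \<otimes> f x) xs"
    if "a \<in> carrier K" "\<And>x. x \<in> set xs \<Longrightarrow> f x \<in> carrier K" for a f and xs :: "('a \<times> 'a) list"
    using that by (intro hom_add_list_sum) (auto simp: hom_def r_distr abelian_group_axioms)
  show ?thesis
  proof (cases "\<forall>c\<in>carrier K. \<phi> c = c")
    case True
    then have "?D = list_sum K (\<lambda>(x, y). x \<otimes> y) ps" using p by (intro list_sum_cong) auto
    then show ?thesis using ps(2) True by simp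
  next
    case False
    then obtain c where c: "c \<in> carrier K" "\<phi> c \<noteq> c" by auto
    have "balanced K (\<lambda>x y. \<phi> x \<otimes> y)"
      using \<phi>(2) k_carrier by (auto simp: balanced_map_def l_distr r_distr m_ac)
    then have "list_sum K (\<lambda>(x, y). \<phi> (c \<otimes> x) \<otimes> y) ps = list_sum K (\<lambda>(x, y). \<phi> x \<otimes> (c \<otimes> y)) ps"
      using central c(1) unfolding central_def by blast
    moreover have "list_sum K (\<lambda>(x, y). \<phi> (c \<otimes> x) \<otimes> y) ps = \<phi> c \<otimes> ?D"
      using p c by (subst mult_sum) (auto simp: m_assoc intro!: list_sum_cong)
    moreover have "list_sum K (\<lambda>(x, y). \<phi> x \<otimes> (c \<otimes> y)) ps = c \<otimes> ?D"
      using p c by (subst mult_sum) (auto simp: m_lcomm intro!: list_sum_cong)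
    ultimately have "?D = \<zero>" using c D m_rcancel[of ?D "\<phi> c" c] by auto
    then show ?thesis using False by simp
  qed
qed

text \<open>The inverse is taken in \<open>BijGroup\<close> so that it is extensional and thus again
  an element of \<open>galois_group\<close>.\<close>

definition galois_inv :: "('a \<Rightarrow> 'a) \<Rightarrow> 'a \<Rightarrow> 'a"
  where "galois_inv \<phi> = inv\<^bsub>BijGroup (carrier K)\<^esub> \<phi>"

lemma galois_inv:
  assumes \<phi>: "\<phi> \<in> galois_group k K"
  shows "galois_inv \<phi> \<in> galois_group k K" and "galois_inv (galois_inv \<phi>) = \<phi>"
    and "x \<in> carrier K \<Longrightarrow> galois_inv \<phi> (\<phi> x) = x" "x \<in> carrier K \<Longrightarrow> \<phi> (galois_inv \<phi> x) = x"
proof -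
  interpret B: group "BijGroup (carrier K)" by (rule group_BijGroup)
  have B: "\<phi> \<in> Bij (carrier K)" using \<phi> by (simp add: galois_group_def)
  then have bij: "bij_betw \<phi> (carrier K) (carrier K)" by (simp add: Bij_def)
  show "galois_inv \<phi> \<in> galois_group k K"
    unfolding galois_inv_def by (rule subgroup.m_inv_closed[OF subgroup_galois_group \<phi>])
  show "galois_inv (galois_inv \<phi>) = \<phi>"
    unfolding galois_inv_def by (rule B.inv_inv) (simp add: BijGroup_def B)
  show "galois_inv \<phi> (\<phi> x) = x" "\<phi> (galois_inv \<phi> x) = x" if "x \<in> carrier K"
    using that bij bij_betwE[OF bij]
    by (simp_all add: galois_inv_def inv_BijGroup[OF B] bij_betw_inv_into_left bij_betw_inv_into_right)
qed

lemma finsum_galois_inv: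
  assumes "abelian_group G" and "\<And>\<phi>. \<phi> \<in> galois_group k K \<Longrightarrow> f \<phi> \<in> carrier G"
  shows "(\<Oplus>\<^bsub>G\<^esub>\<phi>\<in>galois_group k K. f (galois_inv \<phi>)) = (\<Oplus>\<^bsub>G\<^esub>\<phi>\<in>galois_group k K. f \<phi>)"
proof -
  interpret G: abelian_group G by fact
  have inj: "inj_on galois_inv (galois_group k K)" by (rule inj_on_inverseI[of _ galois_inv]) (rule galois_inv)
  have "galois_inv ` galois_group k K = galois_group k K"
    using galois_inv(1,2) by (metis (no_types, lifting) image_iff subsetI subset_antisym)
  then show ?thesis using G.finsum_reindex[OF _ inj, of f] assms(2) by auto
qed

text \<open>The sum is the trace of \<open>x\<close>. Applying \<open>\<psi>\<close> permutes the
  summands, so the trace is fixed by the whole group. Inverses appear because the components of the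
  inverse isomorphism are built from them.\<close>

lemma galois_trace_in_base:
  assumes fin: "finite_dimension k (carrier K)"
    and sep: "separable_extension k K" and normal: "normal_extension k K" and x: "x \<in> carrier K"
  shows "(\<Oplus>\<phi>\<in>galois_group k K. galois_inv \<phi> x) \<in> k"
proof -
  let ?G = "galois_group k K"
  interpret S: subgroup ?G "BijGroup (carrier K)" by (rule subgroup_galois_group)
  interpret B: group "BijGroup (carrier K)" by (rule group_BijGroup)
  have finG: "finite ?G"
    by (rule finite_galois_group[OF fin]) (use sep in \<open>auto simp: separable_extension_def over_def\<close>)
  have cl: "\<phi> z \<in> carrier K" if "\<phi> \<in> ?G" "z \<in> carrier K" for \<phi> z
    using that by (auto simp: galois_group_def intro: ring_hom_closed)
  have "(\<Oplus>\<phi>\<in>?G. \<phi> x) \<in> k"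
  proof (rule fixed_field_galois_group[OF fin sep normal])
    show "(\<Oplus>\<phi>\<in>?G. \<phi> x) \<in> carrier K" using cl x by (intro finsum_closed) auto
    fix \<psi> assume \<psi>: "\<psi> \<in> ?G"
    interpret \<psi>: ring_hom_ring K K \<psi> by (rule galois_group_hom[OF \<psi>])
    let ?m = "\<lambda>\<phi>. \<psi> \<otimes>\<^bsub>BijGroup (carrier K)\<^esub> \<phi>"
    have "\<psi> (\<Oplus>\<phi>\<in>?G. \<phi> x) = (\<Oplus>\<phi>\<in>?G. \<psi> (\<phi> x))"
      using cl x by (intro hom_add_finsum) (auto simp: hom_def finG abelian_group_axioms)
    also have "\<dots> = (\<Oplus>\<phi>\<in>?G. ?m \<phi> x)"
      using cl x \<psi> S.subset by (intro finsum_cong') (auto simp: BijGroup_def compose_def subset_iff)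
    also have "\<dots> = (\<Oplus>\<phi>\<in>?m ` ?G. \<phi> x)"
      using cl x \<psi> S.subset
      by (intro finsum_reindex[symmetric] inj_onI) (auto simp: subset_iff)
    \<comment> \<open>Left translation is injective on a finite set that it maps into
      itself.\<close>
    also have "?m ` ?G = ?G"
    proof (rule endo_inj_surj[OF finG])
      show "inj_on ?m ?G" using \<psi> S.subset by (intro inj_onI) (auto simp: subset_iff)
    qed (use \<psi> in auto)
    finally show "\<psi> (\<Oplus>\<phi>\<in>?G. \<phi> x) = (\<Oplus>\<phi>\<in>?G. \<phi> x)" .
  qed
  then show ?thesis using finsum_galois_inv[OF abelian_group_axioms, of "\<lambda>\<phi>. \<phi> x"] cl x by simp
qed

end

section \<open>The algebra \<open>\<Gamma>\<close> and its twists\<close>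

lemma tensor_hom_eqI:
  assumes "tensor_pair F V W" "abelian_group G"
    and "h \<in> hom (tensor_group F V W) (add_monoid G)" "h' \<in> hom (tensor_group F V W) (add_monoid G)"
    and "\<And>v w. \<lbrakk>v \<in> carrier V; w \<in> carrier W\<rbrakk> \<Longrightarrow> h (pure_tensor F V W v w) = h' (pure_tensor F V W v w)"
    and "S \<in> carrier (tensor_group F V W)"
  shows "h S = h' S"
proof -
  interpret tensor_pair F V W by fact
  show ?thesis using assms(6)
    by (induction S rule: tensor_induct)
      (simp_all add: assms(5) hom_tensor_minus[OF assms(1-3)] hom_tensor_minus[OF assms(1,2,4)])
qed

lemma hom_tensor_group:
  assumes "is_tensor_group T F V W"
  shows "hom (tensor_group F V W) H = hom (add_monoid T) H"
  using assms by (simp add: hom_def is_tensor_group_def)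

locale algebra_extension = field_extension k K + \<Lambda>: assoc_algebra "base_field k K" \<Lambda>
  for k :: "'a set" and K :: "('a, 'x) ring_scheme" (structure) and \<Lambda> :: "('a, 'l, 'y) module_scheme"
begin

abbreviation "A \<equiv> self_algebra K"
abbreviation "\<Gamma> \<equiv> ext_algebra k K \<Lambda>"
abbreviation "pg \<equiv> ext_algebra_pure k K \<Lambda>"

lemma abelian_group_A: "abelian_group A"
  using abelian_groupI[of A] a_assoc a_comm l_neg a_inv_closed by force

lemma tensor_pairI:
  assumes "abelian_group W" "\<And>c w. \<lbrakk>c \<in> k; w \<in> carrier W\<rbrakk> \<Longrightarrow> c \<odot>\<^bsub>W\<^esub> w \<in> carrier W"
  shows "tensor_pair (base_field k K) A W"
  by (intro tensor_pair.intro tensor_pair_axioms.intro abelian_group_A)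
    (use assms k_carrier in auto)

sublocale AL: tensor_pair "base_field k K" A \<Lambda>
  by (rule tensor_pairI) (auto intro: \<Lambda>.smult_closed \<Lambda>.abelian_group_axioms)

text \<open>The product of \<open>\<Gamma>\<close> and its action on \<open>K \<otimes> M\<close>
  have the same shape: multiplication on the left factors and an action of \<open>\<Lambda>\<close>
  on the right ones. The \<open>k\<close>-linearity of \<open>act\<close> in both arguments is what
  allows scalars to cross.\<close>

lemma bilinear_action:
  assumes W: "abelian_group W" "\<And>c w. \<lbrakk>c \<in> k; w \<in> carrier W\<rbrakk> \<Longrightarrow> c \<odot>\<^bsub>W\<^esub> w \<in> carrier W"
    and T: "is_tensor_group T (base_field k K) A W"
    and act: "\<And>l w. \<lbrakk>l \<in> carrier \<Lambda>; w \<in> carrier W\<rbrakk> \<Longrightarrow> act l w \<in> carrier W"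
      "\<And>l l' w. \<lbrakk>l \<in> carrier \<Lambda>; l' \<in> carrier \<Lambda>; w \<in> carrier W\<rbrakk> \<Longrightarrow> act (l \<oplus>\<^bsub>\<Lambda>\<^esub> l') w = act l w \<oplus>\<^bsub>W\<^esub> act l' w"
      "\<And>l w w'. \<lbrakk>l \<in> carrier \<Lambda>; w \<in> carrier W; w' \<in> carrier W\<rbrakk> \<Longrightarrow> act l (w \<oplus>\<^bsub>W\<^esub> w') = act l w \<oplus>\<^bsub>W\<^esub> act l w'"
      "\<And>c l w. \<lbrakk>c \<in> k; l \<in> carrier \<Lambda>; w \<in> carrier W\<rbrakk> \<Longrightarrow> act (c \<odot>\<^bsub>\<Lambda>\<^esub> l) w = c \<odot>\<^bsub>W\<^esub> act l w"
      "\<And>c l w. \<lbrakk>c \<in> k; l \<in> carrier \<Lambda>; w \<in> carrier W\<rbrakk> \<Longrightarrow> act l (c \<odot>\<^bsub>W\<^esub> w) = c \<odot>\<^bsub>W\<^esub> act l w"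
  shows "tensor_bilinear (base_field k K) A \<Lambda> (base_field k K) A W (base_field k K) A W T
    (\<lambda>(a, b) (a', n). (a \<otimes> a', act b n))"
proof -
  interpret AW: tensor_pair "base_field k K" A W by (rule tensor_pairI[OF W])
  note pure = balanced_mapD[OF AW.pure_tensor_balanced[OF T], simplified]
  show ?thesis
  proof unfold_locales
    fix q assume "q \<in> carrier A \<times> carrier W"
    then obtain a' n where q: "q = (a', n)" "a' \<in> carrier K" "n \<in> carrier W" by auto
    have "pure_tensor (base_field k K) A W ((c \<otimes> a) \<otimes> a') (act b n) =
        pure_tensor (base_field k K) A W (a \<otimes> a') (act (c \<odot>\<^bsub>\<Lambda>\<^esub> b) n)"
      if "c \<in> k" "a \<in> carrier K" "b \<in> carrier \<Lambda>" for a b c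
      using pure(4)[of c "a \<otimes> a'" "act b n"] that q k_carrier[OF that(1)] by (simp add: act m_assoc)
    then show "balanced_map (base_field k K) A \<Lambda> T (\<lambda>v w. tensor_class (base_field k K) A W
        (frag_of ((case (v, w) of (a, b) \<Rightarrow> \<lambda>(a', n). (a \<otimes> a', act b n)) q)))"
      using q pure(1-3) act unfolding balanced_map_def pure_tensor_def by (simp add: l_distr)
  next
    fix p assume "p \<in> carrier A \<times> carrier \<Lambda>"
    then obtain a b where p: "p = (a, b)" "a \<in> carrier K" "b \<in> carrier \<Lambda>" by auto
    have "pure_tensor (base_field k K) A W (a \<otimes> (c \<otimes> a')) (act b n) =
        pure_tensor (base_field k K) A W (a \<otimes> a') (act b (c \<odot>\<^bsub>W\<^esub> n))"
      if "c \<in> k" "a' \<in> carrier K" "n \<in> carrier W" for a' n c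
      using pure(4)[of c "a \<otimes> a'" "act b n"] that p k_carrier[OF that(1)] by (simp add: act m_lcomm)
    then show "balanced_map (base_field k K) A W T (\<lambda>v w. tensor_class (base_field k K) A W
        (frag_of ((case p of (a, b) \<Rightarrow> \<lambda>(a', n). (a \<otimes> a', act b n)) (v, w))))"
      using p pure(1-3) act unfolding balanced_map_def pure_tensor_def by (simp add: r_distr)
  qed (use T act in auto)
qed

lemma is_tensor_group_ext_algebra: "is_tensor_group \<Gamma> (base_field k K) A \<Lambda>"
  by (simp add: is_tensor_group_def ext_algebra_def tensor_algebra_def)

sublocale mult: tensor_bilinear "base_field k K" A \<Lambda> "base_field k K" A \<Lambda> "base_field k K" A \<Lambda> \<Gamma>
  "\<lambda>(a, b) (a', b'). (a \<otimes> a', b \<otimes>\<^bsub>\<Lambda>\<^esub> b')"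
  by (rule bilinear_action[OF \<Lambda>.abelian_group_axioms _ is_tensor_group_ext_algebra])
    (auto simp: \<Lambda>.l_distr \<Lambda>.r_distr \<Lambda>.smult_mult_left \<Lambda>.smult_mult_right intro: \<Lambda>.smult_closed)

lemma carrier_ext_algebra: "carrier \<Gamma> = carrier (tensor_group (base_field k K) A \<Lambda>)"
  by (simp add: ext_algebra_def tensor_algebra_def)

lemmas pg_balanced = balanced_mapD[OF AL.pure_tensor_balanced[OF is_tensor_group_ext_algebra], folded ext_algebra_pure_def, simplified]

lemma pg_mult:
  "\<lbrakk>x \<in> carrier K; l \<in> carrier \<Lambda>; y \<in> carrier K; l' \<in> carrier \<Lambda>\<rbrakk> \<Longrightarrow>
    pg x l \<otimes>\<^bsub>\<Gamma>\<^esub> pg y l' = pg (x \<otimes> y) (l \<otimes>\<^bsub>\<Lambda>\<^esub> l')"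
  using mult.lift2_pure[of x l y l'] by (simp add: ext_algebra_pure_def ext_algebra_def tensor_algebra_def pure_tensor_def)

lemma pg_one: "\<one>\<^bsub>\<Gamma>\<^esub> = pg \<one> \<one>\<^bsub>\<Lambda>\<^esub>"
  by (simp add: ext_algebra_pure_def ext_algebra_def tensor_algebra_def)

abbreviation "twist \<phi> \<equiv> tensor_lift (tensor_class (base_field k K) A \<Lambda>) (\<lambda>(x, l). (\<phi> x, l))"

text \<open>This is \<open>\<phi> \<otimes> id\<close>, well defined because \<open>\<phi>\<close>
  fixes \<open>k\<close>. Additivity and the values on pure tensors are what
  \<open>twisted_mult_smult\<close> asks of it.\<close>

lemma twist:
  assumes \<phi>: "\<phi> \<in> galois_group k K"
  shows "twist \<phi> \<in> hom (add_monoid \<Gamma>) (add_monoid \<Gamma>)"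
    and "\<lbrakk>x \<in> carrier K; l \<in> carrier \<Lambda>\<rbrakk> \<Longrightarrow> twist \<phi> (pg x l) = pg (\<phi> x) l"
proof -
  interpret \<phi>: ring_hom_ring K K \<phi> by (rule galois_group_hom[OF \<phi>])
  have ab: "abelian_group \<Gamma>" by (rule AL.abelian_group_tensor[OF is_tensor_group_ext_algebra])
  let ?\<beta> = "\<lambda>v w. tensor_class (base_field k K) A \<Lambda> (frag_of (case (v, w) of (x, l) \<Rightarrow> (\<phi> x, l)))"
  have \<beta>: "?\<beta> v w = pg (\<phi> v) w" for v w by (simp add: ext_algebra_pure_def pure_tensor_def)
  have bal: "balanced_map (base_field k K) A \<Lambda> \<Gamma> ?\<beta>"
    unfolding \<beta> using pg_balanced galois_group_fixes[OF \<phi>] k_carrier by (simp add: balanced_map_def)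
  have eq: "twist \<phi> S = tensor_ext \<Gamma> ?\<beta> S" if "S \<in> carrier \<Gamma>" for S
    by (rule tensor_lift_eq[OF AL.tensor_pair_axioms AL.tensor_pair_axioms is_tensor_group_ext_algebra _ bal])
      (use that in \<open>auto simp: carrier_ext_algebra\<close>)
  have "tensor_ext \<Gamma> ?\<beta> \<in> hom (add_monoid \<Gamma>) (add_monoid \<Gamma>)"
    using AL.tensor_ext_hom[OF ab bal] hom_tensor_group[OF is_tensor_group_ext_algebra] by metis
  then show "twist \<phi> \<in> hom (add_monoid \<Gamma>) (add_monoid \<Gamma>)"
    using abelian_monoid.a_closed[OF abelian_group.axioms(1)[OF ab]] by (auto simp: hom_def eq Pi_iff)
  show "twist \<phi> (pg x l) = pg (\<phi> x) l" if "x \<in> carrier K" "l \<in> carrier \<Lambda>"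
  proof -
    have "tensor_ext \<Gamma> ?\<beta> (pg x l) = ?\<beta> x l"
      unfolding ext_algebra_pure_def by (rule AL.tensor_ext_pure[OF ab bal]) (use that in auto)
    then show ?thesis using eq[of "pg x l"] pg_balanced(1)[OF that] by (simp only: \<beta>)
  qed
qed

end

section \<open>The multiplication map and its section\<close>

lemma hom_comp:
  assumes "f \<in> hom G H" "g \<in> hom H L"
  shows "(\<lambda>x. g (f x)) \<in> hom G L"
  using Group.hom_compose[OF assms] by (simp add: comp_def)

locale extension_module = algebra_extension k K \<Lambda> + M: left_module "ext_algebra k K \<Lambda>" M
  for k :: "'a set" and K :: "('a, 'x) ring_scheme" (structure) and \<Lambda> :: "('a, 'l, 'y) module_scheme"
    and M :: "((('a \<times> 'l) \<Rightarrow>\<^sub>0 int) set, 'm, 'z) module_scheme"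
begin

abbreviation "V \<equiv> underlying_module \<Lambda> (restrict_to_algebra k K \<Lambda> M)"
abbreviation "T \<equiv> ext_module k K \<Lambda> M"
abbreviation "pt \<equiv> ext_module_pure k K \<Lambda> M"

definition field_act :: "'a \<Rightarrow> 'm \<Rightarrow> 'm" where "field_act x m = pg x \<one>\<^bsub>\<Lambda>\<^esub> \<odot>\<^bsub>M\<^esub> m"

definition alg_act :: "'l \<Rightarrow> 'm \<Rightarrow> 'm" where "alg_act l m = pg \<one> l \<odot>\<^bsub>M\<^esub> m"

lemma act_closed [simp, intro]:
  "\<lbrakk>x \<in> carrier K; m \<in> carrier M\<rbrakk> \<Longrightarrow> field_act x m \<in> carrier M"
  "\<lbrakk>l \<in> carrier \<Lambda>; m \<in> carrier M\<rbrakk> \<Longrightarrow> alg_act l m \<in> carrier M"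
  by (simp_all add: field_act_def alg_act_def M.smult_closed pg_balanced(1))

lemma field_act_add:
  "\<lbrakk>x \<in> carrier K; y \<in> carrier K; m \<in> carrier M\<rbrakk> \<Longrightarrow> field_act (x \<oplus> y) m = field_act x m \<oplus>\<^bsub>M\<^esub> field_act y m"
  "\<lbrakk>x \<in> carrier K; m \<in> carrier M; n \<in> carrier M\<rbrakk> \<Longrightarrow> field_act x (m \<oplus>\<^bsub>M\<^esub> n) = field_act x m \<oplus>\<^bsub>M\<^esub> field_act x n"
  by (simp_all add: field_act_def M.smult_l_distr M.smult_r_distr pg_balanced)

lemma alg_act_add:
  "\<lbrakk>l \<in> carrier \<Lambda>; l' \<in> carrier \<Lambda>; m \<in> carrier M\<rbrakk> \<Longrightarrow> alg_act (l \<oplus>\<^bsub>\<Lambda>\<^esub> l') m = alg_act l m \<oplus>\<^bsub>M\<^esub> alg_act l' m"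
  "\<lbrakk>l \<in> carrier \<Lambda>; m \<in> carrier M; n \<in> carrier M\<rbrakk> \<Longrightarrow> alg_act l (m \<oplus>\<^bsub>M\<^esub> n) = alg_act l m \<oplus>\<^bsub>M\<^esub> alg_act l n"
  by (simp_all add: alg_act_def M.smult_l_distr M.smult_r_distr pg_balanced)

text \<open>\<open>x \<otimes> l\<close> factors as \<open>x \<otimes> 1\<close> times
  \<open>1 \<otimes> l\<close> in either order, so an action of \<open>\<Gamma>\<close> amounts to
  commuting actions of \<open>K\<close> and \<open>\<Lambda>\<close>.\<close>

lemma pg_smult:
  assumes "x \<in> carrier K" "l \<in> carrier \<Lambda>" "m \<in> carrier M"
  shows "pg x l \<odot>\<^bsub>M\<^esub> m = field_act x (alg_act l m)" "pg x l \<odot>\<^bsub>M\<^esub> m = alg_act l (field_act x m)"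
  using assms by (simp_all add: field_act_def alg_act_def pg_balanced(1) pg_mult flip: M.smult_assoc)

lemma field_act_mult: "\<lbrakk>x \<in> carrier K; y \<in> carrier K; m \<in> carrier M\<rbrakk> \<Longrightarrow> field_act (x \<otimes> y) m = field_act x (field_act y m)"
  by (simp add: field_act_def pg_balanced(1) pg_mult flip: M.smult_assoc)

lemma field_act_comm:
  assumes "x \<in> carrier K" "y \<in> carrier K" "m \<in> carrier M"
  shows "field_act x (field_act y m) = field_act y (field_act x m)"
  using assms by (simp add: m_comm flip: field_act_mult)

lemma field_act_one: "m \<in> carrier M \<Longrightarrow> field_act \<one> m = m"
  by (simp add: field_act_def M.smult_one flip: pg_one)

lemma field_act_hom: "m \<in> carrier M \<Longrightarrow> (\<lambda>x. field_act x m) \<in> hom (add_monoid K) (add_monoid M)"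
  "x \<in> carrier K \<Longrightarrow> field_act x \<in> hom (add_monoid M) (add_monoid M)"
  by (auto simp: hom_def field_act_add)

lemma V_simps [simp]:
  "carrier V = carrier M" "ring.zero V = \<zero>\<^bsub>M\<^esub>" "ring.add V = ring.add M"
  "c \<odot>\<^bsub>V\<^esub> m = alg_act (c \<odot>\<^bsub>\<Lambda>\<^esub> \<one>\<^bsub>\<Lambda>\<^esub>) m"
  by (simp_all add: underlying_module_def restrict_to_algebra_def restrict_scalars_def alg_act_def)

text \<open>The \<open>k\<close>-structure of \<open>V\<close> arrives through
  \<open>\<Lambda>\<close>, as the action of \<open>1 \<otimes> c1\<close>. Moving \<open>c\<close>
  across identifies it with the restriction of the action of \<open>K\<close>.\<close>

lemma V_smult: "\<lbrakk>c \<in> k; m \<in> carrier M\<rbrakk> \<Longrightarrow> alg_act (c \<odot>\<^bsub>\<Lambda>\<^esub> \<one>\<^bsub>\<Lambda>\<^esub>) m = field_act c m"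
  using pg_balanced(4)[of c \<one> "\<one>\<^bsub>\<Lambda>\<^esub>"] k_carrier by (simp add: field_act_def alg_act_def)

lemma abelian_group_V: "abelian_group V"
  by (rule abelian_groupI) (auto simp: M.M.a_ac intro: M.M.l_neg M.M.a_inv_closed)

sublocale AV: tensor_pair "base_field k K" A V
  by (rule tensor_pairI[OF abelian_group_V]) (auto simp: V_smult k_carrier)

lemma is_tensor_group_ext_module: "is_tensor_group T (base_field k K) A V"
  by (simp add: is_tensor_group_def ext_module_def tensor_module_def Let_def)

sublocale act: tensor_bilinear "base_field k K" A \<Lambda> "base_field k K" A V "base_field k K" A V T
  "\<lambda>(a, b) (a', n). (a \<otimes> a', alg_act b n)"
proof (rule bilinear_action[OF abelian_group_V _ is_tensor_group_ext_module])
  fix c l w assume "c \<in> k" "l \<in> carrier \<Lambda>" "w \<in> carrier V"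
  then have *: "c \<in> k" "c \<in> carrier K" "l \<in> carrier \<Lambda>" "w \<in> carrier M" using k_carrier by auto
  \<comment> \<open>A scalar from \<open>k\<close> passes from the \<open>\<Lambda>\<close>-factor
    to the \<open>K\<close>-factor, where \<open>V_smult\<close> recognises it as the action on
    \<open>V\<close>.\<close>
  have "pg \<one> (c \<odot>\<^bsub>\<Lambda>\<^esub> l) = pg c l" using pg_balanced(4)[of c \<one> l] * by simp
  then show "alg_act (c \<odot>\<^bsub>\<Lambda>\<^esub> l) w = c \<odot>\<^bsub>V\<^esub> alg_act l w"
    using * pg_smult(1)[of c l w] by (simp add: V_smult) (simp add: alg_act_def)
  show "alg_act l (c \<odot>\<^bsub>V\<^esub> w) = c \<odot>\<^bsub>V\<^esub> alg_act l w"
    using * pg_smult[of c l w] by (simp add: V_smult)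
qed (auto simp: V_smult k_carrier alg_act_add)

lemma smult_T: "smult T = act.lift2"
  by (simp add: ext_module_def tensor_module_def Let_def restrict_to_algebra_def restrict_scalars_def alg_act_def
      self_algebra_def[symmetric])

lemma carrier_T: "carrier T = carrier (tensor_group (base_field k K) A V)"
  by (simp add: ext_module_def tensor_module_def Let_def)

lemmas pt_balanced = balanced_mapD[OF AV.pure_tensor_balanced[OF is_tensor_group_ext_module],
    folded ext_module_pure_def, simplified]

sublocale T: abelian_group T
  by (rule AV.abelian_group_tensor[OF is_tensor_group_ext_module])

lemma smult_T_pure:
  "\<lbrakk>x \<in> carrier K; l \<in> carrier \<Lambda>; y \<in> carrier K; m \<in> carrier M\<rbrakk> \<Longrightarrow>
    pg x l \<odot>\<^bsub>T\<^esub> pt y m = pt (x \<otimes> y) (alg_act l m)"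
  using act.lift2_pure[of x l y m]
  by (simp add: smult_T ext_algebra_pure_def ext_module_pure_def) (simp add: pure_tensor_def)

lemma smult_T_hom:
  "S \<in> carrier T \<Longrightarrow> (\<lambda>g. g \<odot>\<^bsub>T\<^esub> S) \<in> hom (add_monoid \<Gamma>) (add_monoid T)"
  "g \<in> carrier \<Gamma> \<Longrightarrow> (\<lambda>S. g \<odot>\<^bsub>T\<^esub> S) \<in> hom (add_monoid T) (add_monoid T)"
  using act.lift2_hom1[of S] act.lift2_hom2[of g]
  by (simp_all add: smult_T carrier_T carrier_ext_algebra hom_tensor_group[OF is_tensor_group_ext_module]
      hom_tensor_group[OF is_tensor_group_ext_algebra])

lemma smult_M_hom:
  "m \<in> carrier M \<Longrightarrow> (\<lambda>g. g \<odot>\<^bsub>M\<^esub> m) \<in> hom (add_monoid \<Gamma>) (add_monoid M)"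
  "g \<in> carrier \<Gamma> \<Longrightarrow> (\<lambda>m. g \<odot>\<^bsub>M\<^esub> m) \<in> hom (add_monoid M) (add_monoid M)"
  by (auto simp: hom_def M.smult_closed M.smult_l_distr M.smult_r_distr)

lemma ext_algebra_hom_eqI:
  assumes "abelian_group G" "h \<in> hom (add_monoid \<Gamma>) (add_monoid G)" "h' \<in> hom (add_monoid \<Gamma>) (add_monoid G)"
    and "\<And>x l. \<lbrakk>x \<in> carrier K; l \<in> carrier \<Lambda>\<rbrakk> \<Longrightarrow> h (pg x l) = h' (pg x l)" "g \<in> carrier \<Gamma>"
  shows "h g = h' g"
  by (rule tensor_hom_eqI[OF AL.tensor_pair_axioms assms(1)])
    (use assms(2-5) in \<open>auto simp: hom_tensor_group[OF is_tensor_group_ext_algebra] carrier_ext_algebra ext_algebra_pure_def\<close>)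

lemma ext_module_hom_eqI:
  assumes "abelian_group G" "h \<in> hom (add_monoid T) (add_monoid G)" "h' \<in> hom (add_monoid T) (add_monoid G)"
    and "\<And>x m. \<lbrakk>x \<in> carrier K; m \<in> carrier M\<rbrakk> \<Longrightarrow> h (pt x m) = h' (pt x m)" "S \<in> carrier T"
  shows "h S = h' S"
  by (rule tensor_hom_eqI[OF AV.tensor_pair_axioms assms(1)])
    (use assms(2-5) in \<open>auto simp: hom_tensor_group[OF is_tensor_group_ext_module] carrier_T ext_module_pure_def\<close>)

text \<open>One family for both claims: the identity gives the multiplication map, the elements of
  the Galois group give the components of the isomorphism.\<close>

definition twisted_mult :: "('a \<Rightarrow> 'a) \<Rightarrow> (('a \<times> 'm) \<Rightarrow>\<^sub>0 int) set \<Rightarrow> 'm"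
  where "twisted_mult \<phi> = tensor_ext M (\<lambda>x m. field_act (\<phi> x) m)"

lemma mult_map_eq: "mult_map k K \<Lambda> M = twisted_mult (\<lambda>x. x)"
  by (simp add: fun_eq_iff mult_map_def twisted_mult_def tensor_ext_def frag_sum_def field_act_def)

context
  fixes \<phi>
  assumes \<phi>: "\<phi> \<in> ring_hom K K" "\<And>c. c \<in> k \<Longrightarrow> \<phi> c = c"
begin

interpretation \<phi>: ring_hom_ring K K \<phi> by (rule ring_hom_ringI2[OF ring_axioms ring_axioms \<phi>(1)])

lemma balanced_twisted_mult: "balanced_map (base_field k K) A V M (\<lambda>x m. field_act (\<phi> x) m)"
  using k_carrier by (auto simp: balanced_map_def field_act_add V_smult \<phi>(2) field_act_mult intro: field_act_comm)

lemma twisted_mult_pure: "\<lbrakk>x \<in> carrier K; m \<in> carrier M\<rbrakk> \<Longrightarrow> twisted_mult \<phi> (pt x m) = field_act (\<phi> x) m"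
  unfolding twisted_mult_def ext_module_pure_def
  by (rule AV.tensor_ext_pure[OF M.M.abelian_group_axioms balanced_twisted_mult]) auto

lemma twisted_mult_hom: "twisted_mult \<phi> \<in> hom (add_monoid T) (add_monoid M)"
  unfolding twisted_mult_def hom_tensor_group[OF is_tensor_group_ext_module, symmetric]
  by (rule AV.tensor_ext_hom[OF M.M.abelian_group_axioms balanced_twisted_mult])

text \<open>\<open>\<theta>\<close> stands for \<open>\<phi> \<otimes> id\<close> on
  \<open>\<Gamma>\<close>. It is kept abstract so that the identity serves for the multiplication
  map and \<open>twist \<phi>\<close> for the twisted modules. Both sides are additive in
  \<open>S\<close> and in \<open>g\<close>, which leaves pure tensors.\<close>

lemma twisted_mult_smult:
  assumes \<theta>: "\<theta> \<in> hom (add_monoid \<Gamma>) (add_monoid \<Gamma>)"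
      "\<And>x l. \<lbrakk>x \<in> carrier K; l \<in> carrier \<Lambda>\<rbrakk> \<Longrightarrow> \<theta> (pg x l) = pg (\<phi> x) l"
    and g: "g \<in> carrier \<Gamma>" and S: "S \<in> carrier T"
  shows "twisted_mult \<phi> (g \<odot>\<^bsub>T\<^esub> S) = \<theta> g \<odot>\<^bsub>M\<^esub> twisted_mult \<phi> S"
proof (rule ext_module_hom_eqI[OF M.M.abelian_group_axioms _ _ _ S, of "\<lambda>S. twisted_mult \<phi> (g \<odot>\<^bsub>T\<^esub> S)"])
  show "(\<lambda>S. twisted_mult \<phi> (g \<odot>\<^bsub>T\<^esub> S)) \<in> hom (add_monoid T) (add_monoid M)"
    by (rule hom_comp[OF smult_T_hom(2)[OF g] twisted_mult_hom])
  show "(\<lambda>S. \<theta> g \<odot>\<^bsub>M\<^esub> twisted_mult \<phi> S) \<in> hom (add_monoid T) (add_monoid M)"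
    by (rule hom_comp[OF twisted_mult_hom smult_M_hom(2)[OF hom_add_closed[OF \<theta>(1) g]]])
  fix y m assume ym: "y \<in> carrier K" "m \<in> carrier M"
  then have ptT: "pt y m \<in> carrier T" and tm: "twisted_mult \<phi> (pt y m) \<in> carrier M"
    using pt_balanced(1) twisted_mult_pure by auto
  show "twisted_mult \<phi> (g \<odot>\<^bsub>T\<^esub> pt y m) = \<theta> g \<odot>\<^bsub>M\<^esub> twisted_mult \<phi> (pt y m)"
  proof (rule ext_algebra_hom_eqI[OF M.M.abelian_group_axioms _ _ _ g, of "\<lambda>g. twisted_mult \<phi> (g \<odot>\<^bsub>T\<^esub> pt y m)"])
    show "(\<lambda>g. twisted_mult \<phi> (g \<odot>\<^bsub>T\<^esub> pt y m)) \<in> hom (add_monoid \<Gamma>) (add_monoid M)"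
      by (rule hom_comp[OF smult_T_hom(1)[OF ptT] twisted_mult_hom])
    show "(\<lambda>g. \<theta> g \<odot>\<^bsub>M\<^esub> twisted_mult \<phi> (pt y m)) \<in> hom (add_monoid \<Gamma>) (add_monoid M)"
      by (rule hom_comp[OF \<theta>(1) smult_M_hom(1)[OF tm]])
    fix x l assume "x \<in> carrier K" "l \<in> carrier \<Lambda>"
    then show "twisted_mult \<phi> (pg x l \<odot>\<^bsub>T\<^esub> pt y m) = \<theta> (pg x l) \<odot>\<^bsub>M\<^esub> twisted_mult \<phi> (pt y m)"
      using ym pg_smult[of "\<phi> y" l m] by (simp add: smult_T_pure twisted_mult_pure \<theta>(2) pg_smult field_act_mult)
  qed
qed

end

text \<open>With the identity this is the section of the multiplication map; with the inverse of a
  Galois automorphism it is a component of the inverse isomorphism.\<close>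

definition twisted_section :: "('a \<times> 'a) list \<Rightarrow> ('a \<Rightarrow> 'a) \<Rightarrow> 'm \<Rightarrow> (('a \<times> 'm) \<Rightarrow>\<^sub>0 int) set"
  where "twisted_section ps \<phi> m = list_sum T (\<lambda>(x, y). pt (\<phi> x) (field_act y m)) ps"

lemma alg_act_one: "m \<in> carrier M \<Longrightarrow> alg_act \<one>\<^bsub>\<Lambda>\<^esub> m = m"
  by (simp add: alg_act_def M.smult_one flip: pg_one)

text \<open>The test map for linearity of the section over \<open>a \<otimes> l\<close>; the action
  of \<open>l\<close> is included so that centrality can be applied after the scalar has
  acted.\<close>

lemma balanced_section:
  assumes \<phi>: "\<phi> \<in> ring_hom K K" "\<And>c. c \<in> k \<Longrightarrow> \<phi> c = c" and l: "l \<in> carrier \<Lambda>" and m: "m \<in> carrier M"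
  shows "balanced T (\<lambda>x y. pt (\<phi> x) (alg_act l (field_act y m)))"
proof -
  interpret \<phi>: ring_hom_ring K K \<phi> by (rule ring_hom_ringI2[OF ring_axioms ring_axioms \<phi>(1)])
  have "pt (\<phi> (c \<otimes> x)) (alg_act l (field_act y m)) = pt (\<phi> x) (alg_act l (field_act (c \<otimes> y) m))"
    if "c \<in> k" "x \<in> carrier K" "y \<in> carrier K" for c x y
  proof -
    have c: "c \<in> carrier K" using that k_carrier by simp
    have "pt (\<phi> (c \<otimes> x)) (alg_act l (field_act y m)) = pt (\<phi> x) (field_act c (alg_act l (field_act y m)))"
      using pt_balanced(4)[of c "\<phi> x" "alg_act l (field_act y m)"] that c l m by (simp add: \<phi>(2) V_smult)
    also have "field_act c (alg_act l (field_act y m)) = alg_act l (field_act (c \<otimes> y) m)"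
      using pg_smult[of c l "field_act y m"] that c l m by (simp add: field_act_mult)
    finally show ?thesis .
  qed
  then show ?thesis
    unfolding balanced_map_def using l m by (simp add: pt_balanced field_act_add alg_act_add)
qed

lemma balanced_section':
  assumes \<phi>: "\<phi> \<in> ring_hom K K" "\<And>c. c \<in> k \<Longrightarrow> \<phi> c = c" and m: "m \<in> carrier M"
  shows "balanced T (\<lambda>x y. pt (\<phi> x) (field_act y m))"
proof -
  have "balanced T (\<lambda>x y. pt (\<phi> x) (alg_act \<one>\<^bsub>\<Lambda>\<^esub> (field_act y m)))"
    by (rule balanced_section[OF \<phi> _ m]) auto
  then show ?thesis using m k_carrier unfolding balanced_map_def by (simp add: alg_act_one)
qed

end

text \<open>Centrality for \<open>T\<close> gives linearity of the section and the sum formula over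
  the Galois group, centrality for \<open>K\<close> gives orthogonality.\<close>

locale separability_element = extension_module k K \<Lambda> M
  for k :: "'a set" and K :: "('a, 'x) ring_scheme" (structure) and \<Lambda> :: "('a, 'l, 'y) module_scheme"
    and M :: "((('a \<times> 'l) \<Rightarrow>\<^sub>0 int) set, 'm, 'z) module_scheme" +
  fixes ps :: "('a \<times> 'a) list"
  assumes ps: "set ps \<subseteq> carrier K \<times> carrier K"
    and ps_one: "list_sum K (\<lambda>(x, y). x \<otimes> y) ps = \<one>"
    and central_T: "central T ps = carrier K" and central_K: "central K ps = carrier K"
begin

lemma ps_closed: "(x, y) \<in> set ps \<Longrightarrow> x \<in> carrier K" "(x, y) \<in> set ps \<Longrightarrow> y \<in> carrier K"
  using ps by auto

lemma centralD:
  assumes "balanced T \<beta>" "c \<in> carrier K"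
  shows "list_sum T (\<lambda>(x, y). \<beta> (c \<otimes> x) y) ps = list_sum T (\<lambda>(x, y). \<beta> x (c \<otimes> y)) ps"
  using assms central_T unfolding central_def by blast

lemma twisted_section_hom:
  assumes \<phi>: "\<phi> \<in> ring_hom K K"
  shows "twisted_section ps \<phi> \<in> hom (add_monoid M) (add_monoid T)"
proof -
  have cl: "\<phi> x \<in> carrier K" if "x \<in> carrier K" for x using ring_hom_closed[OF \<phi> that] .
  have "twisted_section ps \<phi> (m \<oplus>\<^bsub>M\<^esub> n) = twisted_section ps \<phi> m \<oplus>\<^bsub>T\<^esub> twisted_section ps \<phi> n"
    if "m \<in> carrier M" "n \<in> carrier M" for m n
    unfolding twisted_section_def using that cl ps_closed
    by (subst T.list_sum_addf[symmetric]) (auto simp: field_act_add pt_balanced intro!: list_sum_cong)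
  moreover have "twisted_section ps \<phi> m \<in> carrier T" if "m \<in> carrier M" for m
    unfolding twisted_section_def using that cl ps_closed pt_balanced(1) by (intro T.list_sum_closed) auto
  ultimately show ?thesis by (simp add: hom_def)
qed

text \<open>It suffices to treat \<open>a \<otimes> l\<close>. Multiplying from the left puts
  \<open>a\<close> on the first entries of the pairs; centrality carries it to the second entries,
  where it acts on \<open>m\<close>.\<close>

lemma twisted_section_smult:
  assumes g: "g \<in> carrier \<Gamma>" and m: "m \<in> carrier M"
  shows "twisted_section ps (\<lambda>x. x) (g \<odot>\<^bsub>M\<^esub> m) = g \<odot>\<^bsub>T\<^esub> twisted_section ps (\<lambda>x. x) m"
proof (rule ext_algebra_hom_eqI[OF T.abelian_group_axioms _ _ _ g])
  have id: "(\<lambda>x. x) \<in> ring_hom K K" by (simp add: ring_hom_def)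
  let ?s = "twisted_section ps (\<lambda>x. x)"
  have s: "?s m \<in> carrier T" using hom_add_closed[OF twisted_section_hom[OF id] m] .
  show "(\<lambda>g. ?s (g \<odot>\<^bsub>M\<^esub> m)) \<in> hom (add_monoid \<Gamma>) (add_monoid T)"
    by (rule hom_comp[OF smult_M_hom(1)[OF m] twisted_section_hom[OF id]])
  show "(\<lambda>g. g \<odot>\<^bsub>T\<^esub> ?s m) \<in> hom (add_monoid \<Gamma>) (add_monoid T)"
    by (rule smult_T_hom(1)[OF s])
  fix a l assume al: "a \<in> carrier K" "l \<in> carrier \<Lambda>"
  note c = ps_closed
  have "pg a l \<odot>\<^bsub>T\<^esub> ?s m = list_sum T (\<lambda>z. pg a l \<odot>\<^bsub>T\<^esub> (case z of (x, y) \<Rightarrow> pt x (field_act y m))) ps"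
    unfolding twisted_section_def
    by (rule hom_add_list_sum[OF T.abelian_group_axioms T.abelian_group_axioms smult_T_hom(2)])
      (use al m c pg_balanced(1) pt_balanced(1) in auto)
  also have "\<dots> = list_sum T (\<lambda>(x, y). pt (a \<otimes> x) (alg_act l (field_act y m))) ps"
    by (rule list_sum_cong) (use al m c in \<open>auto simp: smult_T_pure\<close>)
  also have "\<dots> = list_sum T (\<lambda>(x, y). pt x (alg_act l (field_act (a \<otimes> y) m))) ps"
    by (rule centralD[OF balanced_section[OF id _ al(2) m] al(1)]) simp
  also have "\<dots> = ?s (pg a l \<odot>\<^bsub>M\<^esub> m)"
    unfolding twisted_section_def
  proof (rule list_sum_cong, clarify)
    fix x y assume "(x, y) \<in> set ps"
    then have "alg_act l (field_act (a \<otimes> y) m) = field_act y (pg a l \<odot>\<^bsub>M\<^esub> m)"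
      using al m c pg_smult[of a l m] pg_smult[of y l "field_act a m"] by (simp add: m_comm[of a y] field_act_mult)
    then show "pt x (alg_act l (field_act (a \<otimes> y) m)) = pt x (field_act y (pg a l \<odot>\<^bsub>M\<^esub> m))" by simp
  qed
  finally show "?s (pg a l \<odot>\<^bsub>M\<^esub> m) = pg a l \<odot>\<^bsub>T\<^esub> ?s m" by simp
qed

text \<open>The composite is multiplication by a scalar of \<open>K\<close> that depends on
  \<open>\<psi>\<close> after \<open>\<phi>\<close> only, which is the form to which
  \<open>ps_one\<close> and \<open>galois_orthogonality\<close> apply.\<close>

lemma twisted_mult_section:
  assumes \<phi>: "\<phi> \<in> ring_hom K K" and \<psi>: "\<psi> \<in> ring_hom K K" "\<And>c. c \<in> k \<Longrightarrow> \<psi> c = c" and m: "m \<in> carrier M"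
  shows "twisted_mult \<psi> (twisted_section ps \<phi> m) = field_act (list_sum K (\<lambda>(x, y). \<psi> (\<phi> x) \<otimes> y) ps) m"
proof -
  have cl: "\<phi> x \<in> carrier K" "\<psi> x \<in> carrier K" if "x \<in> carrier K" for x
    using ring_hom_closed[OF \<phi> that] ring_hom_closed[OF \<psi>(1) that] by auto
  note c = ps_closed
  have "twisted_mult \<psi> (twisted_section ps \<phi> m) =
      list_sum M (\<lambda>z. twisted_mult \<psi> (case z of (x, y) \<Rightarrow> pt (\<phi> x) (field_act y m))) ps"
    unfolding twisted_section_def
    by (rule hom_add_list_sum[OF T.abelian_group_axioms M.M.abelian_group_axioms twisted_mult_hom[OF \<psi>]])
      (use c m cl pt_balanced(1) in auto)
  also have "\<dots> = list_sum M (\<lambda>z. field_act (case z of (x, y) \<Rightarrow> \<psi> (\<phi> x) \<otimes> y) m) ps"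
    by (rule list_sum_cong) (use c m cl in \<open>auto simp: twisted_mult_pure[OF \<psi>] field_act_mult\<close>)
  also have "\<dots> = field_act (list_sum K (\<lambda>(x, y). \<psi> (\<phi> x) \<otimes> y) ps) m"
    by (rule hom_add_list_sum[OF abelian_group_axioms M.M.abelian_group_axioms field_act_hom(1)[OF m], symmetric])
      (use c cl in auto)
  finally show ?thesis .
qed

lemma split_epimorphism_mult_map: "split_epimorphism \<Gamma> T M (mult_map k K \<Lambda> M)"
proof -
  have id: "(\<lambda>x. x) \<in> ring_hom K K" by (simp add: ring_hom_def)
  have id': "(\<lambda>x. x) \<in> hom (add_monoid \<Gamma>) (add_monoid \<Gamma>)" by (simp add: hom_def)
  let ?s = "twisted_section ps (\<lambda>x. x)"
  have "twisted_mult (\<lambda>x. x) \<in> left_module_hom \<Gamma> T M"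
    using twisted_mult_hom[OF id] twisted_mult_smult[OF id _ id'] by (auto simp: left_module_hom_def hom_def)
  moreover have "?s \<in> left_module_hom \<Gamma> M T"
    using twisted_section_hom[OF id] twisted_section_smult by (auto simp: left_module_hom_def hom_def)
  moreover have "twisted_mult (\<lambda>x. x) (?s m) = m" if "m \<in> carrier M" for m
    using twisted_mult_section[OF id id _ that] ps_one field_act_one[OF that] by simp
  ultimately show ?thesis unfolding split_epimorphism_def mult_map_eq by auto
qed

end

section \<open>The Galois decomposition\<close>

lemma finsum_hom:
  assumes "abelian_group G" "abelian_group H" "finite I" "\<And>i. i \<in> I \<Longrightarrow> h i \<in> hom (add_monoid G) (add_monoid H)"
  shows "(\<lambda>x. \<Oplus>\<^bsub>H\<^esub>i\<in>I. h i x) \<in> hom (add_monoid G) (add_monoid H)"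
proof -
  interpret H: abelian_group H by fact
  have cl: "h i x \<in> carrier H" if "i \<in> I" "x \<in> carrier G" for i x
    using hom_add_closed[OF assms(4)[OF that(1)] that(2)] .
  show ?thesis
  proof (rule homI)
    fix x y assume "x \<in> carrier (add_monoid G)" "y \<in> carrier (add_monoid G)"
    then have x: "x \<in> carrier G" and y: "y \<in> carrier G" by auto
    have "x \<oplus>\<^bsub>G\<^esub> y \<in> carrier G"
      using assms(1) x y by (simp add: abelian_group_def abelian_monoid.a_closed)
    then have "(\<Oplus>\<^bsub>H\<^esub>i\<in>I. h i (x \<oplus>\<^bsub>G\<^esub> y)) = (\<Oplus>\<^bsub>H\<^esub>i\<in>I. h i x \<oplus>\<^bsub>H\<^esub> h i y)"
      using cl x y hom_add_add[OF assms(4)] by (intro H.finsum_cong') auto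
    also have "\<dots> = (\<Oplus>\<^bsub>H\<^esub>i\<in>I. h i x) \<oplus>\<^bsub>H\<^esub> (\<Oplus>\<^bsub>H\<^esub>i\<in>I. h i y)"
      using cl x y by (intro H.finsum_addf) auto
    finally show "(\<Oplus>\<^bsub>H\<^esub>i\<in>I. h i (x \<otimes>\<^bsub>add_monoid G\<^esub> y)) = (\<Oplus>\<^bsub>H\<^esub>i\<in>I. h i x) \<otimes>\<^bsub>add_monoid H\<^esub> (\<Oplus>\<^bsub>H\<^esub>i\<in>I. h i y)"
      by simp
  qed (use cl in \<open>auto intro!: H.finsum_closed\<close>)
qed

context separability_element
begin

context
  assumes fin: "finite_dimension k (carrier K)"
    and sep: "separable_extension k K" and normal: "normal_extension k K"
begin

abbreviation "Gal \<equiv> galois_group k K"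
text \<open>With the inverse, \<open>twisted_mult \<psi>\<close> after \<open>sec \<phi>\<close>
  involves \<open>\<psi>\<close> after the inverse of \<open>\<phi>\<close>, which is trivial
  exactly on the diagonal.\<close>

abbreviation "sec \<equiv> \<lambda>\<phi>. twisted_section ps (galois_inv \<phi>)"

lemmas Gal_hom = galois_group_hom[THEN ring_hom_ring.homh]

lemma Gal_closed: "\<lbrakk>\<phi> \<in> Gal; x \<in> carrier K\<rbrakk> \<Longrightarrow> \<phi> x \<in> carrier K"
  by (rule ring_hom_closed[OF Gal_hom])

lemma finite_Gal: "finite Gal"
  by (rule finite_galois_group[OF fin]) (use sep in \<open>auto simp: separable_extension_def over_def\<close>)

lemma Gal_eqI: "\<lbrakk>\<phi> \<in> Gal; \<psi> \<in> Gal; \<And>x. x \<in> carrier K \<Longrightarrow> \<phi> x = \<psi> x\<rbrakk> \<Longrightarrow> \<phi> = \<psi>"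
  by (rule extensionalityI[of _ "carrier K"]) (auto simp: galois_group_def Bij_def)

lemma sec_hom: "\<phi> \<in> Gal \<Longrightarrow> sec \<phi> \<in> hom (add_monoid M) (add_monoid T)"
  by (rule twisted_section_hom[OF Gal_hom[OF galois_inv(1)]])

lemma twisted_mult_hom': "\<phi> \<in> Gal \<Longrightarrow> twisted_mult \<phi> \<in> hom (add_monoid T) (add_monoid M)"
  by (rule twisted_mult_hom[OF Gal_hom galois_group_fixes])

lemma twisted_mult_sec:
  assumes \<phi>: "\<phi> \<in> Gal" and \<psi>: "\<psi> \<in> Gal" and m: "m \<in> carrier M"
  shows "twisted_mult \<psi> (sec \<phi> m) = (if \<psi> = \<phi> then m else \<zero>\<^bsub>M\<^esub>)"
proof -
  have comp: "(\<lambda>x. \<psi> (galois_inv \<phi> x)) \<in> ring_hom K K"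
    using ring_hom_trans[OF Gal_hom[OF galois_inv(1)[OF \<phi>]] Gal_hom[OF \<psi>]] by (simp add: comp_def)
  have fixes_k: "\<psi> (galois_inv \<phi> c) = c" if "c \<in> k" for c
    using that galois_group_fixes galois_inv(1)[OF \<phi>] \<psi> by metis
  \<comment> \<open>Agreement on the carrier yields equal functions because the automorphisms are
    extensional, see \<open>Gal_eqI\<close>.\<close>
  have iff: "(\<forall>c\<in>carrier K. \<psi> (galois_inv \<phi> c) = c) \<longleftrightarrow> \<psi> = \<phi>"
  proof
    assume *: "\<forall>c\<in>carrier K. \<psi> (galois_inv \<phi> c) = c"
    show "\<psi> = \<phi>"
    proof (rule Gal_eqI[OF \<psi> \<phi>])
      fix x assume "x \<in> carrier K"
      then show "\<psi> x = \<phi> x" using *[rule_format, of "\<phi> x"] galois_inv(3)[OF \<phi>] Gal_closed[OF \<phi>] by simp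
    qed
  qed (use galois_inv(4)[OF \<phi>] in auto)
  have "twisted_mult \<psi> (sec \<phi> m) = field_act (list_sum K (\<lambda>(x, y). \<psi> (galois_inv \<phi> x) \<otimes> y) ps) m"
    by (rule twisted_mult_section[OF Gal_hom[OF galois_inv(1)[OF \<phi>]] Gal_hom[OF \<psi>]
          galois_group_fixes[OF \<psi>] m])
  also have "\<dots> = field_act (if \<psi> = \<phi> then \<one> else \<zero>) m"
    using galois_orthogonality[OF ps ps_one central_K comp fixes_k] iff by simp
  also have "\<dots> = (if \<psi> = \<phi> then m else \<zero>\<^bsub>M\<^esub>)"
    using field_act_one[OF m] hom_add_zero[OF abelian_group_axioms M.M.abelian_group_axioms field_act_hom(1)[OF m]] by simp
  finally show ?thesis .
qed

text \<open>For \<open>x \<otimes> m\<close> the summand at \<open>\<phi>\<close> becomes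
  \<open>\<Sum> x \<phi>^{-1}(a) \<otimes> b m\<close> over the pairs \<open>(a, b)\<close>. Summing
  over the group puts the trace \<open>Tr a\<close> next to \<open>x\<close>, from where it crosses
  the tensor sign, and \<open>\<Sum> Tr(a) b = 1\<close> because orthogonality leaves only the
  identity.\<close>

lemma sum_sec_twisted_mult:
  assumes S: "S \<in> carrier T"
  shows "(\<Oplus>\<^bsub>T\<^esub>\<phi>\<in>Gal. sec \<phi> (twisted_mult \<phi> S)) = S"
proof (rule ext_module_hom_eqI[OF T.abelian_group_axioms _ _ _ S])
  show "(\<lambda>S. \<Oplus>\<^bsub>T\<^esub>\<phi>\<in>Gal. sec \<phi> (twisted_mult \<phi> S)) \<in> hom (add_monoid T) (add_monoid T)"
    by (rule finsum_hom[OF T.abelian_group_axioms T.abelian_group_axioms finite_Gal])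
      (rule hom_comp[OF twisted_mult_hom' sec_hom])
  show "(\<lambda>S. S) \<in> hom (add_monoid T) (add_monoid T)" by (simp add: hom_def)
  fix x m assume x: "x \<in> carrier K" and m: "m \<in> carrier M"
  note c = ps_closed
  define Tr where "Tr z = (\<Oplus>\<phi>\<in>Gal. galois_inv \<phi> z)" for z
  have inv_cl: "galois_inv \<phi> z \<in> carrier K" if "\<phi> \<in> Gal" "z \<in> carrier K" for \<phi> z
    using Gal_closed[OF galois_inv(1)] that by blast
  have Tr_k: "Tr z \<in> k" if "z \<in> carrier K" for z
    unfolding Tr_def by (rule galois_trace_in_base[OF fin sep normal that])
  have sec_pt: "sec \<phi> (twisted_mult \<phi> (pt x m)) = list_sum T (\<lambda>(a, b). pt (x \<otimes> galois_inv \<phi> a) (field_act b m)) ps"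
    if \<phi>: "\<phi> \<in> Gal" for \<phi>
  proof -
    note inv = galois_inv(1)[OF \<phi>]
    have "sec \<phi> (twisted_mult \<phi> (pt x m)) = list_sum T (\<lambda>(a, b). pt (galois_inv \<phi> a) (field_act (\<phi> x \<otimes> b) m)) ps"
    proof -
      have tm: "twisted_mult \<phi> (pt x m) = field_act (\<phi> x) m"
        by (rule twisted_mult_pure[OF Gal_hom[OF \<phi>] galois_group_fixes[OF \<phi>] x m])
      have "field_act b (field_act (\<phi> x) m) = field_act (\<phi> x \<otimes> b) m" if "(a, b) \<in> set ps" for a b
        using c[OF that] Gal_closed[OF \<phi> x] m by (simp add: m_comm[of "\<phi> x"] field_act_mult)
      then show ?thesis unfolding twisted_section_def tm by (intro list_sum_cong) auto
    qed
    \<comment> \<open>Centrality carries \<open>\<phi> x\<close> from the second entries to the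
      first ones, where \<open>galois_inv \<phi>\<close> turns it back into
      \<open>x\<close>.\<close>
    also have "\<dots> = list_sum T (\<lambda>(a, b). pt (galois_inv \<phi> (\<phi> x \<otimes> a)) (field_act b m)) ps"
      by (rule centralD[OF
            balanced_section'[OF Gal_hom[OF inv] galois_group_fixes[OF inv] m], symmetric])
        (use Gal_closed[OF \<phi> x] in auto)
    also have "\<dots> = list_sum T (\<lambda>(a, b). pt (x \<otimes> galois_inv \<phi> a) (field_act b m)) ps"
      by (rule list_sum_cong)
        (use c x Gal_closed[OF \<phi>] in \<open>auto simp: ring_hom_mult[OF Gal_hom[OF inv]] galois_inv(3)[OF \<phi>]\<close>)
    finally show ?thesis .
  qed
  have "(\<Oplus>\<^bsub>T\<^esub>\<phi>\<in>Gal. sec \<phi> (twisted_mult \<phi> (pt x m))) =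
      (\<Oplus>\<^bsub>T\<^esub>\<phi>\<in>Gal. list_sum T (\<lambda>(a, b). pt (x \<otimes> galois_inv \<phi> a) (field_act b m)) ps)"
    using sec_pt by (intro T.finsum_cong')
      (auto intro!: T.list_sum_closed simp: pt_balanced(1) c x m inv_cl)
  also have "\<dots> = list_sum T (\<lambda>z. \<Oplus>\<^bsub>T\<^esub>\<phi>\<in>Gal. (case z of (a, b) \<Rightarrow> pt (x \<otimes> galois_inv \<phi> a) (field_act b m))) ps"
    by (rule T.finsum_list_sum[OF finite_Gal]) (auto simp: pt_balanced(1) c x m inv_cl)
  also have "\<dots> = list_sum T (\<lambda>z. pt x (field_act (case z of (a, b) \<Rightarrow> Tr a \<otimes> b) m)) ps"
  proof (rule list_sum_cong, clarify)
    fix a b assume ab: "(a, b) \<in> set ps"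
    have "(\<Oplus>\<^bsub>T\<^esub>\<phi>\<in>Gal. pt (x \<otimes> galois_inv \<phi> a) (field_act b m)) = pt (x \<otimes> Tr a) (field_act b m)"
      unfolding Tr_def
      by (rule hom_add_finsum[OF abelian_group_axioms T.abelian_group_axioms _ finite_Gal, symmetric])
        (use c[OF ab] x m in \<open>auto simp: hom_def r_distr pt_balanced inv_cl\<close>)
    also have "\<dots> = pt (Tr a \<otimes> x) (field_act b m)" using x c[OF ab] Tr_k k_carrier by (simp add: m_comm)
    \<comment> \<open>The trace lies in \<open>k\<close>, so it may cross the tensor sign.\<close>
    also have "\<dots> = pt x (field_act (Tr a \<otimes> b) m)"
      using pt_balanced(4)[OF Tr_k x, of a "field_act b m"] c[OF ab] m Tr_k k_carrier by (simp add: V_smult field_act_mult)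
    finally show "(\<Oplus>\<^bsub>T\<^esub>\<phi>\<in>Gal. pt (x \<otimes> galois_inv \<phi> a) (field_act b m)) = pt x (field_act (Tr a \<otimes> b) m)" .
  qed
  also have "\<dots> = pt x (field_act (list_sum K (\<lambda>(a, b). Tr a \<otimes> b) ps) m)"
    by (rule hom_add_list_sum[OF abelian_group_axioms T.abelian_group_axioms, symmetric])
      (use c x m Tr_k k_carrier in \<open>auto simp: hom_def field_act_add pt_balanced\<close>)
  also have "list_sum K (\<lambda>(a, b). Tr a \<otimes> b) ps = \<one>"
  proof -
    have "list_sum K (\<lambda>(a, b). Tr a \<otimes> b) ps = list_sum K (\<lambda>z. \<Oplus>\<phi>\<in>Gal. case z of (a, b) \<Rightarrow> galois_inv \<phi> a \<otimes> b) ps"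
      unfolding Tr_def
      by (rule list_sum_cong) (auto simp: c finsum_ldistr finite_Gal inv_cl)
    also have "\<dots> = (\<Oplus>\<phi>\<in>Gal. list_sum K (\<lambda>(a, b). galois_inv \<phi> a \<otimes> b) ps)"
      by (rule finsum_list_sum[OF finite_Gal, symmetric]) (auto simp: c inv_cl)
    \<comment> \<open>Reindexing by inversion, so that orthogonality applies to
      \<open>\<phi>\<close> itself.\<close>
    also have "\<dots> = (\<Oplus>\<phi>\<in>Gal. list_sum K (\<lambda>(a, b). \<phi> a \<otimes> b) ps)"
      by (rule finsum_galois_inv[OF abelian_group_axioms]) (auto intro!: list_sum_closed simp: c Gal_closed)
    \<comment> \<open>The neutral element is \<open>restrict id (carrier K)\<close>, the extensional
      form of the identity.\<close>
    also have "\<dots> = (\<Oplus>\<phi>\<in>Gal. if restrict id (carrier K) = \<phi> then \<one> else \<zero>)"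
    proof (rule finsum_cong')
      fix \<phi> assume \<phi>: "\<phi> \<in> Gal"
      have "(\<forall>c\<in>carrier K. \<phi> c = c) \<longleftrightarrow> restrict id (carrier K) = \<phi>"
        using \<phi> by (auto simp: galois_group_def Bij_def fun_eq_iff extensional_def)
      then show "list_sum K (\<lambda>(a, b). \<phi> a \<otimes> b) ps = (if restrict id (carrier K) = \<phi> then \<one> else \<zero>)"
        using galois_orthogonality[OF ps ps_one central_K Gal_hom[OF \<phi>] galois_group_fixes[OF \<phi>]] by simp
    qed auto
    also have "\<dots> = \<one>"
    proof -
      have "restrict id (carrier K) \<in> Gal"
        using id_Bij[of "carrier K"] k_carrier by (auto simp: galois_group_def ring_hom_def id_def)
      then show ?thesis using finsum_singleton[OF _ finite_Gal, of _ "\<lambda>_. \<one>"] by simp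
    qed
    finally show ?thesis .
  qed
  finally show "(\<Oplus>\<^bsub>T\<^esub>\<phi>\<in>Gal. sec \<phi> (twisted_mult \<phi> (pt x m))) = pt x m"
    using field_act_one[OF m] by simp
qed

abbreviation "D \<equiv> direct_sum Gal (\<lambda>\<phi>. twisted_module k K \<Lambda> \<phi> M)"

text \<open>The Galois group is finite, so the support condition in \<open>direct_sum\<close> is
  vacuous and the sum is the full product.\<close>

lemma direct_sum_simps:
  "carrier D = (\<Pi>\<^sub>E \<phi>\<in>Gal. carrier M)"
  "f \<oplus>\<^bsub>D\<^esub> g = (\<lambda>\<phi>\<in>Gal. f \<phi> \<oplus>\<^bsub>M\<^esub> g \<phi>)"
  "a \<odot>\<^bsub>D\<^esub> f = (\<lambda>\<phi>\<in>Gal. twist \<phi> a \<odot>\<^bsub>M\<^esub> f \<phi>)"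
  using finite_Gal by (auto simp: direct_sum_def twisted_module_def restrict_scalars_def PiE_def extensional_def)

text \<open>\<open>sum_sec_twisted_mult\<close> is one composite; for the other,
  \<open>twisted_mult_sec\<close> reduces the sum over the group to its summand at
  \<open>\<psi>\<close>. Linearity is \<open>twisted_mult_smult\<close> with
  \<open>twist \<phi>\<close> as the map on scalars.\<close>

lemma galois_iso: "(\<lambda>S. \<lambda>\<phi>\<in>Gal. twisted_mult \<phi> S) \<in> left_module_iso \<Gamma> T D"
proof -
  let ?h = "\<lambda>S. \<lambda>\<phi>\<in>Gal. twisted_mult \<phi> S"
  let ?g = "\<lambda>f. \<Oplus>\<^bsub>T\<^esub>\<phi>\<in>Gal. sec \<phi> (f \<phi>)"
  have tm_cl: "twisted_mult \<phi> S \<in> carrier M" if "\<phi> \<in> Gal" "S \<in> carrier T" for \<phi> S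
    using hom_add_closed[OF twisted_mult_hom'] that by blast
  have sec_cl: "sec \<phi> m \<in> carrier T" if "\<phi> \<in> Gal" "m \<in> carrier M" for \<phi> m
    using hom_add_closed[OF sec_hom] that by blast
  have hom: "?h \<in> left_module_hom \<Gamma> T D"
    using tm_cl hom_add_add[OF twisted_mult_hom']
      twisted_mult_smult[OF Gal_hom galois_group_fixes twist(1) twist(2)]
    unfolding left_module_hom_def direct_sum_simps by (auto simp: fun_eq_iff)
  have "bij_betw ?h (carrier T) (carrier D)"
  proof (rule bij_betw_byWitness[where f' = ?g])
    show "\<forall>S\<in>carrier T. ?g (?h S) = S"
    proof
      fix S assume S: "S \<in> carrier T"
      have "?g (?h S) = (\<Oplus>\<^bsub>T\<^esub>\<phi>\<in>Gal. sec \<phi> (twisted_mult \<phi> S))"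
        using S tm_cl sec_cl by (intro T.finsum_cong') auto
      then show "?g (?h S) = S" using sum_sec_twisted_mult[OF S] by simp
    qed
    show "\<forall>f\<in>carrier D. ?h (?g f) = f"
    proof
      fix f assume "f \<in> carrier D"
      then have f: "f \<in> (\<Pi>\<^sub>E \<phi>\<in>Gal. carrier M)" by (simp add: direct_sum_simps)
      have "twisted_mult \<psi> (?g f) = f \<psi>" if \<psi>: "\<psi> \<in> Gal" for \<psi>
      proof -
        have "twisted_mult \<psi> (?g f) = (\<Oplus>\<^bsub>M\<^esub>\<phi>\<in>Gal. twisted_mult \<psi> (sec \<phi> (f \<phi>)))"
          by (rule hom_add_finsum[OF T.abelian_group_axioms M.M.abelian_group_axioms twisted_mult_hom'[OF \<psi>] finite_Gal])
            (use f sec_cl in auto)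
        also have "\<dots> = (\<Oplus>\<^bsub>M\<^esub>\<phi>\<in>Gal. if \<psi> = \<phi> then f \<phi> else \<zero>\<^bsub>M\<^esub>)"
          using PiE_mem[OF f] twisted_mult_sec[OF _ \<psi>] by (intro M.M.finsum_cong') auto
        also have "\<dots> = f \<psi>"
          using f by (intro M.M.finsum_singleton[OF \<psi> finite_Gal]) auto
        finally show ?thesis .
      qed
      then show "?h (?g f) = f" using f by (auto simp: fun_eq_iff PiE_def extensional_def)
    qed
    show "?h ` carrier T \<subseteq> carrier D" using tm_cl by (auto simp: direct_sum_simps)
    show "?g ` carrier D \<subseteq> carrier T"
      using sec_cl by (auto simp: direct_sum_simps PiE_iff intro!: T.finsum_closed)
  qed
  then show ?thesis using hom by (simp add: left_module_iso_def)
qed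

end

end

theorem theorem1:
  fixes k :: "'a set" and K :: "('a, 'x) ring_scheme"
    and \<Lambda> :: "('a, 'l, 'y) module_scheme"
    and M :: "((('a \<times> 'l) \<Rightarrow>\<^sub>0 int) set, 'm, 'z) module_scheme"
  assumes "field K" and "subfield k K"
    and "ring.finite_dimension K k (carrier K)"
    and "separable_extension k K"
    and "assoc_algebra (base_field k K) \<Lambda>"
    and "finite_dim_left_module (base_field k K) (ext_algebra k K \<Lambda>) M"
  shows "split_epimorphism (ext_algebra k K \<Lambda>) (ext_module k K \<Lambda> M) M (mult_map k K \<Lambda> M) \<and>
    (normal_extension k K \<longrightarrow>
      left_module_iso (ext_algebra k K \<Lambda>) (ext_module k K \<Lambda> M)
        (direct_sum (galois_group k K) (\<lambda>\<phi>. twisted_module k K \<Lambda> \<phi> M)) \<noteq> {})"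
proof -
  interpret extension_module k K \<Lambda> M
    using assms
    by (simp add: extension_module_def algebra_extension_def field_extension_def
        field_extension_axioms_def finite_dim_left_module_def)
  obtain ps where "set ps \<subseteq> carrier K \<times> carrier K" "list_sum K (\<lambda>(x, y). x \<otimes>\<^bsub>K\<^esub> y) ps = \<one>\<^bsub>K\<^esub>"
    "central T ps = carrier K" "central K ps = carrier K"
    using exists_separability_element[OF T.abelian_group_axioms abelian_group_axioms assms(4,3)] by blast
  then interpret separability_element k K \<Lambda> M ps by unfold_locales
  show ?thesis
    using split_epimorphism_mult_map galois_iso[OF assms(3,4)] by blast
qed

end
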